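(* Let $(\beta_{\rm sd},\beta_{\rm rd},\beta_{\rm sr})\in\mathbb{R}_+^3$ and, for $\mathsf{SNR}>0$, let $S=\mathsf{SNR}^{\beta_{\rm sd}}$, $I=\mathsf{SNR}^{\beta_{\rm rd}}$, $C=\mathsf{SNR}^{\beta_{\rm sr}}$. Let $C^{\rm(HD\text{-}RC)}(\mathsf{SNR})$ be the capacity of the Gaussian half-duplex relay channel with these gains. Then the generalized degrees of freedom $$\mathsf{d}^{\rm(HD\text{-}RC)}:=\lim_{\mathsf{SNR}\to+\infty}\frac{C^{\rm(HD\text{-}RC)}(\mathsf{SNR})}{\log(1+\mathsf{SNR})}$$ exists and equals $$\mathsf{d}^{\rm(HD\text{-}RC)}=\begin{cases}\beta_{\rm sd}+\dfrac{(\beta_{\rm rd}-\beta_{\rm sd})(\beta_{\rm sr}-\beta_{\rm sd})}{(\beta_{\rm rd}-\beta_{\rm sd})+(\beta_{\rm sr}-\beta_{\rm sd})} & \text{if } \beta_{\rm sr}>\beta_{\rm sd} \text{ and } \beta_{\rm rd}>\beta_{\rm sd},\\[2mm] \beta_{\rm sd} & \text{otherwise.}\end{cases}$$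
   Context: Gaussian half-duplex relay channel (G-HD-RC): a source with message $W\in[1:2^{NR}]$ sends $X_{s,i}(W)\in\mathbb{C}$ at times $i\in[1:N]$; the relay at time $i$ chooses a channel input pair $(X_{r,i},S_{r,i})$, $X_{r,i}\in\mathbb{C}$, $S_{r,i}\in\{0,1\}$, as a (possibly randomized) function of its past outputs $Y_r^{i-1}$; $S_r=0$ means the relay listens and $S_r=1$ means it transmits (so the state may itself carry information). The memoryless outputs are $Y_r=\sqrt{C}\,X_s(1-S_r)+Z_r$ and $Y_d=\sqrt{S}\,X_s+e^{j\theta}\sqrt{I}\,X_rS_r+Z_d$, with constants $C,S,I\ge 0$, $\theta\in\mathbb{R}$, and $Z_r,Z_d$ independent circularly-symmetric complex Gaussian with unit variance, i.i.d. over time. Inputs satisfy average power constraints $\mathbb{E}|X_s|^2\le 1$, $\mathbb{E}|X_r|^2\le1$. The destination decodes $W$ from $Y_d^N$; a rate is achievable if the error probability can be made arbitrarily small, and the capacity $C^{\rm(HD\text{-}RC)}$ is the supremum of achievable rates. Logarithms are base 2 (rates in bits per channel use). *)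

theory Defs
  imports "HOL-Probability.Probability"
begin

text \<open>Gaussian half-duplex relay channel (G-HD-RC). Time indices are 0..N-1 and
messages are 0..M-1 (shifted from the paper's 1-based indexing).\<close>

definition cgauss :: "complex measure" where
  "cgauss = density lborel (\<lambda>z. ennreal (exp (- (cmod z)\<^sup>2) / pi))"

text \<open>Probability space of the randomness: relay noise sequence Z_r, destination
noise sequence Z_d (both i.i.d. CN(0,1)), and a private uniform seed U in [0,1]
used by the (possibly randomized) relay.\<close>
definition noise_space :: "(((nat \<Rightarrow> complex) \<times> (nat \<Rightarrow> complex)) \<times> real) measure" where
  "noise_space =
     (PiM UNIV (\<lambda>_. cgauss) \<Otimes>\<^sub>M PiM UNIV (\<lambda>_. cgauss)) \<Otimes>\<^sub>M uniform_measure lborel {0..1}"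

text \<open>A relay strategy: at time i it maps its past outputs Y_r^{i-1} (given as a
sequence that is zero from index i on) and its seed to (X_{r,i}, S_{r,i});
the boolean True means S_r = 1 (transmit), False means S_r = 0 (listen).\<close>
type_synonym relay_fn = "nat \<Rightarrow> (nat \<Rightarrow> complex) \<Rightarrow> real \<Rightarrow> complex \<times> bool"

fun yr_past :: "real \<Rightarrow> (nat \<Rightarrow> complex) \<Rightarrow> relay_fn \<Rightarrow> (nat \<Rightarrow> complex) \<Rightarrow> real
                  \<Rightarrow> nat \<Rightarrow> (nat \<Rightarrow> complex)" where
  "yr_past C x rl zr u 0 = (\<lambda>_. 0)"
| "yr_past C x rl zr u (Suc i) =
     (let h = yr_past C x rl zr u i; s = snd (rl i h u)
      in h(i := complex_of_real (sqrt C) * x i * (if s then 0 else 1) + zr i))"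

definition relay_input :: "real \<Rightarrow> (nat \<Rightarrow> complex) \<Rightarrow> relay_fn \<Rightarrow> (nat \<Rightarrow> complex) \<Rightarrow> real
                            \<Rightarrow> nat \<Rightarrow> complex \<times> bool" where
  "relay_input C x rl zr u i = rl i (yr_past C x rl zr u i) u"

definition dest_out :: "real \<Rightarrow> real \<Rightarrow> real \<Rightarrow> real \<Rightarrow> nat \<Rightarrow> (nat \<Rightarrow> complex) \<Rightarrow> relay_fn
                         \<Rightarrow> (nat \<Rightarrow> complex) \<Rightarrow> (nat \<Rightarrow> complex) \<Rightarrow> real \<Rightarrow> (nat \<Rightarrow> complex)" where
  "dest_out C S I \<theta> N x rl zr zd u =
     (\<lambda>j. if j < N then
            complex_of_real (sqrt S) * x j
            + cis \<theta> * complex_of_real (sqrt I) * fst (relay_input C x rl zr u j)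
                * (if snd (relay_input C x rl zr u j) then 1 else 0)
            + zd j
          else 0)"

text \<open>Admissible code of block length N with M messages: source codebook x m i,
measurable relay strategy, measurable decoder, and average power constraints
(1/N) sum_i E|X_{s,i}|^2 <= 1 and (1/N) sum_i E|X_{r,i}|^2 <= 1, expectations over
the uniform message, the noises and the relay seed.\<close>
definition hd_code_ok ::
  "real \<Rightarrow> nat \<Rightarrow> nat \<Rightarrow> (nat \<Rightarrow> nat \<Rightarrow> complex) \<Rightarrow> relay_fn \<Rightarrow> ((nat \<Rightarrow> complex) \<Rightarrow> nat) \<Rightarrow> bool" where
  "hd_code_ok C N M x rl dec \<longleftrightarrow>
     (\<forall>i. (\<lambda>(h, u). rl i h u)
            \<in> measurable (PiM UNIV (\<lambda>_. borel) \<Otimes>\<^sub>M borel) (borel \<Otimes>\<^sub>M count_space UNIV))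
   \<and> dec \<in> measurable (PiM UNIV (\<lambda>_. borel)) (count_space UNIV)
   \<and> (\<Sum>m<M. \<Sum>i<N. (cmod (x m i))\<^sup>2) \<le> real M * real N
   \<and> (\<Sum>m<M. \<Sum>i<N. \<integral>\<^sup>+ \<omega>. ennreal ((cmod (fst (relay_input C (x m) rl (fst (fst \<omega>)) (snd \<omega>) i)))\<^sup>2)
                        \<partial>noise_space) \<le> ennreal (real M * real N)"

definition hd_err_prob ::
  "real \<Rightarrow> real \<Rightarrow> real \<Rightarrow> real \<Rightarrow> nat \<Rightarrow> nat \<Rightarrow> (nat \<Rightarrow> nat \<Rightarrow> complex) \<Rightarrow> relay_fn
    \<Rightarrow> ((nat \<Rightarrow> complex) \<Rightarrow> nat) \<Rightarrow> real" where
  "hd_err_prob C S I \<theta> N M x rl dec =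
     (\<Sum>m<M. measure noise_space
        {\<omega> \<in> space noise_space.
           dec (dest_out C S I \<theta> N (x m) rl (fst (fst \<omega>)) (snd (fst \<omega>)) (snd \<omega>)) \<noteq> m}) / real M"

definition hd_achievable :: "real \<Rightarrow> real \<Rightarrow> real \<Rightarrow> real \<Rightarrow> real \<Rightarrow> bool" where
  "hd_achievable C S I \<theta> R \<longleftrightarrow>
     (\<forall>\<epsilon>>0. \<forall>N0. \<exists>N\<ge>N0. N > 0 \<and>
        (\<exists>x rl dec. let M = nat \<lceil>2 powr (real N * R)\<rceil> in
            hd_code_ok C N M x rl dec \<and> hd_err_prob C S I \<theta> N M x rl dec \<le> \<epsilon>))"

definition hd_capacity :: "real \<Rightarrow> real \<Rightarrow> real \<Rightarrow> real \<Rightarrow> real" where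
  "hd_capacity C S I \<theta> = Sup {R. hd_achievable C S I \<theta> R}"

end

theory Submission
  imports Defs "HOL-Real_Asymp.Real_Asymp"
begin

text \<open>Converse. For positive \<open>r\<close> and \<open>c\<close> one has \<open>- ln r \<ge> ln c + 1 - c r\<close>. Applied with \<open>r\<close> the density
  ratio of a reference output law, common to all messages, to the actual one, and with \<open>c\<close> equal to the
  number \<open>M\<close> of messages on the event of correct decoding and to 1 elsewhere, it bounds
  \<open>(1 - e) ln M\<close>, for the error probability \<open>e\<close>, by 1 plus the mean of \<open>- ln r\<close>. Two reference laws, built
  letter by letter, play the role of the two cuts: one for the outputs of relay and destination, one for
  the output of the destination alone, where mixing over the relay state costs one bit per use. Up to
  constants they give
  \<open>\<tau> ln (1 + C + S) + (1 - \<tau>) ln (1 + S)\<close> and \<open>\<tau> ln (1 + S) + (1 - \<tau>) ln (1 + S + I)\<close> for the same listening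
  fraction \<open>\<tau>\<close>, and a suitable convex combination of the two does not depend on \<open>\<tau>\<close> to first order.

  Achievability. In a frame of fixed length the source sends uncoded grid points. The relay first listens
  and resolves them; it then forwards their residues modulo the resolution of the destination, on top of
  fresh source symbols. The frame is read off correctly whenever all its noises are bounded by a constant
  \<open>t\<close>, so for large \<open>t\<close> a Gilbert--Varshamov code across frames corrects the remaining small fraction of
  bad frames, at a rate loss that is small relative to \<open>ln SNR\<close>.\<close>

section \<open>Change of measure for Gaussian noise\<close>

text \<open>Only the coefficient of ln SNR matters, so a bounded loss per use is free on both sides;
  crude second moments, uncoded grids and a rough Hamming ball volume suffice. Likelihood ratios in
  place of entropies leave one pointwise inequality and nonnegative integrals. The obstacle in the
  converse is a relay that is adaptive and randomized and whose state carries information. Its state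
  is a function of the seed and of past relay outputs, and the seed has the same law for all
  messages; hence a reference law containing the relay output may adapt its variance to the state.
  The destination alone does not see the state, hence the mixture there. Both means are taken under
  the true law, which is why one listening fraction serves both bounds. In the construction the
  frame length, \<open>t\<close> and the distance of the outer code are fixed before SNR grows, and
  the relay uses the current frame only, so a loud sample spoils a single frame. The best listening
  fraction and the best weight of the broadcast cut are the same number \<open>b / (a + b)\<close>,
  for \<open>a = \<beta>sr - \<beta>sd\<close> and \<open>b = \<beta>rd - \<beta>sd\<close>.\<close>

definition cn :: "real \<Rightarrow> complex \<Rightarrow> real" where
  "cn v y = exp (- (cmod y)\<^sup>2 / v) / (pi * v)"

lemma cn_pos: "v > 0 \<Longrightarrow> cn v y > 0"
  by (simp add: cn_def)

lemma measurable_cn [measurable]: "cn v \<in> borel_measurable borel"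
  unfolding cn_def by measurable

text \<open>The density is a product of two real normal densities of variance \<open>v / 2\<close>,
  one for each coordinate of the complex plane.\<close>

lemma nn_integral_cn:
  assumes "v > 0"
  shows "(\<integral>\<^sup>+ y. ennreal (cn v y) \<partial>lborel) = 1"
proof -
  let ?f = "\<lambda>(b::complex) x. normal_density 0 (sqrt (v / 2)) x"
  have eq: "ennreal (cn v y) = (\<Prod>b\<in>Basis. ennreal (?f b (y \<bullet> b)))" for y
  proof -
    have "cn v y = normal_density 0 (sqrt (v / 2)) (Re y) * normal_density 0 (sqrt (v / 2)) (Im y)"
      using assms by (simp add: cn_def normal_density_def cmod_power2 exp_add[symmetric] add_divide_distrib diff_divide_distrib)
    also have "\<dots> = (\<Prod>b\<in>Basis. ?f b (y \<bullet> b))"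
      by (simp add: Basis_complex_def)
    finally show ?thesis
      by (simp add: prod_ennreal)
  qed
  have one: "(\<integral>\<^sup>+ x. ennreal (normal_density 0 (sqrt (v / 2)) x) \<partial>lborel) = 1"
    using assms by (subst nn_integral_eq_integral) auto
  show ?thesis
    unfolding eq using nn_integral_lborel_prod[of ?f] by (simp add: prod_ennreal one)
qed

lemma cgauss_density: "cgauss = density lborel (\<lambda>z. ennreal (cn 1 z))"
  by (simp add: cgauss_def cn_def)

lemma sets_cgauss [simp, measurable_cong]: "sets cgauss = sets borel"
  and space_cgauss [simp]: "space cgauss = UNIV"
  by (simp_all add: cgauss_def)

lemma prob_space_cgauss: "prob_space cgauss"
  by (rule prob_spaceI) (simp add: cgauss_density emeasure_density nn_integral_cn)

lemma nn_integral_cgauss: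
  "f \<in> borel_measurable borel \<Longrightarrow>
    (\<integral>\<^sup>+ z. f z \<partial>cgauss) = (\<integral>\<^sup>+ z. ennreal (cn 1 z) * f z \<partial>lborel)"
  by (simp add: cgauss_density nn_integral_density)

text \<open>From x \<le> exp x with x half the squared modulus, the integrand is at most 4 times the
  density \<open>cn 2\<close>. The true value is 1; the slack only affects constants.\<close>

lemma cgauss_second_moment: "(\<integral>\<^sup>+ z. ennreal ((cmod z)\<^sup>2) \<partial>cgauss) \<le> 4"
proof -
  have "(\<integral>\<^sup>+ z. ennreal ((cmod z)\<^sup>2) \<partial>cgauss)
      = (\<integral>\<^sup>+ z. ennreal (cn 1 z * (cmod z)\<^sup>2) \<partial>lborel)"
    by (subst nn_integral_cgauss) (auto simp: ennreal_mult' cn_pos less_imp_le)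
  also have "\<dots> \<le> (\<integral>\<^sup>+ z. ennreal 4 * ennreal (cn 2 z) \<partial>lborel)"
  proof (rule nn_integral_mono)
    fix z :: complex
    have "(cmod z)\<^sup>2 / 2 \<le> exp ((cmod z)\<^sup>2 / 2)"
      using exp_ge_add_one_self[of "(cmod z)\<^sup>2 / 2"] by linarith
    hence "exp (- (cmod z)\<^sup>2) * (cmod z)\<^sup>2 \<le> exp (- (cmod z)\<^sup>2) * (2 * exp ((cmod z)\<^sup>2 / 2))"
      by (intro mult_left_mono) auto
    also have "\<dots> = 2 * exp (- (cmod z)\<^sup>2 / 2)"
      by (simp add: exp_add[symmetric])
    finally have "cn 1 z * (cmod z)\<^sup>2 \<le> 4 * cn 2 z"
      by (simp add: cn_def field_simps)
    thus "ennreal (cn 1 z * (cmod z)\<^sup>2) \<le> ennreal 4 * ennreal (cn 2 z)"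
      by (subst ennreal_mult'[symmetric]) (auto intro: ennreal_leI)
  qed
  also have "\<dots> = 4"
    by (subst nn_integral_cmult) (auto simp: nn_integral_cn)
  finally show ?thesis .
qed

abbreviation noise_seq :: "(nat \<Rightarrow> complex) measure" where
  "noise_seq \<equiv> PiM UNIV (\<lambda>_. cgauss)"

abbreviation cseq :: "(nat \<Rightarrow> complex) measure" where
  "cseq \<equiv> PiM UNIV (\<lambda>_. borel)"

lemma sets_noise_seq [measurable_cong]: "sets noise_seq = sets cseq"
  by (intro sets_PiM_cong) auto

lemma prob_space_noise_seq: "prob_space noise_seq"
  by (intro prob_space_PiM prob_space_cgauss)

lemma measurable_cseq_upd [measurable (raw)]:
  assumes "f \<in> measurable M cseq" "g \<in> borel_measurable M"
  shows "(\<lambda>x. (f x)(n := g x)) \<in> measurable M cseq"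
proof (rule measurable_PiM_single')
  fix i :: nat
  have "(\<lambda>x. f x i) \<in> borel_measurable M"
    using measurable_compose[OF assms(1) measurable_component_singleton[of i UNIV "\<lambda>_. borel"]] by simp
  thus "(\<lambda>x. ((f x)(n := g x)) i) \<in> borel_measurable M"
    using assms(2) by (cases "i = n") auto
qed auto

text \<open>Overwriting one coordinate of an i.i.d. sequence by a fresh sample preserves its law.
  This isolates the noise of a single time without splitting the product space.\<close>

lemma nn_integral_resample:
  assumes [measurable]: "f \<in> borel_measurable cseq"
  shows "(\<integral>\<^sup>+ w. f w \<partial>noise_seq) = (\<integral>\<^sup>+ w. (\<integral>\<^sup>+ z. f (w(i := z)) \<partial>cgauss) \<partial>noise_seq)"
proof -
  interpret G: prob_space cgauss by (rule prob_space_cgauss)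
  interpret P: prob_space noise_seq by (rule prob_space_noise_seq)
  interpret pair_sigma_finite cgauss noise_seq ..
  have "distr (cgauss \<Otimes>\<^sub>M noise_seq) noise_seq (\<lambda>(x, X). X(i := x)) = noise_seq"
    using distr_pair_PiM_eq_PiM[of UNIV "\<lambda>_. cgauss" i] prob_space_cgauss by simp
  hence "(\<integral>\<^sup>+ w. f w \<partial>noise_seq)
      = (\<integral>\<^sup>+ w. f w \<partial>(distr (cgauss \<Otimes>\<^sub>M noise_seq) noise_seq (\<lambda>(x, X). X(i := x))))"
    by simp
  also have "\<dots> = (\<integral>\<^sup>+ p. f ((snd p)(i := fst p)) \<partial>(cgauss \<Otimes>\<^sub>M noise_seq))"
    by (subst nn_integral_distr) (auto simp: split_beta)
  also have "\<dots> = (\<integral>\<^sup>+ w. (\<integral>\<^sup>+ z. f (w(i := z)) \<partial>cgauss) \<partial>noise_seq)"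
    by (subst nn_integral_snd[symmetric]) auto
  finally show ?thesis .
qed


section \<open>Paths with additive noise and history-dependent shifts\<close>

primrec causal_path :: "(nat \<Rightarrow> (nat \<Rightarrow> complex) \<Rightarrow> complex) \<Rightarrow> (nat \<Rightarrow> complex) \<Rightarrow> nat \<Rightarrow> nat \<Rightarrow> complex" where
  "causal_path a w 0 = (\<lambda>_. 0)"
| "causal_path a w (Suc n) = (causal_path a w n)(n := a n (causal_path a w n) + w n)"

text \<open>Entries not yet written are 0, the convention of \<open>yr_past\<close> and
  \<open>dest_out\<close>, so that paths of every length live in the same sequence space.\<close>

lemma causal_path_eq_0: "n \<le> j \<Longrightarrow> causal_path a w n j = 0"
  by (induction n) auto

lemma causal_path_cong_noise: "(\<And>j. j < n \<Longrightarrow> w j = w' j) \<Longrightarrow> causal_path a w n = causal_path a w' n"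
  by (induction n) auto

lemma causal_path_upd: "n \<le> i \<Longrightarrow> causal_path a (w(i := z)) n = causal_path a w n"
  by (rule causal_path_cong_noise) auto

lemma causal_path_stable: "j < n \<Longrightarrow> n \<le> n' \<Longrightarrow> causal_path a w n' j = causal_path a w n j"
  by (induction n' rule: nat_induct) (auto simp: le_Suc_eq)

lemma measurable_cseq_component:
  "f \<in> measurable M cseq \<Longrightarrow> (\<lambda>x. f x i) \<in> borel_measurable M"
  using measurable_compose[OF _ measurable_component_singleton[of i UNIV "\<lambda>_. borel"]] by simp

lemma measurable_const_cseq [measurable]: "(\<lambda>_. f) \<in> measurable M cseq"
  by (auto simp: space_PiM)

lemma measurable_causal_path:
  assumes a: "\<And>n. (\<lambda>(x, h). a x n h) \<in> borel_measurable (M \<Otimes>\<^sub>M cseq)"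
    and w[measurable]: "w \<in> measurable M cseq"
  shows "(\<lambda>x. causal_path (a x) (w x) n) \<in> measurable M cseq"
proof (induction n)
  case 0
  show ?case by simp
next
  case (Suc n)
  note [measurable] = Suc measurable_cseq_component[OF w]
  have [measurable]: "(\<lambda>x. a x n (causal_path (a x) (w x) n)) \<in> borel_measurable M"
    using measurable_compose[OF measurable_Pair[OF measurable_ident Suc] a[of n]] by simp
  thus ?case unfolding causal_path.simps by measurable
qed

text \<open>The factor at time \<open>i\<close> replaces the law of the \<open>i\<close>-th symbol of the path given its past, a shifted
  Gaussian, by the law with Lebesgue density \<open>k i\<close>; the shift then no longer matters.\<close>

definition reweighted ::
  "(nat \<Rightarrow> (nat \<Rightarrow> complex) \<Rightarrow> real) \<Rightarrow> nat \<Rightarrow> (nat \<Rightarrow> (nat \<Rightarrow> complex) \<Rightarrow> complex)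
    \<Rightarrow> ((nat \<Rightarrow> complex) \<Rightarrow> ennreal) \<Rightarrow> ennreal" where
  "reweighted k n a F =
    (\<integral>\<^sup>+ w. F (causal_path a w n) * (\<Prod>i<n. ennreal (k i (causal_path a w (Suc i)) / cn 1 (w i))) \<partial>noise_seq)"

text \<open>Resampling the last noise sample exposes an integral against \<open>cn 1\<close>. The
  denominator of the last factor cancels this density and leaves Lebesgue measure, whose translation
  invariance absorbs the shift \<open>a n\<close>; the earlier factors do not see the last
  sample.\<close>

lemma reweighted_Suc:
  assumes a [measurable]: "\<And>n. a n \<in> borel_measurable cseq"
    and k [measurable]: "\<And>n. k n \<in> borel_measurable cseq"
    and k_nonneg: "\<And>n h. k n h \<ge> 0"
    and F [measurable]: "F \<in> borel_measurable cseq"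
  shows "reweighted k (Suc n) a F =
    reweighted k n a (\<lambda>h. \<integral>\<^sup>+ y. F (h(n := y)) * ennreal (k n (h(n := y))) \<partial>lborel)"
proof -
  have inner: "(\<integral>\<^sup>+ z. F (h(n := c + z)) * ennreal (k n (h(n := c + z)) / cn 1 z) \<partial>cgauss)
      = (\<integral>\<^sup>+ y. F (h(n := y)) * ennreal (k n (h(n := y))) \<partial>lborel)" for h c
  proof -
    have "(\<integral>\<^sup>+ z. F (h(n := c + z)) * ennreal (k n (h(n := c + z)) / cn 1 z) \<partial>cgauss)
        = (\<integral>\<^sup>+ z. F (h(n := c + z)) * ennreal (k n (h(n := c + z))) \<partial>lborel)"
    proof (subst nn_integral_cgauss, measurable, rule nn_integral_cong)
      fix z
      have "ennreal (cn 1 z) * ennreal (k n (h(n := c + z)) / cn 1 z) = ennreal (k n (h(n := c + z)))"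
        using cn_pos[of 1 z] k_nonneg by (subst ennreal_mult'[symmetric]) auto
      thus "ennreal (cn 1 z) * (F (h(n := c + z)) * ennreal (k n (h(n := c + z)) / cn 1 z))
          = F (h(n := c + z)) * ennreal (k n (h(n := c + z)))"
        by (metis mult.left_commute)
    qed
    also have "\<dots> = (\<integral>\<^sup>+ y. F (h(n := y)) * ennreal (k n (h(n := y))) \<partial>distr lborel borel ((+) c))"
      by (subst nn_integral_distr) auto
    finally show ?thesis by (simp only: lborel_distr_plus)
  qed
  have [measurable]: "(\<lambda>w. causal_path a w n) \<in> measurable cseq cseq" for n
    by (rule measurable_causal_path) measurable
  have split: "F (causal_path a (w(n := z)) (Suc n))
      * (\<Prod>i<Suc n. ennreal (k i (causal_path a (w(n := z)) (Suc i)) / cn 1 ((w(n := z)) i)))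
    = F ((causal_path a w n)(n := a n (causal_path a w n) + z))
      * ((\<Prod>i<n. ennreal (k i (causal_path a w (Suc i)) / cn 1 (w i)))
      * ennreal (k n ((causal_path a w n)(n := a n (causal_path a w n) + z)) / cn 1 z))" for w z
  proof -
    have "(\<Prod>i<n. ennreal (k i (causal_path a (w(n := z)) (Suc i)) / cn 1 ((w(n := z)) i)))
        = (\<Prod>i<n. ennreal (k i (causal_path a w (Suc i)) / cn 1 (w i)))"
    proof (rule prod.cong)
      fix i assume "i \<in> {..<n}"
      hence i: "Suc i \<le> n" "(w(n := z)) i = w i" by auto
      show "ennreal (k i (causal_path a (w(n := z)) (Suc i)) / cn 1 ((w(n := z)) i))
          = ennreal (k i (causal_path a w (Suc i)) / cn 1 (w i))"
        by (simp only: causal_path_upd[OF i(1)] i(2))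
    qed simp
    moreover have "causal_path a (w(n := z)) (Suc n) = (causal_path a w n)(n := a n (causal_path a w n) + z)"
      unfolding causal_path.simps by (simp only: causal_path_upd fun_upd_same le_refl)
    ultimately show ?thesis
      by (simp only: prod.lessThan_Suc fun_upd_same)
  qed
  have "reweighted k (Suc n) a F =
    (\<integral>\<^sup>+ w. (\<integral>\<^sup>+ z. F ((causal_path a w n)(n := a n (causal_path a w n) + z))
        * ((\<Prod>i<n. ennreal (k i (causal_path a w (Suc i)) / cn 1 (w i)))
        * ennreal (k n ((causal_path a w n)(n := a n (causal_path a w n) + z)) / cn 1 z)) \<partial>cgauss) \<partial>noise_seq)"
    unfolding reweighted_def
    by (subst nn_integral_resample[where i = n], measurable) (simp only: split)
  also have "\<dots> = (\<integral>\<^sup>+ w. (\<Prod>i<n. ennreal (k i (causal_path a w (Suc i)) / cn 1 (w i)))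
      * (\<integral>\<^sup>+ z. F ((causal_path a w n)(n := a n (causal_path a w n) + z))
        * ennreal (k n ((causal_path a w n)(n := a n (causal_path a w n) + z)) / cn 1 z) \<partial>cgauss) \<partial>noise_seq)"
    by (intro nn_integral_cong, subst nn_integral_cmult[symmetric])
       (auto intro!: nn_integral_cong simp: mult_ac)
  also have "\<dots> = reweighted k n a (\<lambda>h. \<integral>\<^sup>+ y. F (h(n := y)) * ennreal (k n (h(n := y))) \<partial>lborel)"
    unfolding inner reweighted_def by (simp add: mult.commute)
  finally show ?thesis .
qed

text \<open>Each peeled letter takes its shift with it, so induction removes all of them. A codeword
  enters a path only through the shift, and this is what makes the reference law common to all
  messages.\<close>

lemma reweighted_shift:
  assumes a: "\<And>n. a n \<in> borel_measurable cseq" and b: "\<And>n. b n \<in> borel_measurable cseq"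
    and k: "\<And>n. k n \<in> borel_measurable cseq"
    and k_nonneg: "\<And>n h. k n h \<ge> 0"
    and F: "F \<in> borel_measurable cseq"
  shows "reweighted k n a F = reweighted k n b F"
  using F
proof (induction n arbitrary: F)
  case 0
  show ?case by (simp add: reweighted_def)
next
  case (Suc n)
  note [measurable] = Suc.prems k
  have "(\<lambda>h. \<integral>\<^sup>+ y. F (h(n := y)) * ennreal (k n (h(n := y))) \<partial>lborel) \<in> borel_measurable cseq"
    by measurable
  from Suc.IH[OF this] show ?case
    unfolding reweighted_Suc[OF a k k_nonneg Suc.prems] reweighted_Suc[OF b k k_nonneg Suc.prems] .
qed

lemma reweighted_1:
  assumes a: "\<And>n. a n \<in> borel_measurable cseq"
    and k [measurable]: "\<And>n. k n \<in> borel_measurable cseq"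
    and k_nonneg: "\<And>n h. k n h \<ge> 0"
    and k_prob: "\<And>n h. (\<integral>\<^sup>+ y. ennreal (k n (h(n := y))) \<partial>lborel) = 1"
  shows "reweighted k n a (\<lambda>_. 1) = 1"
proof (induction n)
  case 0
  interpret prob_space noise_seq by (rule prob_space_noise_seq)
  show ?case by (simp add: reweighted_def emeasure_space_1)
next
  case (Suc n)
  show ?case
    by (subst reweighted_Suc) (use a k k_nonneg Suc in \<open>auto simp: k_prob\<close>)
qed

text \<open>On \<open>A m\<close>, the event of correct decoding, ln x \<le> x - 1 is used at
  \<open>n * r\<close>, elsewhere at \<open>r\<close>. The mean of \<open>r\<close> is 1 and cancels
  the 1 of that inequality; \<open>mass_A\<close> bounds the terms \<open>n * r\<close> by
  \<open>n\<close> over all messages together, hence by 1 per message. The majorant \<open>U\<close>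
  of \<open>- ln r\<close> keeps the integrands nonnegative, and for the same reason the 1 is
  carried on both sides until the end.\<close>

lemma (in prob_space) fano_change_of_measure:
  fixes A :: "nat \<Rightarrow> 'a set" and r U :: "nat \<Rightarrow> 'a \<Rightarrow> real"
  assumes n: "n > 0"
    and A [measurable]: "\<And>m. m < n \<Longrightarrow> A m \<in> events"
    and r [measurable]: "\<And>m. m < n \<Longrightarrow> r m \<in> borel_measurable M"
    and U [measurable]: "\<And>m. m < n \<Longrightarrow> U m \<in> borel_measurable M"
    and r_pos: "\<And>m w. m < n \<Longrightarrow> w \<in> space M \<Longrightarrow> r m w > 0"
    and r_U: "\<And>m w. m < n \<Longrightarrow> w \<in> space M \<Longrightarrow> - ln (r m w) \<le> U m w"
    and U_nonneg: "\<And>m w. m < n \<Longrightarrow> w \<in> space M \<Longrightarrow> U m w \<ge> 0"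
    and mass: "\<And>m. m < n \<Longrightarrow> (\<integral>\<^sup>+ w. ennreal (r m w) \<partial>M) = 1"
    and mass_A: "(\<Sum>m<n. \<integral>\<^sup>+ w. indicator (A m) w * ennreal (r m w) \<partial>M) \<le> 1"
  shows "(\<Sum>m<n. ennreal (prob (A m) * ln n)) \<le> (\<Sum>m<n. \<integral>\<^sup>+ w. ennreal (U m w) \<partial>M) + of_nat n"
proof -
  have ln_n: "ln (real n) \<ge> 0" using n by simp
  have each: "ennreal (prob (A m) * ln n) + 1
      \<le> (\<integral>\<^sup>+ w. ennreal (U m w) \<partial>M) + (of_nat n * (\<integral>\<^sup>+ w. indicator (A m) w * ennreal (r m w) \<partial>M) + 1)"
    if m: "m < n" for m
  proof -
    note [measurable] = A[OF m] r[OF m] U[OF m]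
    have "ennreal (prob (A m) * ln n) + 1
        = (\<integral>\<^sup>+ w. ennreal (ln n) * indicator (A m) w + 1 \<partial>M)"
      using ln_n by (subst nn_integral_add)
        (auto simp: nn_integral_cmult_indicator emeasure_space_1 emeasure_eq_measure prob_space ennreal_mult' mult.commute)
    also have "\<dots> \<le> (\<integral>\<^sup>+ w. ennreal (U m w) + (of_nat n * (indicator (A m) w * ennreal (r m w))
        + ennreal (r m w)) \<partial>M)"
    proof (rule nn_integral_mono)
      fix w assume w: "w \<in> space M"
      have pos: "r m w > 0" using r_pos[OF m w] .
      have *: "ln (real n) + 1 \<le> U m w + (real n * r m w + r m w)"
      proof -
        have "ln (real n * r m w) \<le> real n * r m w - 1"
          using n pos by (intro ln_le_minus_one) simp
        thus ?thesis using r_U[OF m w] n pos by (simp add: ln_mult)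
      qed
      have **: "1 \<le> U m w + r m w"
        using r_U[OF m w] ln_le_minus_one[OF pos] by linarith
      show "ennreal (ln n) * indicator (A m) w + 1 \<le> ennreal (U m w)
          + (of_nat n * (indicator (A m) w * ennreal (r m w)) + ennreal (r m w))"
      proof (cases "w \<in> A m")
        case True
        have "ennreal (ln n) + 1 = ennreal (ln n + 1)"
          using ln_n by (simp add: ennreal_plus)
        also have "\<dots> \<le> ennreal (U m w + (real n * r m w + r m w))"
          using * by (rule ennreal_leI)
        also have "\<dots> = ennreal (U m w) + (of_nat n * ennreal (r m w) + ennreal (r m w))"
          using pos U_nonneg[OF m w] by (simp add: ennreal_plus ennreal_mult ennreal_of_nat_eq_real_of_nat)
        finally show ?thesis using True by simp
      next
        case False
        have "1 \<le> ennreal (U m w + r m w)"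
          using ** by (metis ennreal_1 ennreal_leI)
        thus ?thesis using False pos U_nonneg[OF m w] by (simp add: ennreal_plus)
      qed
    qed
    also have "\<dots> = (\<integral>\<^sup>+ w. ennreal (U m w) \<partial>M)
        + (of_nat n * (\<integral>\<^sup>+ w. indicator (A m) w * ennreal (r m w) \<partial>M) + 1)"
      by (simp add: nn_integral_add nn_integral_cmult mass[OF m])
    finally show ?thesis .
  qed
  have "(\<Sum>m<n. ennreal (prob (A m) * ln n)) + of_nat n
      = (\<Sum>m<n. ennreal (prob (A m) * ln n) + 1)"
    by (simp add: sum.distrib)
  also have "\<dots> \<le> (\<Sum>m<n. (\<integral>\<^sup>+ w. ennreal (U m w) \<partial>M)
      + (of_nat n * (\<integral>\<^sup>+ w. indicator (A m) w * ennreal (r m w) \<partial>M) + 1))"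
    by (intro sum_mono each) auto
  also have "\<dots> = (\<Sum>m<n. \<integral>\<^sup>+ w. ennreal (U m w) \<partial>M)
      + of_nat n * (\<Sum>m<n. \<integral>\<^sup>+ w. indicator (A m) w * ennreal (r m w) \<partial>M) + of_nat n"
    by (simp add: sum.distrib sum_distrib_left add.assoc)
  also have "\<dots> \<le> (\<Sum>m<n. \<integral>\<^sup>+ w. ennreal (U m w) \<partial>M) + of_nat n * 1 + of_nat n"
    by (intro add_mono mult_left_mono mass_A) auto
  finally have "of_nat n + (\<Sum>m<n. ennreal (prob (A m) * ln n))
      \<le> of_nat n + ((\<Sum>m<n. \<integral>\<^sup>+ w. ennreal (U m w) \<partial>M) + of_nat n)"
    by (simp add: ac_simps)
  thus ?thesis
    by (subst (asm) ennreal_add_left_cancel_le) auto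
qed

section \<open>The joint law of seed and noises\<close>

abbreviation seed :: "real measure" where
  "seed \<equiv> uniform_measure lborel {0..1}"

lemma prob_space_seed: "prob_space seed"
  by (rule prob_space_uniform_measure) auto

lemma sets_noise_space [measurable_cong]: "sets noise_space = sets ((cseq \<Otimes>\<^sub>M cseq) \<Otimes>\<^sub>M borel)"
  unfolding noise_space_def by (intro sets_pair_measure_cong sets_noise_seq) auto

lemma space_noise_space [simp]: "space noise_space = UNIV"
  by (simp add: noise_space_def space_pair_measure space_PiM)

lemma prob_space_noise_space: "prob_space noise_space"
proof -
  interpret Z: prob_space noise_seq by (rule prob_space_noise_seq)
  interpret U: prob_space seed by (rule prob_space_seed)
  interpret ZZ: pair_prob_space noise_seq noise_seq ..
  interpret ZZU: pair_prob_space "noise_seq \<Otimes>\<^sub>M noise_seq" seed ..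
  show ?thesis unfolding noise_space_def by (rule ZZU.prob_space_axioms)
qed

text \<open>The seed is outermost and the destination noise innermost: while the latter is
  integrated, the inputs of the relay are constants.\<close>

lemma nn_integral_noise_space:
  assumes f [measurable]: "f \<in> borel_measurable ((cseq \<Otimes>\<^sub>M cseq) \<Otimes>\<^sub>M borel)"
  shows "(\<integral>\<^sup>+ \<omega>. f \<omega> \<partial>noise_space)
    = (\<integral>\<^sup>+ u. (\<integral>\<^sup>+ zr. (\<integral>\<^sup>+ zd. f ((zr, zd), u) \<partial>noise_seq) \<partial>noise_seq) \<partial>seed)"
proof -
  interpret Z: prob_space noise_seq by (rule prob_space_noise_seq)
  interpret U: prob_space seed by (rule prob_space_seed)
  interpret ZZ: pair_prob_space noise_seq noise_seq ..
  interpret ZZU: pair_prob_space "noise_seq \<Otimes>\<^sub>M noise_seq" seed ..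
  have "(\<integral>\<^sup>+ \<omega>. f \<omega> \<partial>noise_space) = (\<integral>\<^sup>+ u. (\<integral>\<^sup>+ z. f (z, u) \<partial>(noise_seq \<Otimes>\<^sub>M noise_seq)) \<partial>seed)"
    unfolding noise_space_def by (subst ZZU.nn_integral_snd) auto
  also have "\<dots> = (\<integral>\<^sup>+ u. (\<integral>\<^sup>+ zr. (\<integral>\<^sup>+ zd. f ((zr, zd), u) \<partial>noise_seq) \<partial>noise_seq) \<partial>seed)"
    by (intro nn_integral_cong, subst Z.nn_integral_fst[symmetric]) auto
  finally show ?thesis .
qed

lemma nn_integral_noise_seq_component:
  assumes f [measurable]: "f \<in> borel_measurable borel"
  shows "(\<integral>\<^sup>+ w. f (w i) \<partial>noise_seq) = (\<integral>\<^sup>+ z. f z \<partial>cgauss)"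
proof -
  interpret Z: prob_space noise_seq by (rule prob_space_noise_seq)
  show ?thesis by (subst nn_integral_resample[where i = i]) (auto simp: Z.emeasure_space_1)
qed

lemma nn_integral_relay_noise:
  assumes f [measurable]: "f \<in> borel_measurable borel"
  shows "(\<integral>\<^sup>+ \<omega>. f (fst (fst \<omega>) i) \<partial>noise_space) = (\<integral>\<^sup>+ z. f z \<partial>cgauss)"
proof -
  interpret Z: prob_space noise_seq by (rule prob_space_noise_seq)
  interpret U: prob_space seed by (rule prob_space_seed)
  show ?thesis
    by (subst nn_integral_noise_space)
       (auto simp: Z.emeasure_space_1 U.emeasure_space_1[simplified] nn_integral_noise_seq_component)
qed

lemma nn_integral_dest_noise:
  assumes f [measurable]: "f \<in> borel_measurable borel"
  shows "(\<integral>\<^sup>+ \<omega>. f (snd (fst \<omega>) i) \<partial>noise_space) = (\<integral>\<^sup>+ z. f z \<partial>cgauss)"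
proof -
  interpret Z: prob_space noise_seq by (rule prob_space_noise_seq)
  interpret U: prob_space seed by (rule prob_space_seed)
  show ?thesis
    by (subst nn_integral_noise_space)
       (auto simp: Z.emeasure_space_1 U.emeasure_space_1[simplified] nn_integral_noise_seq_component)
qed

section \<open>Converse\<close>

lemma cmod_add_power2_le: "(cmod (a + b))\<^sup>2 \<le> 2 * (cmod a)\<^sup>2 + 2 * (cmod b)\<^sup>2"
proof -
  have "(cmod (a + b))\<^sup>2 \<le> (cmod a + cmod b)\<^sup>2"
    by (intro power_mono norm_triangle_ineq) auto
  also have "\<dots> \<le> 2 * (cmod a)\<^sup>2 + 2 * (cmod b)\<^sup>2"
    using sum_squares_ge_zero[of "cmod a - cmod b" 0] by (simp add: power2_eq_square algebra_simps)
  finally show ?thesis .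
qed

lemma cmod_add3_power2_le:
  "(cmod (a + b + c))\<^sup>2 \<le> 3 * (cmod a)\<^sup>2 + 3 * (cmod b)\<^sup>2 + 3 * (cmod c)\<^sup>2"
proof -
  define p q r where "p = cmod a" and "q = cmod b" and "r = cmod c"
  have "(cmod (a + b + c))\<^sup>2 \<le> (p + q + r)\<^sup>2"
    unfolding p_def q_def r_def
    by (intro power_mono order_trans[OF norm_triangle_ineq add_right_mono[OF norm_triangle_ineq]]) auto
  also have "\<dots> \<le> 3 * p\<^sup>2 + 3 * q\<^sup>2 + 3 * r\<^sup>2"
    using zero_le_square[of "p - q"] zero_le_square[of "p - r"] zero_le_square[of "q - r"]
    by (simp add: power2_eq_square algebra_simps)
  finally show ?thesis by (simp add: p_def q_def r_def)
qed

lemma ln_cn_ratio: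
  assumes "v > 0"
  shows "- ln (cn v y / cn 1 z) = ln v + (cmod y)\<^sup>2 / v - (cmod z)\<^sup>2"
  using assms by (simp add: cn_def ln_div ln_mult)

text \<open>Cutting a path back to its history before time \<open>i\<close> lets a density at time
  \<open>i\<close> consult the relay state without depending on the coordinate being
  integrated.\<close>

definition truncate_seq :: "nat \<Rightarrow> (nat \<Rightarrow> complex) \<Rightarrow> nat \<Rightarrow> complex" where
  "truncate_seq i h = (\<lambda>j. if j < i then h j else 0)"

lemma truncate_seq_upd: "truncate_seq i (h(i := y)) = truncate_seq i h"
  by (auto simp: truncate_seq_def)

lemma measurable_truncate_seq [measurable (raw)]:
  assumes "f \<in> measurable M cseq"
  shows "(\<lambda>x. truncate_seq i (f x)) \<in> measurable M cseq"
proof (rule measurable_PiM_single')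
  fix j :: nat
  show "(\<lambda>x. truncate_seq i (f x) j) \<in> borel_measurable M"
    using measurable_cseq_component[OF assms] by (cases "j < i") (auto simp: truncate_seq_def)
qed auto

section \<open>The channel as two causal paths\<close>

locale half_duplex =
  fixes C S I \<theta> :: real and rl :: relay_fn
  assumes gains_nonneg: "C \<ge> 0" "S \<ge> 0" "I \<ge> 0"
    and relay_measurable:
      "\<And>i. (\<lambda>(h, u). rl i h u) \<in> measurable (cseq \<Otimes>\<^sub>M borel) (borel \<Otimes>\<^sub>M count_space UNIV)"
begin

definition relay_shift :: "(nat \<Rightarrow> complex) \<Rightarrow> real \<Rightarrow> nat \<Rightarrow> (nat \<Rightarrow> complex) \<Rightarrow> complex" where
  "relay_shift x u i h = complex_of_real (sqrt C) * x i * (if snd (rl i h u) then 0 else 1)"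

definition relay_contrib :: "complex \<times> bool \<Rightarrow> complex" where
  "relay_contrib a = cis \<theta> * complex_of_real (sqrt I) * fst a * (if snd a then 1 else 0)"

text \<open>Nothing feeds the outputs of the destination back, so its shift is constant in its own
  history; relay noise and seed are mere parameters of the path.\<close>

definition dest_shift :: "(nat \<Rightarrow> complex) \<Rightarrow> (nat \<Rightarrow> complex) \<Rightarrow> real \<Rightarrow> nat \<Rightarrow> (nat \<Rightarrow> complex) \<Rightarrow> complex" where
  "dest_shift x zr u i h = complex_of_real (sqrt S) * x i + relay_contrib (relay_input C x rl zr u i)"

lemma yr_past_eq_causal_path: "yr_past C x rl zr u n = causal_path (relay_shift x u) zr n"
  by (induction n) (auto simp: relay_shift_def Let_def)

lemma dest_out_eq_causal_path: "dest_out C S I \<theta> n x rl zr zd u = causal_path (dest_shift x zr u) zd n"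
proof
  fix j
  show "dest_out C S I \<theta> n x rl zr zd u j = causal_path (dest_shift x zr u) zd n j"
  proof (cases "j < n")
    case True
    have "causal_path (dest_shift x zr u) zd n j = causal_path (dest_shift x zr u) zd (Suc j) j"
      using True by (intro causal_path_stable) auto
    thus ?thesis using True by (simp add: dest_out_def dest_shift_def relay_contrib_def)
  qed (simp add: dest_out_def causal_path_eq_0)
qed

lemma measurable_rl [measurable (raw)]:
  assumes [measurable]: "f \<in> measurable M cseq" "g \<in> borel_measurable M"
  shows "(\<lambda>x. rl i (f x) (g x)) \<in> measurable M (borel \<Otimes>\<^sub>M count_space UNIV)"
proof -
  have "(\<lambda>x. (\<lambda>(h, u). rl i h u) (f x, g x)) \<in> measurable M (borel \<Otimes>\<^sub>M count_space UNIV)"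
    by (rule measurable_compose[OF _ relay_measurable]) measurable
  thus ?thesis by simp
qed

lemma measurable_relay_shift [measurable (raw)]:
  assumes [measurable]: "f \<in> measurable M cseq" "g \<in> borel_measurable M"
  shows "(\<lambda>w. relay_shift x (g w) i (f w)) \<in> borel_measurable M"
  unfolding relay_shift_def by measurable

lemma measurable_relay_contrib [measurable]:
  "relay_contrib \<in> borel_measurable (borel \<Otimes>\<^sub>M count_space UNIV)"
  unfolding relay_contrib_def by measurable

lemma measurable_yr [measurable (raw)]:
  assumes [measurable]: "f \<in> measurable M cseq" "g \<in> borel_measurable M"
  shows "(\<lambda>w. yr_past C x rl (f w) (g w) n) \<in> measurable M cseq"
  unfolding yr_past_eq_causal_path by (rule measurable_causal_path) (simp_all only: split_beta', measurable)

lemma measurable_relay_input [measurable (raw)]: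
  assumes [measurable]: "f \<in> measurable M cseq" "g \<in> borel_measurable M"
  shows "(\<lambda>w. relay_input C x rl (f w) (g w) i) \<in> measurable M (borel \<Otimes>\<^sub>M count_space UNIV)"
  unfolding relay_input_def by measurable

lemma measurable_dest_shift [measurable (raw)]:
  assumes [measurable]: "f \<in> measurable M cseq" "g \<in> borel_measurable M"
  shows "(\<lambda>w. dest_shift x (f w) (g w) i h) \<in> borel_measurable M"
  unfolding dest_shift_def by measurable

lemma measurable_dest_out [measurable (raw)]:
  assumes [measurable]: "f \<in> measurable M cseq" "g \<in> borel_measurable M" "d \<in> measurable M cseq"
  shows "(\<lambda>w. dest_out C S I \<theta> n x rl (f w) (d w) (g w)) \<in> measurable M cseq"
  unfolding dest_out_eq_causal_path
  by (rule measurable_causal_path) (simp_all only: split_beta' dest_shift_def, measurable)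


lemma measurable_causal_path_dest [measurable (raw)]:
  assumes [measurable]: "f \<in> measurable M cseq" "g \<in> borel_measurable M" "d \<in> measurable M cseq"
  shows "(\<lambda>w. causal_path (dest_shift x (f w) (g w)) (d w) n) \<in> measurable M cseq"
  using measurable_dest_out[OF assms] unfolding dest_out_eq_causal_path .

abbreviation relay_in :: "(nat \<Rightarrow> complex) \<Rightarrow> ((nat \<Rightarrow> complex) \<times> (nat \<Rightarrow> complex)) \<times> real \<Rightarrow> nat \<Rightarrow> complex \<times> bool"
  where "relay_in x \<omega> i \<equiv> relay_input C x rl (fst (fst \<omega>)) (snd \<omega>) i"

abbreviation received :: "nat \<Rightarrow> (nat \<Rightarrow> complex) \<Rightarrow> ((nat \<Rightarrow> complex) \<times> (nat \<Rightarrow> complex)) \<times> real \<Rightarrow> nat \<Rightarrow> complex"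
  where "received n x \<omega> \<equiv> dest_out C S I \<theta> n x rl (fst (fst \<omega>)) (snd (fst \<omega>)) (snd \<omega>)"

section \<open>Multiple-access cut: the output of the destination alone\<close>

definition mac_density :: "nat \<Rightarrow> (nat \<Rightarrow> complex) \<Rightarrow> real" where
  "mac_density i h = (cn (1 + S) (h i) + cn (1 + S + I) (h i)) / 2"

definition mac_ratio ::
  "nat \<Rightarrow> (nat \<Rightarrow> complex) \<Rightarrow> ((nat \<Rightarrow> complex) \<times> (nat \<Rightarrow> complex)) \<times> real \<Rightarrow> real" where
  "mac_ratio n x \<omega> = (\<Prod>i<n. mac_density i (causal_path (dest_shift x (fst (fst \<omega>)) (snd \<omega>)) (snd (fst \<omega>)) (Suc i))
      / cn 1 (snd (fst \<omega>) i))"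

definition mac_bound ::
  "nat \<Rightarrow> (nat \<Rightarrow> complex) \<Rightarrow> ((nat \<Rightarrow> complex) \<times> (nat \<Rightarrow> complex)) \<times> real \<Rightarrow> real" where
  "mac_bound n x \<omega> = (\<Sum>i<n. ln 2 + ln (1 + S + (if snd (relay_in x \<omega> i) then I else 0))
      + 3 * (cmod (x i))\<^sup>2 + 3 * (cmod (fst (relay_in x \<omega> i)))\<^sup>2 + 3 * (cmod (snd (fst \<omega>) i))\<^sup>2)"

lemma measurable_mac_density [measurable]: "mac_density i \<in> borel_measurable cseq"
  unfolding mac_density_def by measurable

lemma mac_density_pos: "mac_density i h > 0"
proof -
  have "1 + S > 0" "1 + S + I > 0" using gains_nonneg by linarith+
  from this[THEN cn_pos] show ?thesis
    unfolding mac_density_def by (intro divide_pos_pos add_pos_pos) auto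
qed

lemma nn_integral_mac_density: "(\<integral>\<^sup>+ y. ennreal (mac_density i (h(i := y))) \<partial>lborel) = 1"
proof -
  have "(\<integral>\<^sup>+ y. ennreal (mac_density i (h(i := y))) \<partial>lborel)
      = (\<integral>\<^sup>+ y. ennreal (1/2) * (ennreal (cn (1 + S) y) + ennreal (cn (1 + S + I) y)) \<partial>lborel)"
  proof (rule nn_integral_cong)
    fix y
    have "cn (1 + S) y \<ge> 0" "cn (1 + S + I) y \<ge> 0"
      using gains_nonneg by (auto intro!: less_imp_le cn_pos)
    thus "ennreal (mac_density i (h(i := y)))
        = ennreal (1/2) * (ennreal (cn (1 + S) y) + ennreal (cn (1 + S + I) y))"
      unfolding mac_density_def by (subst ennreal_plus[symmetric], simp, simp, subst ennreal_mult'[symmetric]) simp_all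
  qed
  also have "\<dots> = ennreal (1/2) * (1 + 1)"
    using gains_nonneg by (subst nn_integral_cmult, simp, subst nn_integral_add) (auto simp: nn_integral_cn)
  also have "\<dots> = 1"
    by (metis ennreal_1 ennreal_plus ennreal_mult' field_sum_of_halves mult_1 distrib_left mult.right_neutral zero_le_one divide_nonneg_nonneg zero_le_numeral)
  finally show ?thesis .
qed

lemma measurable_mac_ratio [measurable]: "mac_ratio n x \<in> borel_measurable ((cseq \<Otimes>\<^sub>M cseq) \<Otimes>\<^sub>M borel)"
  unfolding mac_ratio_def by measurable

lemma measurable_mac_bound [measurable]: "mac_bound n x \<in> borel_measurable ((cseq \<Otimes>\<^sub>M cseq) \<Otimes>\<^sub>M borel)"
  unfolding mac_bound_def by measurable

lemma mac_ratio_pos: "mac_ratio n x \<omega> > 0"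
  unfolding mac_ratio_def by (intro prod_pos) (auto intro!: divide_pos_pos mac_density_pos cn_pos)

text \<open>For fixed \<open>zr\<close> and \<open>u\<close> the relay contribution is just part of
  the shift, and \<open>reweighted_shift\<close> erases it together with the codeword.\<close>

lemma mac_change_of_measure:
  assumes F [measurable]: "F \<in> borel_measurable cseq"
  shows "(\<integral>\<^sup>+ \<omega>. F (received n x \<omega>) * ennreal (mac_ratio n x \<omega>) \<partial>noise_space)
    = reweighted mac_density n (\<lambda>_ _. 0) F"
proof -
  interpret Z: prob_space noise_seq by (rule prob_space_noise_seq)
  interpret U: prob_space seed by (rule prob_space_seed)
  have "(\<integral>\<^sup>+ zd. F (received n x ((zr, zd), u)) * ennreal (mac_ratio n x ((zr, zd), u)) \<partial>noise_seq)
      = reweighted mac_density n (\<lambda>_ _. 0) F" for zr u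
  proof -
    have "(\<integral>\<^sup>+ zd. F (received n x ((zr, zd), u)) * ennreal (mac_ratio n x ((zr, zd), u)) \<partial>noise_seq)
        = reweighted mac_density n (dest_shift x zr u) F"
      unfolding reweighted_def mac_ratio_def dest_out_eq_causal_path
      by (simp add: prod_ennreal mac_density_pos cn_pos less_imp_le)
    also have "\<dots> = reweighted mac_density n (\<lambda>_ _. 0) F"
      by (rule reweighted_shift) (auto simp: dest_shift_def[abs_def] mac_density_pos less_imp_le)
    finally show ?thesis .
  qed
  thus ?thesis
    by (subst nn_integral_noise_space) (simp_all add: Z.emeasure_space_1 U.emeasure_space_1[simplified])
qed

text \<open>\<open>c\<close> is the relay gain in force and \<open>v = 1 + S + c\<close> the
  matching variance. The component \<open>cn v\<close> is at most twice the mixture, which costs ln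
  2. Since 1, \<open>S\<close> and \<open>c\<close> are all at most \<open>v\<close>, the squared
  output divided by \<open>v\<close> is bounded by three squares free of the gains.\<close>

lemma mac_letter:
  assumes c: "c = (if s then I else 0)"
    and y: "y = complex_of_real (sqrt S) * a + relay_contrib (b, s) + z"
  shows "- ln ((cn (1 + S) y + cn (1 + S + I) y) / 2 / cn 1 z)
    \<le> ln 2 + ln (1 + S + c) + 3 * (cmod a)\<^sup>2 + 3 * (cmod b)\<^sup>2 + 3 * (cmod z)\<^sup>2"
proof -
  define v where "v = 1 + S + c"
  have c0: "c \<ge> 0" using c gains_nonneg by auto
  have v: "v \<ge> 1" "v \<ge> S" "v \<ge> c" "v > 0" using gains_nonneg c0 by (auto simp: v_def)
  have pos: "cn (1 + S) y > 0" "cn (1 + S + I) y > 0" "cn 1 z > 0" "cn v y > 0"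
    using gains_nonneg v by (auto intro!: cn_pos)
  have "cn v y \<le> cn (1 + S) y + cn (1 + S + I) y"
    using pos c by (auto simp: v_def)
  hence "cn v y / cn 1 z / 2 \<le> (cn (1 + S) y + cn (1 + S + I) y) / 2 / cn 1 z"
    using pos by (simp add: field_simps)
  hence "ln (cn v y / cn 1 z / 2) \<le> ln ((cn (1 + S) y + cn (1 + S + I) y) / 2 / cn 1 z)"
    using pos by (subst ln_le_cancel_iff) (auto intro!: divide_pos_pos add_pos_pos)
  moreover have "ln (cn v y / cn 1 z / 2) = ln (cn v y / cn 1 z) - ln 2"
    using pos by (simp add: ln_div ln_mult)
  moreover have "- ln (cn v y / cn 1 z) = ln v + (cmod y)\<^sup>2 / v - (cmod z)\<^sup>2"
    using v by (intro ln_cn_ratio) auto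
  moreover have "(cmod y)\<^sup>2 / v \<le> 3 * (cmod a)\<^sup>2 + 3 * (cmod b)\<^sup>2 + 3 * (cmod z)\<^sup>2"
  proof -
    have "(cmod y)\<^sup>2 \<le> 3 * (cmod (complex_of_real (sqrt S) * a))\<^sup>2 + 3 * (cmod (relay_contrib (b, s)))\<^sup>2 + 3 * (cmod z)\<^sup>2"
      unfolding y by (rule cmod_add3_power2_le)
    also have "(cmod (complex_of_real (sqrt S) * a))\<^sup>2 = S * (cmod a)\<^sup>2"
      using gains_nonneg by (simp add: norm_mult power_mult_distrib)
    also have "(cmod (relay_contrib (b, s)))\<^sup>2 = c * (cmod b)\<^sup>2"
      using gains_nonneg c by (simp add: relay_contrib_def norm_mult power_mult_distrib)
    also have "3 * (S * (cmod a)\<^sup>2) + 3 * (c * (cmod b)\<^sup>2) + 3 * (cmod z)\<^sup>2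
        \<le> 3 * (v * (cmod a)\<^sup>2) + 3 * (v * (cmod b)\<^sup>2) + 3 * (v * (cmod z)\<^sup>2)"
      using v mult_right_mono[OF v(1), of "(cmod z)\<^sup>2"] by (intro add_mono mult_left_mono mult_right_mono) auto
    also have "\<dots> = (3 * (cmod a)\<^sup>2 + 3 * (cmod b)\<^sup>2 + 3 * (cmod z)\<^sup>2) * v"
      by (simp add: algebra_simps)
    finally show ?thesis using v by (simp add: divide_le_eq)
  qed
  ultimately show ?thesis
    using zero_le_power2[of "cmod z"] unfolding v_def by linarith
qed

lemma mac_ratio_bound: "- ln (mac_ratio n x \<omega>) \<le> mac_bound n x \<omega>"
proof -
  let ?p = "\<lambda>i. causal_path (dest_shift x (fst (fst \<omega>)) (snd \<omega>)) (snd (fst \<omega>)) (Suc i)"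
  have "- ln (mac_ratio n x \<omega>) = (\<Sum>i<n. - ln (mac_density i (?p i) / cn 1 (snd (fst \<omega>) i)))"
    unfolding mac_ratio_def sum_negf
    by (subst ln_prod) (auto simp: less_imp_neq[OF mac_density_pos, symmetric] less_imp_neq[OF cn_pos, symmetric]
        simp del: causal_path.simps)
  also have "\<dots> \<le> mac_bound n x \<omega>"
    unfolding mac_bound_def
  proof (rule sum_mono)
    fix i
    show "- ln (mac_density i (?p i) / cn 1 (snd (fst \<omega>) i))
      \<le> ln 2 + ln (1 + S + (if snd (relay_in x \<omega> i) then I else 0)) + 3 * (cmod (x i))\<^sup>2
        + 3 * (cmod (fst (relay_in x \<omega> i)))\<^sup>2 + 3 * (cmod (snd (fst \<omega>) i))\<^sup>2"
      unfolding mac_density_def by (rule mac_letter) (auto simp: dest_shift_def)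
  qed
  finally show ?thesis .
qed

lemma mac_bound_nonneg: "mac_bound n x \<omega> \<ge> 0"
  unfolding mac_bound_def using gains_nonneg by (intro sum_nonneg add_nonneg_nonneg) auto


section \<open>Broadcast cut: the outputs of relay and destination together\<close>

definition listen_gain :: "real \<Rightarrow> nat \<Rightarrow> (nat \<Rightarrow> complex) \<Rightarrow> real" where
  "listen_gain u i h = (if snd (rl i (truncate_seq i h) u) then 0 else C)"

definition bc_relay_density :: "real \<Rightarrow> nat \<Rightarrow> (nat \<Rightarrow> complex) \<Rightarrow> real" where
  "bc_relay_density u i h = cn (1 + listen_gain u i h) (h i)"

text \<open>The reference law of the pair of outputs at time \<open>i\<close> is the Gaussian one with the covariance of
  \<open>(\<surd>c X + Z\<^sub>r, \<surd>S X + Z\<^sub>d)\<close>, where \<open>c\<close> is the current listening gain and \<open>X\<close> is a standard Gaussian: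
  the relay output has variance \<open>1 + c\<close>, and given it the destination output has the parameters below.\<close>

definition bc_dest_density :: "real \<Rightarrow> (nat \<Rightarrow> complex) \<Rightarrow> nat \<Rightarrow> (nat \<Rightarrow> complex) \<Rightarrow> real" where
  "bc_dest_density u H i y = (let c = listen_gain u i H in
     cn ((1 + c + S) / (1 + c))
       (y i - complex_of_real (sqrt S * sqrt c / (1 + c)) * H i - relay_contrib (rl i (truncate_seq i H) u)))"

definition bc_ratio ::
  "nat \<Rightarrow> (nat \<Rightarrow> complex) \<Rightarrow> ((nat \<Rightarrow> complex) \<times> (nat \<Rightarrow> complex)) \<times> real \<Rightarrow> real" where
  "bc_ratio n x \<omega> =
    (\<Prod>i<n. bc_relay_density (snd \<omega>) i (causal_path (relay_shift x (snd \<omega>)) (fst (fst \<omega>)) (Suc i))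
      / cn 1 (fst (fst \<omega>) i))
    * (\<Prod>i<n. bc_dest_density (snd \<omega>) (yr_past C x rl (fst (fst \<omega>)) (snd \<omega>) n) i
        (causal_path (dest_shift x (fst (fst \<omega>)) (snd \<omega>)) (snd (fst \<omega>)) (Suc i))
      / cn 1 (snd (fst \<omega>) i))"

definition bc_bound ::
  "nat \<Rightarrow> (nat \<Rightarrow> complex) \<Rightarrow> ((nat \<Rightarrow> complex) \<times> (nat \<Rightarrow> complex)) \<times> real \<Rightarrow> real" where
  "bc_bound n x \<omega> = (\<Sum>i<n. ln (1 + (if snd (relay_in x \<omega> i) then 0 else C) + S)
      + 5 * (cmod (x i))\<^sup>2 + 5 * (cmod (fst (fst \<omega>) i))\<^sup>2 + 3 * (cmod (snd (fst \<omega>) i))\<^sup>2)"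

lemma listen_gain_nonneg: "listen_gain u i h \<ge> 0"
  using gains_nonneg by (simp add: listen_gain_def)

text \<open>The state at time \<open>i\<close> is fixed before the output at time \<open>i\<close>
  arrives. Hence \<open>bc_relay_density\<close> is a probability density in its last coordinate
  although its variance depends on the path.\<close>

lemma listen_gain_upd: "listen_gain u i (h(i := y)) = listen_gain u i h"
  by (simp add: listen_gain_def truncate_seq_upd)

lemma measurable_listen_gain [measurable (raw)]:
  assumes [measurable]: "f \<in> measurable M cseq" "g \<in> borel_measurable M"
  shows "(\<lambda>w. listen_gain (g w) i (f w)) \<in> borel_measurable M"
  unfolding listen_gain_def by measurable

lemma measurable_cn_compose [measurable (raw)]:
  assumes [measurable]: "f \<in> borel_measurable M" "g \<in> borel_measurable M"
  shows "(\<lambda>w. cn (f w) (g w)) \<in> borel_measurable M"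
  unfolding cn_def by measurable

lemma measurable_bc_relay_density [measurable (raw)]:
  assumes [measurable]: "f \<in> measurable M cseq" "g \<in> borel_measurable M"
  shows "(\<lambda>w. bc_relay_density (g w) i (f w)) \<in> borel_measurable M"
  unfolding bc_relay_density_def using measurable_cseq_component[OF assms(1)] by measurable

lemma measurable_bc_dest_density [measurable (raw)]:
  assumes [measurable]: "f \<in> measurable M cseq" "d \<in> measurable M cseq" "g \<in> borel_measurable M"
  shows "(\<lambda>w. bc_dest_density (g w) (f w) i (d w)) \<in> borel_measurable M"
  unfolding bc_dest_density_def Let_def
  using measurable_cseq_component[OF assms(1)] measurable_cseq_component[OF assms(2)] by measurable

lemma measurable_causal_path_relay [measurable (raw)]:
  assumes [measurable]: "f \<in> measurable M cseq" "g \<in> borel_measurable M"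
  shows "(\<lambda>w. causal_path (relay_shift x (g w)) (f w) n) \<in> measurable M cseq"
  using measurable_yr[OF assms] unfolding yr_past_eq_causal_path .

lemma measurable_bc_ratio [measurable]: "bc_ratio n x \<in> borel_measurable ((cseq \<Otimes>\<^sub>M cseq) \<Otimes>\<^sub>M borel)"
  unfolding bc_ratio_def by measurable

lemma measurable_bc_bound [measurable]: "bc_bound n x \<in> borel_measurable ((cseq \<Otimes>\<^sub>M cseq) \<Otimes>\<^sub>M borel)"
  unfolding bc_bound_def by measurable

lemma bc_relay_density_pos: "bc_relay_density u i h > 0"
  unfolding bc_relay_density_def using listen_gain_nonneg[of u i h] by (intro cn_pos) linarith

lemma bc_dest_density_pos: "bc_dest_density u H i y > 0"
proof -
  have "1 + listen_gain u i H > 0" "1 + listen_gain u i H + S > 0"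
    using listen_gain_nonneg[of u i H] gains_nonneg by linarith+
  thus ?thesis unfolding bc_dest_density_def Let_def by (intro cn_pos divide_pos_pos)
qed

lemma nn_integral_bc_relay_density: "(\<integral>\<^sup>+ y. ennreal (bc_relay_density u i (h(i := y))) \<partial>lborel) = 1"
proof -
  have "1 + listen_gain u i h > 0" using listen_gain_nonneg[of u i h] by linarith
  thus ?thesis unfolding bc_relay_density_def by (simp add: listen_gain_upd nn_integral_cn del: fun_upd_apply)
      (simp add: nn_integral_cn)
qed

lemma nn_integral_bc_dest_density: "(\<integral>\<^sup>+ y. ennreal (bc_dest_density u H i (h(i := y))) \<partial>lborel) = 1"
proof -
  let ?c = "listen_gain u i H"
  let ?a = "- complex_of_real (sqrt S * sqrt ?c / (1 + ?c)) * H i - relay_contrib (rl i (truncate_seq i H) u)"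
  have "1 + ?c > 0" "1 + ?c + S > 0"
    using listen_gain_nonneg[of u i H] gains_nonneg by linarith+
  hence v: "(1 + ?c + S) / (1 + ?c) > 0" by (rule divide_pos_pos[rotated])
  have "(\<integral>\<^sup>+ y. ennreal (bc_dest_density u H i (h(i := y))) \<partial>lborel)
      = (\<integral>\<^sup>+ y. ennreal (cn ((1 + ?c + S) / (1 + ?c)) (?a + y)) \<partial>lborel)"
    unfolding bc_dest_density_def Let_def by (simp add: algebra_simps)
  also have "\<dots> = (\<integral>\<^sup>+ y. ennreal (cn ((1 + ?c + S) / (1 + ?c)) y) \<partial>distr lborel borel ((+) ?a))"
    by (subst nn_integral_distr) auto
  also have "\<dots> = 1"
    unfolding lborel_distr_plus by (rule nn_integral_cn[OF v])
  finally show ?thesis .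
qed

lemma bc_ratio_pos: "bc_ratio n x \<omega> > 0"
  unfolding bc_ratio_def
  by (intro mult_pos_pos prod_pos) (auto intro!: divide_pos_pos bc_relay_density_pos bc_dest_density_pos cn_pos)

text \<open>The seed keeps its true law, the relay path follows its reference law given the seed,
  and the destination path follows its own given both. No codeword occurs.\<close>

definition bc_reference :: "nat \<Rightarrow> ((nat \<Rightarrow> complex) \<Rightarrow> ennreal) \<Rightarrow> ennreal" where
  "bc_reference n F = (\<integral>\<^sup>+ u. reweighted (bc_relay_density u) n (\<lambda>_ _. 0)
     (\<lambda>H. reweighted (bc_dest_density u H) n (\<lambda>_ _. 0) F) \<partial>seed)"

text \<open>The destination noise is integrated with the relay path held fixed, which removes the
  shift of the destination. What remains is a function \<open>G u\<close> of the relay path, to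
  which the same argument applies a second time.\<close>

lemma bc_change_of_measure:
  assumes F [measurable]: "F \<in> borel_measurable cseq"
  shows "(\<integral>\<^sup>+ \<omega>. F (received n x \<omega>) * ennreal (bc_ratio n x \<omega>) \<partial>noise_space) = bc_reference n F"
proof -
  interpret Z: prob_space noise_seq by (rule prob_space_noise_seq)
  define G where "G u H = reweighted (bc_dest_density u H) n (\<lambda>_ _. 0) F" for u H
  have [measurable]: "(\<lambda>w. causal_path (\<lambda>_ _. 0) (f w) n) \<in> measurable M cseq"
    if "f \<in> measurable M cseq" for f M n
    using that by (intro measurable_causal_path) auto
  have G_meas [measurable]: "G u \<in> borel_measurable cseq" for u
    unfolding G_def[abs_def] reweighted_def by measurable
  have inner: "(\<integral>\<^sup>+ zd. F (received n x ((zr, zd), u)) * ennreal (bc_ratio n x ((zr, zd), u)) \<partial>noise_seq)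
      = G u (causal_path (relay_shift x u) zr n)
        * (\<Prod>i<n. ennreal (bc_relay_density u i (causal_path (relay_shift x u) zr (Suc i)) / cn 1 (zr i)))" for zr u
  proof -
    let ?H = "causal_path (relay_shift x u) zr n"
    let ?P = "\<Prod>i<n. ennreal (bc_relay_density u i (causal_path (relay_shift x u) zr (Suc i)) / cn 1 (zr i))"
    have "(\<integral>\<^sup>+ zd. F (received n x ((zr, zd), u)) * ennreal (bc_ratio n x ((zr, zd), u)) \<partial>noise_seq)
        = (\<integral>\<^sup>+ zd. ?P * (F (causal_path (dest_shift x zr u) zd n)
          * (\<Prod>i<n. ennreal (bc_dest_density u ?H i (causal_path (dest_shift x zr u) zd (Suc i)) / cn 1 (zd i)))) \<partial>noise_seq)"
      unfolding bc_ratio_def dest_out_eq_causal_path yr_past_eq_causal_path fst_conv snd_conv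
      by (subst ennreal_mult)
         (auto intro!: prod_nonneg divide_nonneg_nonneg nn_integral_cong
           simp: prod_ennreal bc_dest_density_pos bc_relay_density_pos cn_pos less_imp_le mult_ac simp del: causal_path.simps)
    also have "\<dots> = ?P * reweighted (bc_dest_density u ?H) n (dest_shift x zr u) F"
      unfolding reweighted_def by (rule nn_integral_cmult) measurable
    also have "reweighted (bc_dest_density u ?H) n (dest_shift x zr u) F = G u ?H"
      unfolding G_def
      by (rule reweighted_shift) (auto simp: dest_shift_def[abs_def] bc_dest_density_pos less_imp_le)
    finally show ?thesis by (simp only: mult.commute)
  qed
  have "(\<integral>\<^sup>+ zr. G u (causal_path (relay_shift x u) zr n)
        * (\<Prod>i<n. ennreal (bc_relay_density u i (causal_path (relay_shift x u) zr (Suc i)) / cn 1 (zr i))) \<partial>noise_seq)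
      = reweighted (bc_relay_density u) n (\<lambda>_ _. 0) (G u)" for u
    unfolding reweighted_def[symmetric]
    by (rule reweighted_shift) (auto simp: bc_relay_density_pos less_imp_le)
  hence "(\<integral>\<^sup>+ zr. (\<integral>\<^sup>+ zd. F (received n x ((zr, zd), u)) * ennreal (bc_ratio n x ((zr, zd), u)) \<partial>noise_seq) \<partial>noise_seq)
      = reweighted (bc_relay_density u) n (\<lambda>_ _. 0) (G u)" for u
    unfolding inner .
  thus ?thesis
    unfolding bc_reference_def by (subst nn_integral_noise_space) (simp_all add: G_def[abs_def])
qed

lemma bc_reference_1: "bc_reference n (\<lambda>_. 1) = 1"
proof -
  interpret U: prob_space seed by (rule prob_space_seed)
  have "reweighted (bc_dest_density u H) n (\<lambda>_ _. 0) (\<lambda>_. 1) = 1" for u H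
    by (rule reweighted_1) (auto simp: bc_dest_density_pos less_imp_le nn_integral_bc_dest_density simp del: fun_upd_apply)
  moreover have "reweighted (bc_relay_density u) n (\<lambda>_ _. 0) (\<lambda>_. 1) = 1" for u
    by (rule reweighted_1) (auto simp: bc_relay_density_pos less_imp_le nn_integral_bc_relay_density simp del: fun_upd_apply)
  ultimately show ?thesis
    by (simp add: bc_reference_def U.emeasure_space_1[simplified])
qed

text \<open>The two variances multiply to \<open>1 + c + S\<close>, so their logarithms add up to
  that of the cut. The relay contribution \<open>b\<close> is known to the reference law and is
  subtracted; thus no relay power appears on the right.\<close>

lemma bc_letter:
  assumes c: "c \<ge> 0"
    and p: "p = complex_of_real (sqrt c) * a + z"
    and q: "q = complex_of_real (sqrt S) * a + b + z'"
  shows "- ln (cn (1 + c) p / cn 1 z)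
      - ln (cn ((1 + c + S) / (1 + c)) (q - complex_of_real (sqrt S * sqrt c / (1 + c)) * p - b) / cn 1 z')
    \<le> ln (1 + c + S) + 5 * (cmod a)\<^sup>2 + 5 * (cmod z)\<^sup>2 + 3 * (cmod z')\<^sup>2"
proof -
  define v where "v = (1 + c + S) / (1 + c)"
  define \<rho> where "\<rho> = sqrt S * sqrt c / (1 + c)"
  define w where "w = q - complex_of_real \<rho> * p - b"
  have S: "S \<ge> 0" using gains_nonneg by simp
  have v: "v > 0" "v \<ge> 1" using S c by (auto simp: v_def)
  have "- ln (cn (1 + c) p / cn 1 z) = ln (1 + c) + (cmod p)\<^sup>2 / (1 + c) - (cmod z)\<^sup>2"
    using c by (intro ln_cn_ratio) auto
  moreover have "- ln (cn v w / cn 1 z') = ln v + (cmod w)\<^sup>2 / v - (cmod z')\<^sup>2"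
    by (rule ln_cn_ratio[OF v(1)])
  moreover have "ln (1 + c) + ln v = ln (1 + c + S)"
    using c S by (simp add: v_def ln_div)
  moreover have "(cmod p)\<^sup>2 / (1 + c) \<le> 2 * (cmod a)\<^sup>2 + 2 * (cmod z)\<^sup>2"
  proof -
    have "(cmod p)\<^sup>2 \<le> 2 * (c * (cmod a)\<^sup>2) + 2 * (cmod z)\<^sup>2"
      using cmod_add_power2_le[of "complex_of_real (sqrt c) * a" z] c
      unfolding p by (simp add: norm_mult power_mult_distrib)
    also have "\<dots> \<le> 2 * ((1 + c) * (cmod a)\<^sup>2) + 2 * ((1 + c) * (cmod z)\<^sup>2)"
      using c mult_right_mono[of 1 "1 + c" "(cmod z)\<^sup>2"]
      by (intro add_mono mult_left_mono mult_right_mono) auto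
    also have "\<dots> = (2 * (cmod a)\<^sup>2 + 2 * (cmod z)\<^sup>2) * (1 + c)"
      by (simp add: algebra_simps)
    finally show ?thesis using c by (simp add: divide_le_eq)
  qed
  moreover have "(cmod w)\<^sup>2 / v \<le> 3 * (cmod a)\<^sup>2 + 3 * (cmod z)\<^sup>2 + 3 * (cmod z')\<^sup>2"
  proof -
    \<comment> \<open>\<open>\<rho>\<close> is the linear estimation coefficient. Subtracting
      \<open>\<rho> * p\<close> leaves the source symbol with factor \<open>sqrt S / (1 + c)\<close>
      and the relay noise with factor \<open>- \<rho>\<close>; both squared factors are at most
      \<open>v\<close>.\<close>
    have coef: "sqrt S - \<rho> * sqrt c = sqrt S / (1 + c)"
      using c by (simp add: \<rho>_def field_simps)
    have "w = complex_of_real (sqrt S - \<rho> * sqrt c) * a + (- complex_of_real \<rho> * z) + z'"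
      unfolding w_def p q by (simp add: algebra_simps)
    also have "sqrt S - \<rho> * sqrt c = sqrt S / (1 + c)"
      by (rule coef)
    finally have "(cmod w)\<^sup>2 \<le> 3 * (cmod (complex_of_real (sqrt S / (1 + c)) * a))\<^sup>2
        + 3 * (cmod (- complex_of_real \<rho> * z))\<^sup>2 + 3 * (cmod z')\<^sup>2"
      by (simp only: cmod_add3_power2_le)
    also have "(cmod (complex_of_real (sqrt S / (1 + c)) * a))\<^sup>2 = S / (1 + c)\<^sup>2 * (cmod a)\<^sup>2"
      using S c by (simp only: norm_mult norm_of_real power_mult_distrib power2_abs power_divide real_sqrt_pow2)
    also have "(cmod (- complex_of_real \<rho> * z))\<^sup>2 = S * c / (1 + c)\<^sup>2 * (cmod z)\<^sup>2"
      using S c unfolding \<rho>_def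
      by (simp only: norm_mult norm_minus_cancel norm_of_real power_mult_distrib power2_abs power_divide real_sqrt_pow2)
    also have "3 * (S / (1 + c)\<^sup>2 * (cmod a)\<^sup>2) + 3 * (S * c / (1 + c)\<^sup>2 * (cmod z)\<^sup>2) + 3 * (cmod z')\<^sup>2
        \<le> 3 * (v * (cmod a)\<^sup>2) + 3 * (v * (cmod z)\<^sup>2) + 3 * (v * (cmod z')\<^sup>2)"
    proof -
      have "S / (1 + c)\<^sup>2 \<le> v"
      proof -
        have "S \<le> (1 + c + S) * (1 + c)" using S c by (simp add: algebra_simps add_increasing)
        thus ?thesis using c by (simp add: v_def power2_eq_square divide_le_eq)
      qed
      moreover have "S * c / (1 + c)\<^sup>2 \<le> v"
      proof -
        have "S * c \<le> (1 + c + S) * (1 + c)" using S c by (simp add: algebra_simps)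
        thus ?thesis using c by (simp add: v_def power2_eq_square divide_le_eq)
      qed
      ultimately show ?thesis
        using mult_right_mono[OF v(2), of "(cmod z')\<^sup>2"] by (intro add_mono mult_left_mono mult_right_mono) auto
    qed
    also have "\<dots> = (3 * (cmod a)\<^sup>2 + 3 * (cmod z)\<^sup>2 + 3 * (cmod z')\<^sup>2) * v"
      by (simp add: algebra_simps)
    finally show ?thesis using v by (simp add: divide_le_eq)
  qed
  ultimately show ?thesis
    using zero_le_power2[of "cmod z"] zero_le_power2[of "cmod z'"]
    unfolding v_def[symmetric] \<rho>_def[symmetric] w_def[symmetric] by linarith
qed

lemma bc_ratio_bound: "- ln (bc_ratio n x \<omega>) \<le> bc_bound n x \<omega>"
proof -
  obtain zr zd u where \<omega>: "\<omega> = ((zr, zd), u)" by (metis prod.collapse)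
  let ?H = "causal_path (relay_shift x u) zr n"
  let ?f = "\<lambda>i. bc_relay_density u i (causal_path (relay_shift x u) zr (Suc i)) / cn 1 (zr i)"
  let ?g = "\<lambda>i. bc_dest_density u ?H i (causal_path (dest_shift x zr u) zd (Suc i)) / cn 1 (zd i)"
  have pos: "?f i > 0" "?g i > 0" for i
    by (auto intro!: divide_pos_pos bc_relay_density_pos bc_dest_density_pos cn_pos simp del: causal_path.simps)
  have "- ln (bc_ratio n x \<omega>) = - ln (\<Prod>i<n. ?f i) - ln (\<Prod>i<n. ?g i)"
    unfolding bc_ratio_def \<omega> fst_conv snd_conv yr_past_eq_causal_path
    using prod_pos[of "{..<n}" ?f, OF pos(1)] prod_pos[of "{..<n}" ?g, OF pos(2)]
    by (subst ln_mult) (simp_all only: less_imp_neq[symmetric] minus_add_distrib diff_conv_add_uminus, auto)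
  also have "\<dots> = (\<Sum>i<n. - ln (?f i) - ln (?g i))"
    unfolding sum_subtractf sum_negf
    by (subst (1 2) ln_prod) (simp_all only: finite_lessThan less_imp_neq[OF pos(1), symmetric]
        less_imp_neq[OF pos(2), symmetric] not_False_eq_True)
  also have "\<dots> \<le> bc_bound n x \<omega>"
    unfolding bc_bound_def
  proof (rule sum_mono)
    fix i assume "i \<in> {..<n}"
    hence i: "i < n" by simp
    define c where "c = (if snd (relay_in x \<omega> i) then 0 else C)"
    \<comment> \<open>Truncating any longer path at \<open>i\<close> returns the history on which
      the relay acted at time \<open>i\<close>, so the state seen by the densities is the actual
      one.\<close>
    have trunc: "truncate_seq i (causal_path a w m) = causal_path a w i" if "i \<le> m" for a w m
      using that by (auto simp: truncate_seq_def causal_path_stable[symmetric] causal_path_eq_0 intro!: ext causal_path_stable)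
    have gain: "listen_gain u i (causal_path (relay_shift x u) zr (Suc i)) = c" "listen_gain u i ?H = c"
      using i trunc[of "Suc i"] trunc[of n]
      by (auto simp: listen_gain_def c_def \<omega> relay_input_def yr_past_eq_causal_path simp del: causal_path.simps)
    have H: "?H i = causal_path (relay_shift x u) zr (Suc i) i"
      using i by (intro causal_path_stable) auto
    have p: "causal_path (relay_shift x u) zr (Suc i) i = complex_of_real (sqrt c) * x i + zr i"
      by (simp add: relay_shift_def c_def \<omega> relay_input_def yr_past_eq_causal_path)
    have q: "causal_path (dest_shift x zr u) zd (Suc i) i
        = complex_of_real (sqrt S) * x i + relay_contrib (rl i (truncate_seq i ?H) u) + zd i"
      using i by (simp add: dest_shift_def relay_input_def yr_past_eq_causal_path trunc)
    have "c \<ge> 0" using gains_nonneg by (simp add: c_def)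
    from bc_letter[OF this p q]
    show "- ln (?f i) - ln (?g i) \<le> ln (1 + (if snd (relay_in x \<omega> i) then 0 else C) + S)
      + 5 * (cmod (x i))\<^sup>2 + 5 * (cmod (fst (fst \<omega>) i))\<^sup>2 + 3 * (cmod (snd (fst \<omega>) i))\<^sup>2"
      unfolding bc_relay_density_def bc_dest_density_def Let_def gain H c_def[symmetric]
      by (simp only: \<omega> fst_conv snd_conv)
  qed
  finally show ?thesis .
qed

lemma bc_bound_nonneg: "bc_bound n x \<omega> \<ge> 0"
  unfolding bc_bound_def using gains_nonneg by (intro sum_nonneg add_nonneg_nonneg) auto

end

section \<open>Averaging the bounds over the noises and the relay state\<close>

lemma (in prob_space) nn_integral_two_valued:
  assumes [measurable]: "Measurable.pred M P" and "a \<ge> 0" "b \<ge> 0"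
  shows "(\<integral>\<^sup>+ w. ennreal (if P w then a else b) \<partial>M)
    = ennreal (prob {w \<in> space M. P w} * a + (1 - prob {w \<in> space M. P w}) * b)"
proof -
  let ?L = "{w \<in> space M. P w}"
  have L [measurable]: "?L \<in> events" by measurable
  have "(\<integral>\<^sup>+ w. ennreal (if P w then a else b) \<partial>M)
      = (\<integral>\<^sup>+ w. ennreal a * indicator ?L w + ennreal b * indicator (space M - ?L) w \<partial>M)"
    by (intro nn_integral_cong) (auto simp: indicator_def)
  also have "\<dots> = ennreal a * emeasure M ?L + ennreal b * emeasure M (space M - ?L)"
    by (subst nn_integral_add) (auto simp: nn_integral_cmult_indicator)
  also have "\<dots> = ennreal a * ennreal (prob ?L) + ennreal b * ennreal (1 - prob ?L)"
    by (simp only: emeasure_eq_measure prob_compl[OF L])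
  also have "\<dots> = ennreal (prob ?L * a + (1 - prob ?L) * b)"
    using assms by (simp add: ennreal_plus ennreal_mult mult.commute)
  finally show ?thesis .
qed

context half_duplex
begin

text \<open>\<open>K F\<close> does not depend on the codeword, so every term may be computed with
  \<open>x 0\<close>. Under this single law the decoding regions of different messages are
  disjoint.\<close>

lemma sum_decoding_mass:
  fixes x :: "nat \<Rightarrow> nat \<Rightarrow> complex"
  assumes [measurable]: "dec \<in> measurable cseq (count_space UNIV)"
    and r_meas [measurable]: "\<And>x. r x \<in> borel_measurable ((cseq \<Otimes>\<^sub>M cseq) \<Otimes>\<^sub>M borel)"
    and change: "\<And>F x. F \<in> borel_measurable cseq \<Longrightarrow>
      (\<integral>\<^sup>+ \<omega>. F (received n x \<omega>) * ennreal (r x \<omega>) \<partial>noise_space) = K F"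
    and K_1: "K (\<lambda>_. 1) = 1"
  shows "(\<Sum>m<k. \<integral>\<^sup>+ \<omega>. indicator {\<omega>. dec (received n (x m) \<omega>) = m} \<omega> * ennreal (r (x m) \<omega>) \<partial>noise_space) \<le> 1"
proof -
  let ?F = "\<lambda>m y. indicator {y. dec y = m} y :: ennreal"
  have [measurable]: "?F m \<in> borel_measurable cseq" for m by measurable
  have [measurable]: "(\<lambda>\<omega>. received n x \<omega>) \<in> measurable ((cseq \<Otimes>\<^sub>M cseq) \<Otimes>\<^sub>M borel) cseq" for x
    by measurable
  have ind: "indicator {\<omega>. dec (received n (x m) \<omega>) = m} \<omega> = ?F m (received n (x m) \<omega>)" for m \<omega>
    by (auto simp: indicator_def)
  have "(\<Sum>m<k. \<integral>\<^sup>+ \<omega>. indicator {\<omega>. dec (received n (x m) \<omega>) = m} \<omega> * ennreal (r (x m) \<omega>) \<partial>noise_space)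
      = (\<Sum>m<k. \<integral>\<^sup>+ \<omega>. ?F m (received n (x 0) \<omega>) * ennreal (r (x 0) \<omega>) \<partial>noise_space)"
    unfolding ind by (intro sum.cong refl) (simp only: change \<open>\<And>m. ?F m \<in> borel_measurable cseq\<close>)
  also have "\<dots> = (\<integral>\<^sup>+ \<omega>. (\<Sum>m<k. ?F m (received n (x 0) \<omega>) * ennreal (r (x 0) \<omega>)) \<partial>noise_space)"
    by (subst nn_integral_sum) auto
  also have "\<dots> \<le> (\<integral>\<^sup>+ \<omega>. (\<lambda>_. 1) (received n (x 0) \<omega>) * ennreal (r (x 0) \<omega>) \<partial>noise_space)"
  proof (rule nn_integral_mono)
    fix \<omega>
    have "(\<Sum>m<k. ?F m (received n (x 0) \<omega>)) \<le> 1"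
      using card_mono[of "{dec (received n (x 0) \<omega>)}" "{..<k} \<inter> {dec (received n (x 0) \<omega>)}"]
      by (simp add: indicator_def)
    thus "(\<Sum>m<k. ?F m (received n (x 0) \<omega>) * ennreal (r (x 0) \<omega>))
        \<le> (\<lambda>_. 1) (received n (x 0) \<omega>) * ennreal (r (x 0) \<omega>)"
      by (subst sum_distrib_right[symmetric]) (rule mult_right_mono, auto)
  qed
  also have "\<dots> = 1" by (subst change) (auto simp: K_1)
  finally show ?thesis .
qed

abbreviation listen_prob :: "(nat \<Rightarrow> complex) \<Rightarrow> nat \<Rightarrow> real" where
  "listen_prob x i \<equiv> measure noise_space {\<omega> \<in> space noise_space. \<not> snd (relay_in x \<omega> i)}"

text \<open>13 covers ln 2 and the 3 * 4 of the destination noise. The relay power stays an integral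
  for each time, since the constraint bounds it only after summation over times and
  messages.\<close>

lemma nn_integral_mac_bound:
  "(\<integral>\<^sup>+ \<omega>. ennreal (mac_bound n x \<omega>) \<partial>noise_space)
    \<le> (\<Sum>i<n. ennreal (13 + (listen_prob x i * ln (1 + S) + (1 - listen_prob x i) * ln (1 + S + I))
        + 3 * (cmod (x i))\<^sup>2)
      + 3 * (\<integral>\<^sup>+ \<omega>. ennreal ((cmod (fst (relay_in x \<omega> i)))\<^sup>2) \<partial>noise_space))"
proof -
  interpret P: prob_space noise_space by (rule prob_space_noise_space)
  have logs: "ln (1 + S) \<ge> 0" "ln (1 + S + I) \<ge> 0" using gains_nonneg by auto
  have "(\<integral>\<^sup>+ \<omega>. ennreal (mac_bound n x \<omega>) \<partial>noise_space)
      = (\<integral>\<^sup>+ \<omega>. (\<Sum>i<n. ennreal (ln 2 + 3 * (cmod (x i))\<^sup>2)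
        + ennreal (if \<not> snd (relay_in x \<omega> i) then ln (1 + S) else ln (1 + S + I))
        + 3 * ennreal ((cmod (fst (relay_in x \<omega> i)))\<^sup>2) + 3 * ennreal ((cmod (snd (fst \<omega>) i))\<^sup>2)) \<partial>noise_space)"
  proof (rule nn_integral_cong)
    fix \<omega>
    have num: "(3 :: ennreal) = ennreal 3" by simp
    have "ennreal (mac_bound n x \<omega>) = (\<Sum>i<n. ennreal (ln 2 + ln (1 + S + (if snd (relay_in x \<omega> i) then I else 0))
      + 3 * (cmod (x i))\<^sup>2 + 3 * (cmod (fst (relay_in x \<omega> i)))\<^sup>2 + 3 * (cmod (snd (fst \<omega>) i))\<^sup>2))"
      unfolding mac_bound_def using gains_nonneg
      by (intro sum_ennreal[symmetric] add_nonneg_nonneg) auto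
    also have "\<dots> = (\<Sum>i<n. ennreal (ln 2 + 3 * (cmod (x i))\<^sup>2)
        + ennreal (if \<not> snd (relay_in x \<omega> i) then ln (1 + S) else ln (1 + S + I))
        + 3 * ennreal ((cmod (fst (relay_in x \<omega> i)))\<^sup>2) + 3 * ennreal ((cmod (snd (fst \<omega>) i))\<^sup>2))"
      unfolding num using logs
      by (intro sum.cong refl)
         (simp add: ennreal_plus[symmetric] ennreal_mult[symmetric] add_nonneg_nonneg algebra_simps del: ennreal_plus ennreal_numeral)
    finally show "ennreal (mac_bound n x \<omega>) = \<dots>" .
  qed
  also have "\<dots> = (\<Sum>i<n. ennreal (ln 2 + 3 * (cmod (x i))\<^sup>2)
        + ennreal (listen_prob x i * ln (1 + S) + (1 - listen_prob x i) * ln (1 + S + I))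
        + 3 * (\<integral>\<^sup>+ \<omega>. ennreal ((cmod (fst (relay_in x \<omega> i)))\<^sup>2) \<partial>noise_space)
        + 3 * (\<integral>\<^sup>+ z. ennreal ((cmod z)\<^sup>2) \<partial>cgauss))"
    using logs
    by (subst nn_integral_sum, measurable, intro sum.cong refl)
       (simp add: nn_integral_add nn_integral_cmult P.nn_integral_two_valued P.emeasure_space_1[simplified]
         nn_integral_dest_noise[of "\<lambda>z. ennreal ((cmod z)\<^sup>2)"])
  also have "\<dots> \<le> (\<Sum>i<n. ennreal (ln 2 + 3 * (cmod (x i))\<^sup>2)
        + ennreal (listen_prob x i * ln (1 + S) + (1 - listen_prob x i) * ln (1 + S + I))
        + 3 * (\<integral>\<^sup>+ \<omega>. ennreal ((cmod (fst (relay_in x \<omega> i)))\<^sup>2) \<partial>noise_space)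
        + 3 * 4)"
    by (intro sum_mono add_mono mult_left_mono cgauss_second_moment) auto
  also have "\<dots> \<le> (\<Sum>i<n. ennreal (13 + (listen_prob x i * ln (1 + S) + (1 - listen_prob x i) * ln (1 + S + I))
        + 3 * (cmod (x i))\<^sup>2)
      + 3 * (\<integral>\<^sup>+ \<omega>. ennreal ((cmod (fst (relay_in x \<omega> i)))\<^sup>2) \<partial>noise_space))"
  proof (rule sum_mono)
    fix i
    let ?E = "3 * (\<integral>\<^sup>+ \<omega>. ennreal ((cmod (fst (relay_in x \<omega> i)))\<^sup>2) \<partial>noise_space)"
    let ?q = "listen_prob x i * ln (1 + S) + (1 - listen_prob x i) * ln (1 + S + I)"
    have q: "?q \<ge> 0" using logs by (intro add_nonneg_nonneg mult_nonneg_nonneg) auto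
    have "ennreal (ln 2 + 3 * (cmod (x i))\<^sup>2) + ennreal ?q + ?E + 3 * 4
        = (ennreal (ln 2 + 3 * (cmod (x i))\<^sup>2) + ennreal ?q + ennreal 12) + ?E"
      by (simp add: ac_simps)
    also have "ennreal (ln 2 + 3 * (cmod (x i))\<^sup>2) + ennreal ?q + ennreal 12
        = ennreal (ln 2 + 3 * (cmod (x i))\<^sup>2 + ?q + 12)"
      using q by (subst ennreal_plus[symmetric] , simp, simp)+ simp
    also have "\<dots> \<le> ennreal (13 + ?q + 3 * (cmod (x i))\<^sup>2)"
      using ln_le_minus_one[of 2] by (intro ennreal_leI) simp
    finally show "ennreal (ln 2 + 3 * (cmod (x i))\<^sup>2) + ennreal ?q + ?E + 3 * 4
        \<le> ennreal (13 + ?q + 3 * (cmod (x i))\<^sup>2) + ?E"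
      by (simp add: add_mono)
  qed
  finally show ?thesis .
qed

text \<open>32 is 5 * 4 + 3 * 4, from the second moments of the two noises.\<close>

lemma nn_integral_bc_bound:
  "(\<integral>\<^sup>+ \<omega>. ennreal (bc_bound n x \<omega>) \<partial>noise_space)
    \<le> (\<Sum>i<n. ennreal (32 + (listen_prob x i * ln (1 + C + S) + (1 - listen_prob x i) * ln (1 + S))
        + 5 * (cmod (x i))\<^sup>2))"
proof -
  interpret P: prob_space noise_space by (rule prob_space_noise_space)
  have logs: "ln (1 + S) \<ge> 0" "ln (1 + C + S) \<ge> 0" using gains_nonneg by auto
  have "(\<integral>\<^sup>+ \<omega>. ennreal (bc_bound n x \<omega>) \<partial>noise_space)
      = (\<integral>\<^sup>+ \<omega>. (\<Sum>i<n. ennreal (5 * (cmod (x i))\<^sup>2)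
        + ennreal (if \<not> snd (relay_in x \<omega> i) then ln (1 + C + S) else ln (1 + S))
        + 5 * ennreal ((cmod (fst (fst \<omega>) i))\<^sup>2) + 3 * ennreal ((cmod (snd (fst \<omega>) i))\<^sup>2)) \<partial>noise_space)"
  proof (rule nn_integral_cong)
    fix \<omega>
    have num: "(3 :: ennreal) = ennreal 3" "(5 :: ennreal) = ennreal 5" by simp_all
    have "ennreal (bc_bound n x \<omega>) = (\<Sum>i<n. ennreal (ln (1 + (if snd (relay_in x \<omega> i) then 0 else C) + S)
      + 5 * (cmod (x i))\<^sup>2 + 5 * (cmod (fst (fst \<omega>) i))\<^sup>2 + 3 * (cmod (snd (fst \<omega>) i))\<^sup>2))"
      unfolding bc_bound_def using gains_nonneg
      by (intro sum_ennreal[symmetric] add_nonneg_nonneg) auto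
    also have "\<dots> = (\<Sum>i<n. ennreal (5 * (cmod (x i))\<^sup>2)
        + ennreal (if \<not> snd (relay_in x \<omega> i) then ln (1 + C + S) else ln (1 + S))
        + 5 * ennreal ((cmod (fst (fst \<omega>) i))\<^sup>2) + 3 * ennreal ((cmod (snd (fst \<omega>) i))\<^sup>2))"
      unfolding num using logs
      by (intro sum.cong refl)
         (simp add: ennreal_plus[symmetric] ennreal_mult[symmetric] add_nonneg_nonneg algebra_simps del: ennreal_plus ennreal_numeral)
    finally show "ennreal (bc_bound n x \<omega>) = \<dots>" .
  qed
  also have "\<dots> = (\<Sum>i<n. ennreal (5 * (cmod (x i))\<^sup>2)
        + ennreal (listen_prob x i * ln (1 + C + S) + (1 - listen_prob x i) * ln (1 + S))
        + 5 * (\<integral>\<^sup>+ z. ennreal ((cmod z)\<^sup>2) \<partial>cgauss)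
        + 3 * (\<integral>\<^sup>+ z. ennreal ((cmod z)\<^sup>2) \<partial>cgauss))"
    using logs
    by (subst nn_integral_sum, measurable, intro sum.cong refl)
       (simp add: nn_integral_add nn_integral_cmult P.nn_integral_two_valued P.emeasure_space_1[simplified]
         nn_integral_dest_noise[of "\<lambda>z. ennreal ((cmod z)\<^sup>2)"] nn_integral_relay_noise[of "\<lambda>z. ennreal ((cmod z)\<^sup>2)"])
  also have "\<dots> \<le> (\<Sum>i<n. ennreal (5 * (cmod (x i))\<^sup>2)
        + ennreal (listen_prob x i * ln (1 + C + S) + (1 - listen_prob x i) * ln (1 + S))
        + 5 * 4 + 3 * 4)"
    by (intro sum_mono add_mono mult_left_mono cgauss_second_moment) auto
  also have "\<dots> = (\<Sum>i<n. ennreal (32 + (listen_prob x i * ln (1 + C + S) + (1 - listen_prob x i) * ln (1 + S))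
        + 5 * (cmod (x i))\<^sup>2))"
  proof (rule sum.cong[OF refl])
    fix i
    let ?q = "listen_prob x i * ln (1 + C + S) + (1 - listen_prob x i) * ln (1 + S)"
    have q: "?q \<ge> 0" using logs by (intro add_nonneg_nonneg mult_nonneg_nonneg) auto
    have "ennreal (5 * (cmod (x i))\<^sup>2) + ennreal ?q + 5 * 4 + 3 * 4
        = ennreal (5 * (cmod (x i))\<^sup>2) + ennreal ?q + ennreal 32"
      by (simp add: add.assoc)
    also have "\<dots> = ennreal (5 * (cmod (x i))\<^sup>2 + ?q + 32)"
      using q by (subst ennreal_plus[symmetric] , simp, simp)+ simp
    finally show "ennreal (5 * (cmod (x i))\<^sup>2) + ennreal ?q + 5 * 4 + 3 * 4
        = ennreal (32 + ?q + 5 * (cmod (x i))\<^sup>2)"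
      by (simp add: ac_simps)
  qed
  finally show ?thesis .
qed

end


section \<open>Both cut bounds for a single code, and their combination\<close>

lemma converse_bounds:
  fixes x :: "nat \<Rightarrow> nat \<Rightarrow> complex" and \<theta> :: real
  assumes gains: "C \<ge> 0" "S \<ge> 0" "I \<ge> 0"
    and ok: "hd_code_ok C N M x rl dec" and N: "N > 0" and M: "M > 0"
  defines "e \<equiv> hd_err_prob C S I \<theta> N M x rl dec"
  obtains \<tau> where "0 \<le> \<tau>" "\<tau> \<le> 1"
    "(1 - e) * ln M \<le> 1 + real N * (37 + \<tau> * ln (1 + C + S) + (1 - \<tau>) * ln (1 + S))"
    "(1 - e) * ln M \<le> 1 + real N * (19 + \<tau> * ln (1 + S) + (1 - \<tau>) * ln (1 + S + I))"
proof -
  interpret half_duplex C S I \<theta> rl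
    using gains ok by unfold_locales (auto simp: hd_code_ok_def)
  interpret P: prob_space noise_space by (rule prob_space_noise_space)
  have dec [measurable]: "dec \<in> measurable cseq (count_space UNIV)"
    and power_s: "(\<Sum>m<M. \<Sum>i<N. (cmod (x m i))\<^sup>2) \<le> real M * real N"
    and power_r: "(\<Sum>m<M. \<Sum>i<N. \<integral>\<^sup>+ \<omega>. ennreal ((cmod (fst (relay_in (x m) \<omega> i)))\<^sup>2) \<partial>noise_space)
      \<le> ennreal (real M * real N)"
    using ok by (auto simp: hd_code_ok_def)
  define A where "A m = {\<omega>. dec (received N (x m) \<omega>) = m}" for m
  have A [measurable]: "A m \<in> P.events" for m
  proof -
    have "{\<omega> \<in> space noise_space. dec (received N (x m) \<omega>) = m} \<in> P.events" by measurable
    thus ?thesis by (simp add: A_def)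
  qed
  have err: "(\<Sum>m<M. P.prob (A m)) = real M * (1 - e)"
  proof -
    have "e = (\<Sum>m<M. P.prob (space noise_space - A m)) / real M"
      unfolding e_def hd_err_prob_def A_def by (intro arg_cong2[where f = "(/)"] sum.cong arg_cong2[where f = measure]) auto
    also have "\<dots> = (\<Sum>m<M. 1 - P.prob (A m)) / real M"
      by (simp only: P.prob_compl[OF A])
    finally show ?thesis using M by (simp add: sum_subtractf field_simps)
  qed
  have ln_M: "ln (real M) \<ge> 0" using M by simp
  \<comment> \<open>Both bounds are affine in the listening probabilities, so only their average
    over messages and times survives.\<close>
  define \<tau> where "\<tau> = (\<Sum>m<M. \<Sum>i<N. listen_prob (x m) i) / (real M * real N)"
  have MN: "real M * real N > 0" using M N by simp
  have sum_listen: "(\<Sum>m<M. \<Sum>i<N. listen_prob (x m) i) = real M * real N * \<tau>"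
    using MN by (simp add: \<tau>_def)
  have "\<tau> \<ge> 0" unfolding \<tau>_def by (intro divide_nonneg_nonneg sum_nonneg) auto
  moreover have "\<tau> \<le> 1"
  proof -
    have "(\<Sum>m<M. \<Sum>i<N. listen_prob (x m) i) \<le> (\<Sum>m<M. \<Sum>i<N. 1)"
      by (intro sum_mono) auto
    thus ?thesis using MN by (simp add: \<tau>_def divide_le_eq)
  qed
  moreover have average: "(\<Sum>m<M. \<Sum>i<N. k + (listen_prob (x m) i * a + (1 - listen_prob (x m) i) * b) + d * (cmod (x m i))\<^sup>2)
      \<le> real M * (real N * (k + d + \<tau> * a + (1 - \<tau>) * b))" if "d \<ge> 0" for k a b d
  proof -
    have "(\<Sum>m<M. \<Sum>i<N. k + (listen_prob (x m) i * a + (1 - listen_prob (x m) i) * b) + d * (cmod (x m i))\<^sup>2)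
        = real M * real N * (k + b) + (\<Sum>m<M. \<Sum>i<N. listen_prob (x m) i) * (a - b)
          + d * (\<Sum>m<M. \<Sum>i<N. (cmod (x m i))\<^sup>2)"
      by (simp add: sum.distrib sum_subtractf sum_distrib_left sum_distrib_right algebra_simps)
    also have "\<dots> \<le> real M * real N * (k + b) + real M * real N * \<tau> * (a - b) + d * (real M * real N)"
      using mult_left_mono[OF power_s that] unfolding sum_listen by linarith
    finally show ?thesis by (simp add: algebra_simps)
  qed
  have logs: "ln (1 + S) \<ge> 0" "ln (1 + C + S) \<ge> 0" "ln (1 + S + I) \<ge> 0" using gains by auto
  have conclude: "(1 - e) * ln M \<le> 1 + B"
    if "(\<Sum>m<M. ennreal (P.prob (A m) * ln M)) \<le> ennreal (real M * B) + of_nat M" "B \<ge> 0" for B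
  proof -
    have "(\<Sum>m<M. ennreal (P.prob (A m) * ln M)) = ennreal (real M * (1 - e) * ln M)"
      using ln_M by (subst sum_ennreal) (auto simp: err[symmetric] sum_distrib_right)
    moreover have "ennreal (real M * B) + of_nat M = ennreal (real M * (1 + B))"
      using that(2) by (simp add: ennreal_plus[symmetric] ennreal_of_nat_eq_real_of_nat algebra_simps del: ennreal_plus)
    ultimately have "real M * ((1 - e) * ln M) \<le> real M * (1 + B)"
      using that by (simp add: ennreal_le_iff mult.assoc)
    thus ?thesis using M by simp
  qed
  \<comment> \<open>37 is 32 plus 5 from the source power.\<close>
  have "(1 - e) * ln M \<le> 1 + real N * (37 + \<tau> * ln (1 + C + S) + (1 - \<tau>) * ln (1 + S))"
  proof (rule conclude)
    have "(\<Sum>m<M. ennreal (P.prob (A m) * ln M))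
        \<le> (\<Sum>m<M. \<integral>\<^sup>+ \<omega>. ennreal (bc_bound N (x m) \<omega>) \<partial>noise_space) + of_nat M"
    proof (rule P.fano_change_of_measure[where r = "\<lambda>m. bc_ratio N (x m)"])
      show "(\<integral>\<^sup>+ \<omega>. ennreal (bc_ratio N (x m) \<omega>) \<partial>noise_space) = 1" for m
        using bc_change_of_measure[of "\<lambda>_. 1" N "x m"] by (simp add: bc_reference_1)
      show "(\<Sum>m<M. \<integral>\<^sup>+ \<omega>. indicator (A m) \<omega> * ennreal (bc_ratio N (x m) \<omega>) \<partial>noise_space) \<le> 1"
        unfolding A_def
        by (rule sum_decoding_mass[where K = "bc_reference N"]) (auto simp: bc_change_of_measure bc_reference_1)
    qed (use M bc_ratio_pos bc_ratio_bound bc_bound_nonneg in auto)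
    also have "(\<Sum>m<M. \<integral>\<^sup>+ \<omega>. ennreal (bc_bound N (x m) \<omega>) \<partial>noise_space)
        \<le> (\<Sum>m<M. \<Sum>i<N. ennreal (32 + (listen_prob (x m) i * ln (1 + C + S) + (1 - listen_prob (x m) i) * ln (1 + S))
          + 5 * (cmod (x m i))\<^sup>2))"
      by (intro sum_mono nn_integral_bc_bound)
    also have "\<dots> = ennreal (\<Sum>m<M. \<Sum>i<N. 32 + (listen_prob (x m) i * ln (1 + C + S) + (1 - listen_prob (x m) i) * ln (1 + S))
          + 5 * (cmod (x m i))\<^sup>2)"
      using logs by (subst sum_ennreal; intro sum_nonneg sum.cong refl sum_ennreal add_nonneg_nonneg mult_nonneg_nonneg) auto
    also have "\<dots> \<le> ennreal (real M * (real N * (37 + \<tau> * ln (1 + C + S) + (1 - \<tau>) * ln (1 + S))))"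
      using average[of 5 32] by (intro ennreal_leI) simp
    finally show "(\<Sum>m<M. ennreal (P.prob (A m) * ln M))
        \<le> ennreal (real M * (real N * (37 + \<tau> * ln (1 + C + S) + (1 - \<tau>) * ln (1 + S)))) + of_nat M"
      by (simp add: add_right_mono)
    show "0 \<le> real N * (37 + \<tau> * ln (1 + C + S) + (1 - \<tau>) * ln (1 + S))"
      using logs \<open>0 \<le> \<tau>\<close> \<open>\<tau> \<le> 1\<close> by (intro mult_nonneg_nonneg add_nonneg_nonneg) auto
  qed
  \<comment> \<open>19 is 13 plus 3 for each of the two power constraints.\<close>
  moreover have "(1 - e) * ln M \<le> 1 + real N * (19 + \<tau> * ln (1 + S) + (1 - \<tau>) * ln (1 + S + I))"
  proof (rule conclude)
    have "(\<Sum>m<M. ennreal (P.prob (A m) * ln M))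
        \<le> (\<Sum>m<M. \<integral>\<^sup>+ \<omega>. ennreal (mac_bound N (x m) \<omega>) \<partial>noise_space) + of_nat M"
    proof (rule P.fano_change_of_measure[where r = "\<lambda>m. mac_ratio N (x m)"])
      have mac_1: "reweighted mac_density N (\<lambda>_ _. 0) (\<lambda>_. 1) = 1"
        by (rule reweighted_1) (auto simp: mac_density_pos less_imp_le nn_integral_mac_density simp del: fun_upd_apply)
      show "(\<integral>\<^sup>+ \<omega>. ennreal (mac_ratio N (x m) \<omega>) \<partial>noise_space) = 1" for m
        using mac_change_of_measure[of "\<lambda>_. 1" N "x m"] by (simp add: mac_1)
      show "(\<Sum>m<M. \<integral>\<^sup>+ \<omega>. indicator (A m) \<omega> * ennreal (mac_ratio N (x m) \<omega>) \<partial>noise_space) \<le> 1"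
        unfolding A_def
        by (rule sum_decoding_mass[where K = "reweighted mac_density N (\<lambda>_ _. 0)"])
           (auto simp: mac_change_of_measure mac_1)
    qed (use M mac_ratio_pos mac_ratio_bound mac_bound_nonneg in auto)
    also have "(\<Sum>m<M. \<integral>\<^sup>+ \<omega>. ennreal (mac_bound N (x m) \<omega>) \<partial>noise_space)
        \<le> (\<Sum>m<M. \<Sum>i<N. ennreal (13 + (listen_prob (x m) i * ln (1 + S) + (1 - listen_prob (x m) i) * ln (1 + S + I))
          + 3 * (cmod (x m i))\<^sup>2)
          + 3 * (\<integral>\<^sup>+ \<omega>. ennreal ((cmod (fst (relay_in (x m) \<omega> i)))\<^sup>2) \<partial>noise_space))"
      by (intro sum_mono nn_integral_mac_bound)
    also have "\<dots> = (\<Sum>m<M. \<Sum>i<N. ennreal (13 + (listen_prob (x m) i * ln (1 + S) + (1 - listen_prob (x m) i) * ln (1 + S + I))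
          + 3 * (cmod (x m i))\<^sup>2))
          + 3 * (\<Sum>m<M. \<Sum>i<N. \<integral>\<^sup>+ \<omega>. ennreal ((cmod (fst (relay_in (x m) \<omega> i)))\<^sup>2) \<partial>noise_space)"
      by (simp only: sum.distrib sum_distrib_left)
    also have "\<dots> \<le> (\<Sum>m<M. \<Sum>i<N. ennreal (13 + (listen_prob (x m) i * ln (1 + S) + (1 - listen_prob (x m) i) * ln (1 + S + I))
          + 3 * (cmod (x m i))\<^sup>2)) + 3 * ennreal (real M * real N)"
      by (intro add_mono mult_left_mono power_r) auto
    also have "(\<Sum>m<M. \<Sum>i<N. ennreal (13 + (listen_prob (x m) i * ln (1 + S) + (1 - listen_prob (x m) i) * ln (1 + S + I))
          + 3 * (cmod (x m i))\<^sup>2))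
        = ennreal (\<Sum>m<M. \<Sum>i<N. 13 + (listen_prob (x m) i * ln (1 + S) + (1 - listen_prob (x m) i) * ln (1 + S + I))
          + 3 * (cmod (x m i))\<^sup>2)"
      using logs by (subst sum_ennreal; intro sum_nonneg sum.cong refl sum_ennreal add_nonneg_nonneg mult_nonneg_nonneg) auto
    also have "\<dots> \<le> ennreal (real M * (real N * (16 + \<tau> * ln (1 + S) + (1 - \<tau>) * ln (1 + S + I))))"
      using average[of 3 13] by (intro ennreal_leI) simp
    also have "\<dots> + 3 * ennreal (real M * real N)
        = ennreal (real M * (real N * (19 + \<tau> * ln (1 + S) + (1 - \<tau>) * ln (1 + S + I))))"
    proof -
      let ?g = "16 + \<tau> * ln (1 + S) + (1 - \<tau>) * ln (1 + S + I)"
      have "?g \<ge> 0"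
        using logs \<open>0 \<le> \<tau>\<close> \<open>\<tau> \<le> 1\<close> by (intro add_nonneg_nonneg mult_nonneg_nonneg) auto
      hence "ennreal (real M * (real N * ?g)) + ennreal (3 * (real M * real N))
          = ennreal (real M * (real N * ?g) + 3 * (real M * real N))"
        by (intro ennreal_plus[symmetric]) auto
      moreover have "3 * ennreal (real M * real N) = ennreal (3 * (real M * real N))"
        by (simp add: ennreal_mult)
      moreover have "real M * (real N * ?g) + 3 * (real M * real N)
          = real M * (real N * (19 + \<tau> * ln (1 + S) + (1 - \<tau>) * ln (1 + S + I)))"
        by (simp add: algebra_simps)
      ultimately show ?thesis by simp
    qed
    finally show "(\<Sum>m<M. ennreal (P.prob (A m) * ln M))
        \<le> ennreal (real M * (real N * (19 + \<tau> * ln (1 + S) + (1 - \<tau>) * ln (1 + S + I)))) + of_nat M"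
      by (simp add: add_right_mono add_left_mono)
    show "0 \<le> real N * (19 + \<tau> * ln (1 + S) + (1 - \<tau>) * ln (1 + S + I))"
      using logs \<open>0 \<le> \<tau>\<close> \<open>\<tau> \<le> 1\<close> by (intro mult_nonneg_nonneg add_nonneg_nonneg) auto
  qed
  ultimately show ?thesis by (rule that)
qed

text \<open>The weight \<open>w\<close> belongs to the broadcast cut, \<open>1 - w\<close> to the multiple-access cut.\<close>

lemma achievable_rate_le:
  assumes gains: "C \<ge> 0" "S \<ge> 0" "I \<ge> 0"
    and R: "hd_achievable C S I \<theta> R"
    and w: "w \<ge> 0" "w \<le> 1"
  shows "R * ln 2 \<le> 37 + max (w * ln (1 + C + S) + (1 - w) * ln (1 + S))
    (w * ln (1 + S) + (1 - w) * ln (1 + S + I))" (is "_ \<le> 37 + max ?a ?b")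
proof (cases "R > 0")
  case True
  have "(1 - \<epsilon>) * (R * ln 2) \<le> \<epsilon> + (37 + max ?a ?b)" if \<epsilon>: "\<epsilon> > 0" "\<epsilon> < 1" for \<epsilon>
  proof -
    \<comment> \<open>At this block length the additive 1 of the Fano bound is at most
      \<open>\<epsilon>\<close> per channel use.\<close>
    obtain N x rl dec where N: "N \<ge> nat \<lceil>1 / \<epsilon>\<rceil>" "N > 0"
      and ok: "hd_code_ok C N (nat \<lceil>2 powr (real N * R)\<rceil>) x rl dec"
      and err: "hd_err_prob C S I \<theta> N (nat \<lceil>2 powr (real N * R)\<rceil>) x rl dec \<le> \<epsilon>"
      using R \<epsilon> unfolding hd_achievable_def Let_def by blast
    define M where "M = nat \<lceil>2 powr (real N * R)\<rceil>"
    let ?e = "hd_err_prob C S I \<theta> N M x rl dec"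
    have M_ge: "real M \<ge> 2 powr (real N * R)" unfolding M_def by linarith
    moreover have "(2::real) powr (real N * R) > 0" by simp
    ultimately have M: "M > 0" by (metis less_le_trans of_nat_0_less_iff)
    obtain \<tau> where \<tau>: "0 \<le> \<tau>" "\<tau> \<le> 1"
      "(1 - ?e) * ln M \<le> 1 + real N * (37 + \<tau> * ln (1 + C + S) + (1 - \<tau>) * ln (1 + S))"
      "(1 - ?e) * ln M \<le> 1 + real N * (19 + \<tau> * ln (1 + S) + (1 - \<tau>) * ln (1 + S + I))"
      using converse_bounds[OF gains ok[folded M_def] N(2) M] by metis
    have "real N * R * ln 2 \<le> ln M"
      using M_ge M by (subst ln_powr[symmetric]) (auto simp del: ln_powr)
    moreover have "1 - \<epsilon> \<le> 1 - ?e" using err by (simp add: M_def)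
    ultimately have low: "(1 - \<epsilon>) * (real N * R * ln 2) \<le> (1 - ?e) * ln M"
      using \<epsilon> True by (intro mult_mono) auto
    have "(1 - \<epsilon>) * (real N * R * ln 2) = w * ((1 - \<epsilon>) * (real N * R * ln 2)) + (1 - w) * ((1 - \<epsilon>) * (real N * R * ln 2))"
      by (simp add: algebra_simps)
    also have "\<dots> \<le> w * (1 + real N * (37 + \<tau> * ln (1 + C + S) + (1 - \<tau>) * ln (1 + S)))
        + (1 - w) * (1 + real N * (37 + \<tau> * ln (1 + S) + (1 - \<tau>) * ln (1 + S + I)))"
    proof (intro add_mono mult_left_mono)
      have "real N * (19 + \<tau> * ln (1 + S) + (1 - \<tau>) * ln (1 + S + I)) \<le> real N * (37 + \<tau> * ln (1 + S) + (1 - \<tau>) * ln (1 + S + I))"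
        by (intro mult_left_mono) auto
      thus "(1 - \<epsilon>) * (real N * R * ln 2) \<le> 1 + real N * (37 + \<tau> * ln (1 + S) + (1 - \<tau>) * ln (1 + S + I))"
        using low \<tau>(4) by linarith
    qed (use low \<tau>(3) w in auto)
    \<comment> \<open>Regrouped by \<open>\<tau>\<close>, the bound is a convex combination of
      \<open>?a\<close> and \<open>?b\<close>; their maximum is free of the unknown listening
      fraction.\<close>
    also have "\<dots> = 1 + real N * (37 + (\<tau> * ?a + (1 - \<tau>) * ?b))"
      by (simp add: algebra_simps)
    also have "\<tau> * ?a + (1 - \<tau>) * ?b \<le> \<tau> * max ?a ?b + (1 - \<tau>) * max ?a ?b"
      using \<tau> by (intro add_mono mult_left_mono) auto
    also have "\<dots> = max ?a ?b" by (simp add: algebra_simps)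
    finally have up: "(1 - \<epsilon>) * (real N * R * ln 2) \<le> 1 + real N * (37 + max ?a ?b)"
      using N by (simp add: mult_left_mono)
    have one: "1 \<le> real N * \<epsilon>"
    proof -
      have "1 / \<epsilon> \<le> real N" using N(1) by linarith
      thus ?thesis using \<epsilon> by (simp add: field_simps)
    qed
    have "real N * ((1 - \<epsilon>) * (R * ln 2)) = (1 - \<epsilon>) * (real N * R * ln 2)"
      by (simp only: ac_simps)
    also have "\<dots> \<le> real N * \<epsilon> + real N * (37 + max ?a ?b)"
      using up one by linarith
    also have "\<dots> = real N * (\<epsilon> + (37 + max ?a ?b))"
      by (simp only: distrib_left)
    finally have "real N * ((1 - \<epsilon>) * (R * ln 2)) \<le> real N * (\<epsilon> + (37 + max ?a ?b))" .
    thus ?thesis using N by simp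
  qed
  hence ev: "eventually (\<lambda>\<epsilon>. (1 - \<epsilon>) * (R * ln 2) \<le> \<epsilon> + (37 + max ?a ?b)) (at_right (0::real))"
    by (auto simp: eventually_at_right_field intro!: exI[of _ 1])
  have "((\<lambda>\<epsilon>. (1 - \<epsilon>) * (R * ln 2)) \<longlongrightarrow> (1 - 0) * (R * ln 2)) (at_right (0::real))"
    by (intro tendsto_intros)
  moreover have "((\<lambda>\<epsilon>. \<epsilon> + (37 + max ?a ?b)) \<longlongrightarrow> 0 + (37 + max ?a ?b)) (at_right (0::real))"
    by (intro tendsto_intros)
  ultimately have "(1 - 0) * (R * ln 2) \<le> 0 + (37 + max ?a ?b)"
    using ev by (intro tendsto_le[OF trivial_limit_at_right_real]) auto
  thus ?thesis by simp
next
  case False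
  have "?a \<ge> 0" using gains w by (intro add_nonneg_nonneg mult_nonneg_nonneg) auto
  moreover have "R * ln 2 \<le> 0" using False by (simp add: mult_le_0_iff)
  ultimately show ?thesis by linarith
qed

section \<open>Achievability\<close>

definition exceedances :: "real \<Rightarrow> (nat \<Rightarrow> complex) \<Rightarrow> nat \<Rightarrow> nat set" where
  "exceedances t w N = {i. i < N \<and> cmod (w i) > t}"

lemma finite_exceedances [simp]: "finite (exceedances t w N)"
  by (simp add: exceedances_def)

lemma card_exceedances_eq_sum:
  "real (card (exceedances t w N)) = (\<Sum>i<N. if cmod (w i) > t then 1 else 0)"
proof -
  have "(\<Sum>i<N. if cmod (w i) > t then 1 else 0) = (\<Sum>i\<in>{i \<in> {..<N}. cmod (w i) > t}. 1 :: real)"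
    by (rule sum.inter_filter[symmetric]) simp
  also have "{i \<in> {..<N}. cmod (w i) > t} = exceedances t w N"
    by (auto simp: exceedances_def)
  finally show ?thesis by simp
qed

lemma measurable_card_exceedances [measurable]:
  "(\<lambda>w. real (card (exceedances t w N))) \<in> borel_measurable cseq"
  unfolding card_exceedances_eq_sum by measurable

lemma cgauss_tail:
  assumes "t > 0"
  shows "measure cgauss {z. cmod z > t} \<le> 4 / t\<^sup>2"
proof -
  interpret G: prob_space cgauss by (rule prob_space_cgauss)
  have "ennreal (measure cgauss {z. cmod z > t}) = emeasure cgauss {z. cmod z > t}"
    by (simp add: G.emeasure_eq_measure)
  also have "\<dots> = (\<integral>\<^sup>+ z. indicator {z. cmod z > t} z \<partial>cgauss)"
    by simp
  also have "\<dots> \<le> (\<integral>\<^sup>+ z. ennreal (1 / t\<^sup>2) * ennreal ((cmod z)\<^sup>2) \<partial>cgauss)"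
  proof (rule nn_integral_mono)
    fix z :: complex
    show "indicator {z. cmod z > t} z \<le> ennreal (1 / t\<^sup>2) * ennreal ((cmod z)\<^sup>2)"
    proof (cases "cmod z > t")
      case True
      hence "t\<^sup>2 \<le> (cmod z)\<^sup>2" using assms by (intro power_mono) auto
      hence "1 \<le> (1 / t\<^sup>2) * (cmod z)\<^sup>2" using assms by (simp add: field_simps)
      hence "1 \<le> ennreal ((1 / t\<^sup>2) * (cmod z)\<^sup>2)" by (metis ennreal_1 ennreal_leI)
      thus ?thesis using True by (simp add: ennreal_mult' flip: ennreal_mult')
    qed simp
  qed
  also have "\<dots> \<le> ennreal (1 / t\<^sup>2) * 4"
    by (subst nn_integral_cmult) (auto intro!: mult_left_mono cgauss_second_moment)
  also have "\<dots> = ennreal (4 / t\<^sup>2)"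
    using ennreal_mult'[of 4 "1 / t\<^sup>2"] by (simp add: mult.commute)
  finally show ?thesis by (simp add: ennreal_le_iff)
qed

text \<open>The exceedance indicators are independent with mean at most \<open>4 / t\<^sup>2\<close>
  by Chebyshev, and Hoeffding's inequality controls their sum.\<close>

lemma exceedances_tail:
  assumes t: "t > 0" and \<eta>: "\<eta> > 0" and N: "N > 0"
  shows "measure noise_seq {w. real (card (exceedances t w N)) \<ge> (4 / t\<^sup>2 + \<eta>) * N} \<le> exp (- 2 * \<eta>\<^sup>2 * N)"
proof -
  interpret G: prob_space cgauss by (rule prob_space_cgauss)
  interpret P: prob_space noise_seq by (rule prob_space_noise_seq)
  let ?f = "\<lambda>z. if cmod z > t then 1 else 0 :: real"
  let ?X = "\<lambda>i w. ?f (w i)"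
  have proj: "(\<lambda>w. w i) \<in> noise_seq \<rightarrow>\<^sub>M cgauss" for i by measurable
  have comp: "distr noise_seq cgauss (\<lambda>w. w i) = cgauss" for i
    by (rule distr_PiM_component) (auto intro: prob_space_cgauss)
  have "P.indep_vars (\<lambda>_. cgauss) (\<lambda>i w. w i) UNIV"
    by (subst P.indep_vars_iff_distr_eq_PiM') (auto simp: comp restrict_def distr_id2)
  hence "P.indep_vars (\<lambda>_. cgauss) (\<lambda>i w. w i) {..<N}"
    by (rule P.indep_vars_subset) simp
  hence indep: "P.indep_vars (\<lambda>_. borel) ?X {..<N}"
    by (rule P.indep_vars_compose2) measurable
  interpret H: Hoeffding_ineq noise_seq "{..<N}" ?X "\<lambda>_. 0" "\<lambda>_. 1" "\<Sum>i<N. P.expectation (?X i)"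
    by unfold_locales (auto simp: indep)
  have exp: "P.expectation (?X i) \<le> 4 / t\<^sup>2" for i
  proof -
    have "P.expectation (?X i) = (\<integral>z. ?f z \<partial>distr noise_seq cgauss (\<lambda>w. w i))"
      by (subst integral_distr) (use proj in auto)
    also have "\<dots> = (\<integral>z. indicator {z. cmod z > t} z \<partial>cgauss)"
      unfolding comp by (intro Bochner_Integration.integral_cong) (auto simp: indicator_def)
    also have "\<dots> = measure cgauss {z. cmod z > t}"
      by (simp add: G.emeasure_eq_measure)
    finally show ?thesis using cgauss_tail[OF t] by simp
  qed
  have mean: "(\<Sum>i<N. P.expectation (?X i)) \<le> N * (4 / t\<^sup>2)"
    using sum_bounded_above[of "{..<N}" "\<lambda>i. P.expectation (?X i)" "4 / t\<^sup>2"] exp by simp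
  have "measure noise_seq {w. real (card (exceedances t w N)) \<ge> (4 / t\<^sup>2 + \<eta>) * N}
      \<le> P.prob {w \<in> space noise_seq. (\<Sum>i<N. ?X i w) \<ge> (\<Sum>i<N. P.expectation (?X i)) + \<eta> * N}"
  proof (rule P.finite_measure_mono)
    show "{w \<in> space noise_seq. (\<Sum>i<N. ?X i w) \<ge> (\<Sum>i<N. P.expectation (?X i)) + \<eta> * N} \<in> P.events"
      by measurable
  qed (use mean in \<open>auto simp: space_PiM algebra_simps card_exceedances_eq_sum\<close>)
  also have "\<dots> \<le> exp (- 2 * (\<eta> * N)\<^sup>2 / (\<Sum>i<N. (1 - 0)\<^sup>2))"
    using \<eta> N by (intro H.Hoeffding_ineq_ge) auto
  also have "\<dots> = exp (- 2 * \<eta>\<^sup>2 * N)"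
    using N by (simp add: power2_eq_square)
  finally show ?thesis .
qed

section \<open>Codes with large Hamming distance\<close>

lemma card_hamming_ball_le:
  fixes g :: "nat \<Rightarrow> nat"
  assumes Q: "Q > 0"
  shows "card {f \<in> {..<n} \<rightarrow>\<^sub>E {..<Q}. card {i. i < n \<and> f i \<noteq> g i} \<le> d} \<le> 2 ^ n * Q ^ d"
    (is "card ?ball \<le> _")
proof -
  \<comment> \<open>\<open>As\<close> lists the possible sets of disagreement, \<open>B A\<close>
    the words that may differ from \<open>g\<close> only on \<open>A\<close>. Counting the sets by
    \<open>2 ^ n\<close> costs one bit per letter of the outer code, a bounded amount per
    frame.\<close>
  define As where "As = {A. A \<subseteq> {..<n} \<and> card A \<le> d}"
  define B where "B A = PiE {..<n} (\<lambda>i. if i \<in> A then {..<Q} else {g i})" for A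
  have fin: "finite As" by (rule finite_subset[of _ "Pow {..<n}"]) (auto simp: As_def)
  have finB: "finite (B A)" for A unfolding B_def by (intro finite_PiE) simp_all
  have sub: "?ball \<subseteq> (\<Union>A\<in>As. B A)"
  proof
    fix f assume f: "f \<in> ?ball"
    define A where "A = {i. i < n \<and> f i \<noteq> g i}"
    have "A \<in> As" using f by (auto simp: A_def As_def)
    moreover have "f \<in> B A"
      unfolding B_def
    proof (rule PiE_I)
      fix i assume "i \<in> {..<n}"
      thus "f i \<in> (if i \<in> A then {..<Q} else {g i})" using f by (auto simp: A_def)
    next
      fix i assume "i \<notin> {..<n}"
      thus "f i = undefined" using f PiE_arb[of f "{..<n}" "\<lambda>_. {..<Q}" i] by blast
    qed
    ultimately show "f \<in> (\<Union>A\<in>As. B A)" by blast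
  qed
  have "card ?ball \<le> card (\<Union>A\<in>As. B A)"
    by (rule card_mono[OF finite_UN_I[OF fin finB] sub])
  also have "\<dots> \<le> (\<Sum>A\<in>As. card (B A))"
    by (rule card_UN_le[OF fin])
  also have "\<dots> \<le> (\<Sum>A\<in>As. Q ^ d)"
  proof (rule sum_mono)
    fix A assume A: "A \<in> As"
    have "card (B A) = (\<Prod>i<n. card (if i \<in> A then {..<Q} else {g i}))"
      unfolding B_def by (rule card_PiE) simp
    also have "\<dots> = (\<Prod>i<n. if i \<in> A then Q else 1)"
      by (intro prod.cong refl) simp
    also have "\<dots> = (\<Prod>i\<in>{i \<in> {..<n}. i \<in> A}. Q)"
      by (rule prod.inter_filter[symmetric]) simp
    also have "{i \<in> {..<n}. i \<in> A} = A" using A by (auto simp: As_def)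
    also have "(\<Prod>i\<in>A. Q) = Q ^ card A" by simp
    also have "\<dots> \<le> Q ^ d" using A Q by (intro power_increasing) (auto simp: As_def)
    finally show "card (B A) \<le> Q ^ d" .
  qed
  also have "\<dots> = card As * Q ^ d" by simp
  also have "\<dots> \<le> 2 ^ n * Q ^ d"
  proof (rule mult_right_mono)
    have "card As \<le> card (Pow {..<n})" by (intro card_mono) (auto simp: As_def)
    thus "card As \<le> 2 ^ n" by (simp add: card_Pow)
  qed simp
  finally show ?thesis .
qed

text \<open>Greedy choice: while the balls around the words chosen so far do not exhaust the space,
  one more word can be added. The last of \<open>k\<close> words has to avoid \<open>k - 1\<close>
  balls.\<close>

lemma gilbert_varshamov:
  fixes Q n d k :: nat
  assumes Q: "Q > 0" and k: "(k - 1) * (2 ^ n * Q ^ d) < Q ^ n"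
  shows "\<exists>c. (\<forall>m<k. c m \<in> {..<n} \<rightarrow>\<^sub>E {..<Q}) \<and> (\<forall>m<k. \<forall>m'<m. card {i. i < n \<and> c m i \<noteq> c m' i} > d)"
  using k
proof (induction k)
  case 0
  show ?case by simp
next
  case (Suc k)
  have "(k - 1) * (2 ^ n * Q ^ d) \<le> k * (2 ^ n * Q ^ d)" by (intro mult_right_mono) auto
  also have "\<dots> < Q ^ n" using Suc.prems by simp
  finally obtain c where c: "\<forall>m<k. c m \<in> {..<n} \<rightarrow>\<^sub>E {..<Q}"
    "\<forall>m<k. \<forall>m'<m. card {i. i < n \<and> c m i \<noteq> c m' i} > d"
    using Suc.IH by blast
  let ?ball = "\<lambda>g. {f \<in> {..<n} \<rightarrow>\<^sub>E {..<Q}. card {i. i < n \<and> f i \<noteq> g i} \<le> d}"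
  have finW: "finite ({..<n} \<rightarrow>\<^sub>E {..<Q})" by (intro finite_PiE) auto
  have fin: "finite (\<Union>m<k. ?ball (c m))" using finW by auto
  have "card (\<Union>m<k. ?ball (c m)) \<le> (\<Sum>m<k. card (?ball (c m)))"
    by (rule card_UN_le) simp
  also have "\<dots> \<le> (\<Sum>m<k. 2 ^ n * Q ^ d)"
    by (intro sum_mono card_hamming_ball_le Q)
  also have "\<dots> < Q ^ n" using Suc.prems by simp
  also have "Q ^ n = card ({..<n} \<rightarrow>\<^sub>E {..<Q})" by (simp add: card_PiE)
  finally have "\<not> {..<n} \<rightarrow>\<^sub>E {..<Q} \<subseteq> (\<Union>m<k. ?ball (c m))"
    using card_mono[OF fin, of "{..<n} \<rightarrow>\<^sub>E {..<Q}"] by linarith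
  then obtain f where f: "f \<in> {..<n} \<rightarrow>\<^sub>E {..<Q}" "f \<notin> (\<Union>m<k. ?ball (c m))" by blast
  have "\<forall>m<k. card {i. i < n \<and> f i \<noteq> c m i} > d"
  proof (intro allI impI)
    fix m assume "m < k"
    hence "f \<notin> ?ball (c m)" using f(2) by blast
    thus "card {i. i < n \<and> f i \<noteq> c m i} > d" using f(1) by simp
  qed
  hence "(\<forall>m<Suc k. (c(k := f)) m \<in> {..<n} \<rightarrow>\<^sub>E {..<Q})
      \<and> (\<forall>m<Suc k. \<forall>m'<m. card {i. i < n \<and> (c(k := f)) m i \<noteq> (c(k := f)) m' i} > d)"
    using c f(1) by (simp add: less_Suc_eq)
  thus ?case by blast
qed

section \<open>Frame codes: relay strategy, decoder and error probability\<close>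

lemma norm_triangle_sub_points:
  fixes a b y :: "'a :: real_normed_vector"
  shows "norm (a - b) \<le> norm (y - a) + norm (y - b)"
  using norm_triangle_ineq4[of "y - b" "y - a"] by (simp add: algebra_simps)

lemma pred_all_near:
  "Measurable.pred cseq (\<lambda>h. \<forall>j<(n::nat). cmod (h (f j) - a j) \<le> t)"
proof -
  have "(\<lambda>h. h i) \<in> borel_measurable cseq" for i :: nat
    by (rule measurable_component_singleton) simp
  hence *: "Measurable.pred cseq (\<lambda>h. cmod (h i - b) \<le> t)" for i b by measurable
  have "Measurable.pred cseq (\<lambda>h. \<forall>j\<in>{..<n}. cmod (h (f j) - a j) \<le> t)"
    by (rule pred_intros_finite(3)[OF finite_lessThan *])
  thus ?thesis by (simp only: Ball_def lessThan_iff)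
qed

lemma measure_noise_space_marginals:
  assumes [measurable]: "A \<in> sets cseq"
  shows "measure noise_space {\<omega>. fst (fst \<omega>) \<in> A} = measure noise_seq A"
    and "measure noise_space {\<omega>. snd (fst \<omega>) \<in> A} = measure noise_seq A"
proof -
  interpret Z: prob_space noise_seq by (rule prob_space_noise_seq)
  interpret U: prob_space seed by (rule prob_space_seed)
  have A: "A \<in> sets noise_seq" by (simp add: sets_noise_seq)
  have fst_meas: "{\<omega>. fst (fst \<omega>) \<in> A} \<in> sets noise_space" "{\<omega>. snd (fst \<omega>) \<in> A} \<in> sets noise_space"
  proof -
    have "{\<omega> \<in> space noise_space. fst (fst \<omega>) \<in> A} \<in> sets noise_space"
      "{\<omega> \<in> space noise_space. snd (fst \<omega>) \<in> A} \<in> sets noise_space"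
      by measurable
    thus "{\<omega>. fst (fst \<omega>) \<in> A} \<in> sets noise_space" "{\<omega>. snd (fst \<omega>) \<in> A} \<in> sets noise_space"
      by simp_all
  qed
  have "emeasure noise_space {\<omega>. fst (fst \<omega>) \<in> A} = (\<integral>\<^sup>+ \<omega>. indicator A (fst (fst \<omega>)) \<partial>noise_space)"
    by (subst nn_integral_indicator[OF fst_meas(1), symmetric]) (auto intro!: nn_integral_cong simp: indicator_def)
  also have "\<dots> = emeasure noise_seq A"
    by (subst nn_integral_noise_space) (auto simp: Z.emeasure_space_1 U.emeasure_space_1[simplified] A)
  finally show "measure noise_space {\<omega>. fst (fst \<omega>) \<in> A} = measure noise_seq A"
    by (simp add: measure_def)
  have "emeasure noise_space {\<omega>. snd (fst \<omega>) \<in> A} = (\<integral>\<^sup>+ \<omega>. indicator A (snd (fst \<omega>)) \<partial>noise_space)"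
    by (subst nn_integral_indicator[OF fst_meas(2), symmetric]) (auto intro!: nn_integral_cong simp: indicator_def)
  also have "\<dots> = emeasure noise_seq A"
    by (subst nn_integral_noise_space) (auto simp: Z.emeasure_space_1 U.emeasure_space_1[simplified] A)
  finally show "measure noise_space {\<omega>. snd (fst \<omega>) \<in> A} = measure noise_seq A"
    by (simp add: measure_def)
qed

text \<open>A frame has \<open>Q\<close> possible words, \<open>T1\<close> listening slots and
  \<open>T - T1\<close> forwarding slots. The radius \<open>2 * t\<close> is that of two candidates
  each within \<open>t\<close> of the same received value. The relay has to recover its own symbols
  \<open>g\<close> rather than the word. The bounds on \<open>xs\<close> and \<open>g\<close> hold
  for all indices, so the power constraint survives a wrong guess.\<close>

locale frame_code =
  fixes C S I \<theta> t :: real and T T1 Q :: nat and xs g :: "nat \<Rightarrow> nat \<Rightarrow> complex"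
  assumes gains_nonneg: "C \<ge> 0" "S \<ge> 0" "I \<ge> 0" and t_pos: "t > 0"
    and frame_length: "0 < T" "T1 \<le> T" and Q_pos: "Q > 0"
    and xs_le: "\<And>w j. cmod (xs w j) \<le> 1" and g_le: "\<And>w j. cmod (g w j) \<le> 1"
    and relay_separation: "\<And>w w' j. \<lbrakk>w < Q; w' < Q;
      \<And>i. i < T1 \<Longrightarrow> cmod (complex_of_real (sqrt C) * xs w i - complex_of_real (sqrt C) * xs w' i) \<le> 2 * t;
      T1 \<le> j; j < T\<rbrakk> \<Longrightarrow> g w j = g w' j"
    and dest_separation: "\<And>w w'. \<lbrakk>w < Q; w' < Q;
      \<And>j. j < T \<Longrightarrow> cmod ((complex_of_real (sqrt S) * xs w j
          + (if T1 \<le> j then cis \<theta> * complex_of_real (sqrt I) * g w j else 0))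
        - (complex_of_real (sqrt S) * xs w' j
          + (if T1 \<le> j then cis \<theta> * complex_of_real (sqrt I) * g w' j else 0))) \<le> 2 * t\<rbrakk> \<Longrightarrow> w = w'"
begin

definition noiseless :: "nat \<Rightarrow> nat \<Rightarrow> complex" where
  "noiseless w j = complex_of_real (sqrt S) * xs w j
    + (if T1 \<le> j then cis \<theta> * complex_of_real (sqrt I) * g w j else 0)"

text \<open>Any word consistent with the listening slots will do. In a noisy frame there may be none
  and the value is arbitrary; such frames are left to the outer code.\<close>

definition relay_guess :: "(nat \<Rightarrow> complex) \<Rightarrow> nat \<Rightarrow> nat" where
  "relay_guess h k = (LEAST w. w < Q \<and> (\<forall>j<T1. cmod (h (k * T + j) - complex_of_real (sqrt C) * xs w j) \<le> t))"

definition frame_relay :: relay_fn where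
  "frame_relay i h u = (if i mod T < T1 then (0, False) else (g (relay_guess h (i div T)) (i mod T), True))"

definition source_word :: "(nat \<Rightarrow> nat) \<Rightarrow> nat \<Rightarrow> complex" where
  "source_word c i = xs (c (i div T)) (i mod T)"

definition inconsistent_frames :: "nat \<Rightarrow> (nat \<Rightarrow> complex) \<Rightarrow> (nat \<Rightarrow> nat) \<Rightarrow> nat set" where
  "inconsistent_frames n y c = {k. k < n \<and> (\<exists>j<T. cmod (y (k * T + j) - noiseless (c k) j) > t)}"

definition frame_decoder :: "nat \<Rightarrow> nat \<Rightarrow> nat \<Rightarrow> (nat \<Rightarrow> nat \<Rightarrow> nat) \<Rightarrow> (nat \<Rightarrow> complex) \<Rightarrow> nat" where
  "frame_decoder n e M c y = (LEAST m. m < M \<and> card (inconsistent_frames n y (c m)) \<le> e)"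

lemma consistent_frame:
  "k < n \<Longrightarrow> k \<notin> inconsistent_frames n y c \<Longrightarrow> j < T \<Longrightarrow> cmod (y (k * T + j) - noiseless (c k) j) \<le> t"
  unfolding inconsistent_frames_def not_less[symmetric] by blast

lemma measurable_relay_guess: "(\<lambda>h. relay_guess h k) \<in> measurable cseq (count_space UNIV)"
  unfolding relay_guess_def
  by (rule measurable_Least) (intro pred_intros_logic(3) pred_all_near, simp)

lemma measurable_frame_relay:
  "(\<lambda>(h, u). frame_relay i h u) \<in> measurable (cseq \<Otimes>\<^sub>M borel) (borel \<Otimes>\<^sub>M count_space UNIV)"
proof (cases "i mod T < T1")
  case False
  have "(\<lambda>p. relay_guess (fst p) (i div T)) \<in> measurable (cseq \<Otimes>\<^sub>M borel) (count_space UNIV)"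
    by (rule measurable_compose[OF measurable_fst measurable_relay_guess])
  hence "(\<lambda>p. g (relay_guess (fst p) (i div T)) (i mod T)) \<in> borel_measurable (cseq \<Otimes>\<^sub>M borel)"
    by (rule measurable_compose[where g = "\<lambda>w. g w (i mod T)"]) simp
  hence "(\<lambda>p. (g (relay_guess (fst p) (i div T)) (i mod T), True))
      \<in> measurable (cseq \<Otimes>\<^sub>M borel) (borel \<Otimes>\<^sub>M count_space UNIV)"
    by (rule measurable_Pair) (rule measurable_const, simp add: space_pair_measure)
  moreover have "(\<lambda>(h, u). frame_relay i h u) = (\<lambda>p. (g (relay_guess (fst p) (i div T)) (i mod T), True))"
    using False by (auto simp: frame_relay_def)
  ultimately show ?thesis by (simp only:)
next
  case True
  hence "(\<lambda>(h, u). frame_relay i h u) = (\<lambda>p. (0, False))"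
    by (auto simp: frame_relay_def)
  thus ?thesis by (simp only:) (rule measurable_const, simp add: space_pair_measure)
qed

lemma measurable_frame_decoder: "frame_decoder n e M c \<in> measurable cseq (count_space UNIV)"
proof -
  let ?G = "\<lambda>m k y. \<forall>j<T. cmod (y (k * T + j) - noiseless (c m k) j) \<le> t"
  have card: "real (card (inconsistent_frames n y (c m))) = (\<Sum>k<n. if ?G m k y then 0 else 1)" for y m
  proof -
    have "(\<Sum>k<n. if ?G m k y then 0 else 1) = (\<Sum>k<n. if \<not> ?G m k y then 1 else 0 :: real)"
      by (intro sum.cong) auto
    also have "\<dots> = (\<Sum>k\<in>{k \<in> {..<n}. \<not> ?G m k y}. 1 :: real)"
      by (rule sum.inter_filter[symmetric]) simp
    also have "{k \<in> {..<n}. \<not> ?G m k y} = inconsistent_frames n y (c m)"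
      by (auto simp: inconsistent_frames_def not_le)
    finally show ?thesis by simp
  qed
  have G: "Measurable.pred cseq (?G m k)" for m k by (rule pred_all_near)
  have "(\<lambda>y. \<Sum>k<n. if ?G m k y then 0 else 1 :: real) \<in> borel_measurable cseq" for m
    by (intro borel_measurable_sum measurable_If) (use G in \<open>auto simp: pred_def\<close>)
  hence "Measurable.pred cseq (\<lambda>y. (\<Sum>k<n. if ?G m k y then 0 else 1) \<le> real e)" for m
    by measurable
  hence "Measurable.pred cseq (\<lambda>y. card (inconsistent_frames n y (c m)) \<le> e)" for m
    unfolding card[symmetric] of_nat_le_iff .
  hence "(\<lambda>y. LEAST m. m < M \<and> card (inconsistent_frames n y (c m)) \<le> e) \<in> measurable cseq (count_space UNIV)"
    by (intro measurable_Least pred_intros_logic(3)) auto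
  thus ?thesis by (simp only: frame_decoder_def[abs_def])
qed

abbreviation noisy_frames :: "nat \<Rightarrow> (nat \<Rightarrow> complex) \<Rightarrow> nat set" where
  "noisy_frames n w \<equiv> (\<lambda>i. i div T) ` exceedances t w (n * T)"

lemma frame_index: "k < n \<Longrightarrow> j < T \<Longrightarrow> k * T + j < n * T"
proof -
  assume "k < n" "j < T"
  hence "k * T + j < Suc k * T" "Suc k * T \<le> n * T"
    using mult_le_mono1[of "Suc k" n T] by simp_all
  thus ?thesis by linarith
qed

lemma quiet_frame:
  assumes "k < n" "k \<notin> noisy_frames n w" "j < T"
  shows "cmod (w (k * T + j)) \<le> t"
proof (rule ccontr)
  assume "\<not> cmod (w (k * T + j)) \<le> t"
  hence "k * T + j \<in> exceedances t w (n * T)"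
    using frame_index[OF assms(1,3)] by (simp add: exceedances_def)
  moreover have "(k * T + j) div T = k" using assms(3) by simp
  ultimately show False using assms(2) by force
qed

lemma yr_past_listen:
  assumes "k * T + j < i" "j < T1"
  shows "yr_past C (source_word c) frame_relay zr u i (k * T + j)
    = complex_of_real (sqrt C) * xs (c k) j + zr (k * T + j)"
  using assms(1)
proof (induction i)
  case (Suc i)
  have j: "j < T" using assms(2) frame_length by linarith
  show ?case
  proof (cases "k * T + j = i")
    case True
    have "i div T = k" "i mod T = j" using j True by auto
    thus ?thesis using True assms(2) by (simp add: Let_def frame_relay_def source_word_def)
  next
    case False
    thus ?thesis using Suc by (simp add: Let_def)
  qed
qed simp

text \<open>Noise bounded by \<open>t\<close> makes the true word pass the test of the relay, so the
  guess passes it too. Two passing words are within \<open>2 * t\<close> in every listening slot,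
  and \<open>relay_separation\<close> yields the same symbols.\<close>

lemma relay_input_quiet:
  assumes k: "k < n" "k \<notin> noisy_frames n zr" and j: "j < T" and c: "c k < Q"
  shows "relay_input C (source_word c) frame_relay zr u (k * T + j)
    = (if j < T1 then (0, False) else (g (c k) j, True))"
proof (cases "j < T1")
  case True
  thus ?thesis using j by (simp add: relay_input_def frame_relay_def)
next
  case False
  let ?h = "yr_past C (source_word c) frame_relay zr u (k * T + j)"
  let ?P = "\<lambda>w. w < Q \<and> (\<forall>j<T1. cmod (?h (k * T + j) - complex_of_real (sqrt C) * xs w j) \<le> t)"
  have true: "?P (c k)"
  proof (intro conjI allI impI c)
    fix j' assume j': "j' < T1"
    have "?h (k * T + j') = complex_of_real (sqrt C) * xs (c k) j' + zr (k * T + j')"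
      using False j' by (intro yr_past_listen) auto
    moreover have "cmod (zr (k * T + j')) \<le> t"
      using quiet_frame[OF k, of j'] j' frame_length by linarith
    ultimately show "cmod (?h (k * T + j') - complex_of_real (sqrt C) * xs (c k) j') \<le> t"
      by (simp only: add_diff_cancel_left')
  qed
  have guess: "?P (relay_guess ?h k)"
    unfolding relay_guess_def by (rule LeastI[of ?P, OF true])
  have "g (relay_guess ?h k) j = g (c k) j"
  proof (rule relay_separation)
    fix i assume i: "i < T1"
    let ?a = "complex_of_real (sqrt C) * xs (relay_guess ?h k) i" and ?b = "complex_of_real (sqrt C) * xs (c k) i"
    have "cmod (?h (k * T + i) - ?a) \<le> t" "cmod (?h (k * T + i) - ?b) \<le> t"
      using i true guess by blast+
    moreover have "cmod (?a - ?b) \<le> cmod (?h (k * T + i) - ?a) + cmod (?h (k * T + i) - ?b)"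
      by (rule norm_triangle_sub_points)
    ultimately show "cmod (?a - ?b) \<le> 2 * t" by linarith
  next
    show "relay_guess ?h k < Q" "c k < Q" using guess true by blast+
  qed (use False j in auto)
  thus ?thesis using False j by (simp add: relay_input_def frame_relay_def)
qed

text \<open>When both noises are quiet in a frame, the relay forwards the right symbols and the
  destination sees the noiseless word up to \<open>t\<close>, whatever happens in other
  frames.\<close>

lemma inconsistent_subset_noisy:
  assumes c: "\<And>k. k < n \<Longrightarrow> c k < Q"
  shows "inconsistent_frames n (dest_out C S I \<theta> (n * T) (source_word c) frame_relay zr zd u) c
    \<subseteq> noisy_frames n zr \<union> noisy_frames n zd"
proof
  let ?y = "dest_out C S I \<theta> (n * T) (source_word c) frame_relay zr zd u"
  fix k assume k: "k \<in> inconsistent_frames n ?y c"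
  show "k \<in> noisy_frames n zr \<union> noisy_frames n zd"
  proof (rule ccontr)
    assume nk: "k \<notin> noisy_frames n zr \<union> noisy_frames n zd"
    from k obtain j where j: "k < n" "j < T" "cmod (?y (k * T + j) - noiseless (c k) j) > t"
      by (auto simp: inconsistent_frames_def)
    have "?y (k * T + j) = noiseless (c k) j + zd (k * T + j)"
      using frame_index[OF j(1,2)] nk j c relay_input_quiet[OF j(1) _ j(2), of zr c u]
      by (simp add: dest_out_def noiseless_def source_word_def)
    moreover have "cmod (zd (k * T + j)) \<le> t" using quiet_frame j nk by blast
    ultimately show False using j(3) by simp
  qed
qed

text \<open>Each exceedance spoils at most one frame, so the sent codeword has at most
  \<open>e\<close> inconsistent frames. In a frame consistent with two codewords these agree by
  \<open>dest_separation\<close>, so two candidates would differ in at most \<open>2 * e\<close>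
  frames, against \<open>dist\<close>.\<close>

lemma frame_decoder_correct:
  assumes c: "\<And>m k. m < M \<Longrightarrow> k < n \<Longrightarrow> c m k < Q"
    and dist: "\<And>m m'. m < M \<Longrightarrow> m' < m \<Longrightarrow> card {k. k < n \<and> c m k \<noteq> c m' k} > 2 * e"
    and m: "m < M"
    and quiet: "card (exceedances t zr (n * T)) + card (exceedances t zd (n * T)) \<le> e"
  shows "frame_decoder n e M c (dest_out C S I \<theta> (n * T) (source_word (c m)) frame_relay zr zd u) = m"
proof -
  let ?y = "dest_out C S I \<theta> (n * T) (source_word (c m)) frame_relay zr zd u"
  let ?P = "\<lambda>m. m < M \<and> card (inconsistent_frames n ?y (c m)) \<le> e"
  have "card (inconsistent_frames n ?y (c m)) \<le> card (noisy_frames n zr \<union> noisy_frames n zd)"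
    using inconsistent_subset_noisy c m by (intro card_mono) auto
  also have "\<dots> \<le> card (noisy_frames n zr) + card (noisy_frames n zd)" by (rule card_Un_le)
  also have "\<dots> \<le> e"
    using quiet card_image_le[of "exceedances t zr (n * T)" "\<lambda>i. i div T"]
      card_image_le[of "exceedances t zd (n * T)" "\<lambda>i. i div T"] by (simp add: add_mono order_trans)
  finally have Pm: "?P m" using m by simp
  have "m' = m" if P': "?P m'" for m'
  proof (rule ccontr)
    assume ne: "m' \<noteq> m"
    have fin: "finite (inconsistent_frames n ?y (c i))" for i
      by (simp add: inconsistent_frames_def)
    have "{k. k < n \<and> c m k \<noteq> c m' k} \<subseteq> inconsistent_frames n ?y (c m) \<union> inconsistent_frames n ?y (c m')"
    proof
      fix k assume k: "k \<in> {k. k < n \<and> c m k \<noteq> c m' k}"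
      show "k \<in> inconsistent_frames n ?y (c m) \<union> inconsistent_frames n ?y (c m')"
      proof (rule ccontr)
        assume nk: "k \<notin> inconsistent_frames n ?y (c m) \<union> inconsistent_frames n ?y (c m')"
        have "c m k = c m' k"
        proof (rule dest_separation)
          fix j assume j: "j < T"
          have "cmod (?y (k * T + j) - noiseless (c m k) j) \<le> t" "cmod (?y (k * T + j) - noiseless (c m' k) j) \<le> t"
            using nk k j consistent_frame[of k n ?y] by blast+
          moreover have "cmod (noiseless (c m k) j - noiseless (c m' k) j)
              \<le> cmod (?y (k * T + j) - noiseless (c m k) j) + cmod (?y (k * T + j) - noiseless (c m' k) j)"
            by (rule norm_triangle_sub_points)
          ultimately have "cmod (noiseless (c m k) j - noiseless (c m' k) j) \<le> 2 * t" by linarith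
          thus "cmod ((complex_of_real (sqrt S) * xs (c m k) j
              + (if T1 \<le> j then cis \<theta> * complex_of_real (sqrt I) * g (c m k) j else 0))
            - (complex_of_real (sqrt S) * xs (c m' k) j
              + (if T1 \<le> j then cis \<theta> * complex_of_real (sqrt I) * g (c m' k) j else 0))) \<le> 2 * t"
            by (simp only: noiseless_def)
        qed (use c k m P' in auto)
        thus False using k by simp
      qed
    qed
    hence "card {k. k < n \<and> c m k \<noteq> c m' k}
        \<le> card (inconsistent_frames n ?y (c m) \<union> inconsistent_frames n ?y (c m'))"
      using fin by (intro card_mono) auto
    also have "\<dots> \<le> card (inconsistent_frames n ?y (c m)) + card (inconsistent_frames n ?y (c m'))"
      by (rule card_Un_le)
    also have "\<dots> \<le> 2 * e" using Pm P' by simp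
    finally have le: "card {k. k < n \<and> c m k \<noteq> c m' k} \<le> 2 * e" .
    have sym: "{k. k < n \<and> c m' k \<noteq> c m k} = {k. k < n \<and> c m k \<noteq> c m' k}" by auto
    from ne consider "m' < m" | "m < m'" by linarith
    thus False using dist[of m m'] dist[of m' m] le m P' sym by cases auto
  qed
  moreover have "?P (frame_decoder n e M c ?y)"
    unfolding frame_decoder_def by (rule LeastI[of ?P, OF Pm])
  ultimately show ?thesis by blast
qed


lemma frame_code_ok:
  "hd_code_ok C N M (\<lambda>m. source_word (c m)) frame_relay (frame_decoder n e M' c)"
  unfolding hd_code_ok_def
proof (intro conjI allI)
  interpret P: prob_space noise_space by (rule prob_space_noise_space)
  have "(\<Sum>m<M. \<Sum>i<N. (cmod (source_word (c m) i))\<^sup>2) \<le> (\<Sum>m<M. \<Sum>i<N. 1)"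
    using xs_le by (intro sum_mono) (auto simp: source_word_def power_le_one)
  thus "(\<Sum>m<M. \<Sum>i<N. (cmod (source_word (c m) i))\<^sup>2) \<le> real M * real N" by simp
  have le_1: "cmod (fst (relay_input C x frame_relay zr u i)) \<le> 1" for x zr u i
    using g_le by (simp add: relay_input_def frame_relay_def)
  have "(\<Sum>m<M. \<Sum>i<N. \<integral>\<^sup>+ \<omega>. ennreal ((cmod (fst (relay_input C (source_word (c m)) frame_relay
      (fst (fst \<omega>)) (snd \<omega>) i)))\<^sup>2) \<partial>noise_space) \<le> (\<Sum>m<M. \<Sum>i<N. \<integral>\<^sup>+ \<omega>. ennreal 1 \<partial>noise_space)"
    by (intro sum_mono nn_integral_mono ennreal_leI power_le_one le_1) auto
  also have "\<dots> = (\<Sum>m<M. \<Sum>i<N. 1)"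
    using P.emeasure_space_1 by simp
  also have "\<dots> = ennreal (real M * real N)"
    by (simp add: ennreal_of_nat_eq_real_of_nat ennreal_mult)
  finally show "(\<Sum>m<M. \<Sum>i<N. \<integral>\<^sup>+ \<omega>. ennreal ((cmod (fst (relay_input C (source_word (c m)) frame_relay
      (fst (fst \<omega>)) (snd \<omega>) i)))\<^sup>2) \<partial>noise_space) \<le> ennreal (real M * real N)" .
qed (rule measurable_frame_relay measurable_frame_decoder)+

text \<open>\<open>noise\<close> amounts to \<open>4 / t\<^sup>2 \<le> \<delta> / (4 * T)\<close>.
  With the Hoeffding deviation set to this right side, each noise sequence stays below
  \<open>\<delta> * n / 2\<close> exceedances up to an exponentially small probability.\<close>

lemma frame_error_le:
  assumes c: "\<And>m k. m < M \<Longrightarrow> k < n \<Longrightarrow> c m k < Q"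
    and dist: "\<And>m m'. m < M \<Longrightarrow> m' < m \<Longrightarrow> card {k. k < n \<and> c m k \<noteq> c m' k} > 2 * nat \<lfloor>\<delta> * real n\<rfloor>"
    and M: "M > 0" and n: "n > 0" and \<delta>: "\<delta> > 0" and noise: "16 * real T \<le> \<delta> * t\<^sup>2"
  shows "hd_err_prob C S I \<theta> (n * T) M (\<lambda>m. source_word (c m)) frame_relay (frame_decoder n (nat \<lfloor>\<delta> * real n\<rfloor>) M c)
    \<le> 2 * exp (- 2 * (\<delta> / (4 * real T))\<^sup>2 * real (n * T))"
proof -
  interpret P: prob_space noise_space by (rule prob_space_noise_space)
  let ?e = "nat \<lfloor>\<delta> * real n\<rfloor>" and ?\<eta> = "\<delta> / (4 * real T)"
  let ?bound = "exp (- 2 * ?\<eta>\<^sup>2 * real (n * T))"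
  let ?A = "{w. real (card (exceedances t w (n * T))) \<ge> (4 / t\<^sup>2 + ?\<eta>) * real (n * T)}"
  have T: "real T > 0" using frame_length by simp
  have "{w \<in> space cseq. real (card (exceedances t w (n * T))) \<ge> (4 / t\<^sup>2 + ?\<eta>) * real (n * T)} \<in> sets cseq"
    by measurable
  hence A: "?A \<in> sets cseq" by (simp add: space_PiM)
  have tail: "measure noise_seq ?A \<le> ?bound"
    using exceedances_tail[OF t_pos, of ?\<eta> "n * T"] \<delta> T n frame_length by simp
  have threshold: "(4 / t\<^sup>2 + ?\<eta>) * real (n * T) \<le> \<delta> * real n / 2"
  proof -
    have "4 / t\<^sup>2 \<le> ?\<eta>" using noise t_pos T by (simp add: field_simps)
    hence "(4 / t\<^sup>2 + ?\<eta>) * real (n * T) \<le> (?\<eta> + ?\<eta>) * real (n * T)"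
      by (intro mult_right_mono add_right_mono) auto
    also have "\<dots> = \<delta> * real n / 2" using T by (simp add: field_simps)
    finally show ?thesis .
  qed
  have add_le_of_halves: "x + y \<le> d" if "x < h" "y < h" "h \<le> d / 2" for x y h d :: real
    using that by linarith
  have each: "measure noise_space {\<omega> \<in> space noise_space. frame_decoder n ?e M c
      (dest_out C S I \<theta> (n * T) (source_word (c m)) frame_relay (fst (fst \<omega>)) (snd (fst \<omega>)) (snd \<omega>)) \<noteq> m}
    \<le> 2 * ?bound" (is "measure _ ?E \<le> _") if m: "m < M" for m
  proof -
    have "?E \<subseteq> {\<omega>. fst (fst \<omega>) \<in> ?A} \<union> {\<omega>. snd (fst \<omega>) \<in> ?A}"
    proof
      fix \<omega> assume E: "\<omega> \<in> ?E"
      show "\<omega> \<in> {\<omega>. fst (fst \<omega>) \<in> ?A} \<union> {\<omega>. snd (fst \<omega>) \<in> ?A}"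
      proof (rule ccontr)
        assume "\<omega> \<notin> {\<omega>. fst (fst \<omega>) \<in> ?A} \<union> {\<omega>. snd (fst \<omega>) \<in> ?A}"
        hence "real (card (exceedances t (fst (fst \<omega>)) (n * T))) < (4 / t\<^sup>2 + ?\<eta>) * real (n * T)"
          "real (card (exceedances t (snd (fst \<omega>)) (n * T))) < (4 / t\<^sup>2 + ?\<eta>) * real (n * T)"
          by (simp_all only: Un_iff mem_Collect_eq de_Morgan_disj not_le)
        hence "real (card (exceedances t (fst (fst \<omega>)) (n * T)) + card (exceedances t (snd (fst \<omega>)) (n * T)))
            \<le> \<delta> * real n"
          unfolding of_nat_add by (rule add_le_of_halves[OF _ _ threshold])
        hence "card (exceedances t (fst (fst \<omega>)) (n * T)) + card (exceedances t (snd (fst \<omega>)) (n * T)) \<le> ?e"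
          using le_nat_floor by blast
        from frame_decoder_correct[where c = c, OF c dist m this] E show False by simp
      qed
    qed
    moreover have sets: "{\<omega>. fst (fst \<omega>) \<in> ?A} \<in> P.events" "{\<omega>. snd (fst \<omega>) \<in> ?A} \<in> P.events"
    proof -
      note [measurable] = A
      have "{\<omega> \<in> space noise_space. fst (fst \<omega>) \<in> ?A} \<in> P.events" "{\<omega> \<in> space noise_space. snd (fst \<omega>) \<in> ?A} \<in> P.events"
        by measurable
      thus "{\<omega>. fst (fst \<omega>) \<in> ?A} \<in> P.events" "{\<omega>. snd (fst \<omega>) \<in> ?A} \<in> P.events" by simp_all
    qed
    ultimately have "P.prob ?E \<le> P.prob ({\<omega>. fst (fst \<omega>) \<in> ?A} \<union> {\<omega>. snd (fst \<omega>) \<in> ?A})"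
      by (intro P.finite_measure_mono sets.Un)
    also have "\<dots> \<le> P.prob {\<omega>. fst (fst \<omega>) \<in> ?A} + P.prob {\<omega>. snd (fst \<omega>) \<in> ?A}"
      by (rule measure_Un_le[OF sets])
    also have "\<dots> \<le> 2 * ?bound"
      using tail unfolding measure_noise_space_marginals[OF A] by linarith
    finally show ?thesis .
  qed
  have "hd_err_prob C S I \<theta> (n * T) M (\<lambda>m. source_word (c m)) frame_relay (frame_decoder n ?e M c)
      \<le> (\<Sum>m<M. 2 * ?bound) / real M"
    unfolding hd_err_prob_def by (intro divide_right_mono sum_mono each) auto
  thus ?thesis using M by simp
qed

text \<open>Budget per frame in bits: \<open>T * R\<close> for the message, 1 for the sets of
  disagreement and \<open>2 * \<delta> * log 2 Q\<close> for the values on them, against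
  \<open>log 2 Q\<close> available.\<close>

lemma code_size_bound:
  assumes R: "real T * R + 1 + 2 * \<delta> * log 2 (real Q) \<le> log 2 (real Q)" and \<delta>: "\<delta> > 0"
  shows "(nat \<lceil>2 powr (real (n * T) * R)\<rceil> - 1) * (2 ^ n * Q ^ (2 * nat \<lfloor>\<delta> * real n\<rfloor>)) < Q ^ n"
proof -
  let ?M = "nat \<lceil>2 powr (real (n * T) * R)\<rceil>" and ?e = "nat \<lfloor>\<delta> * real n\<rfloor>"
  have Q: "real Q \<ge> 1" using Q_pos by simp
  have pos: "2 powr (real (n * T) * R) > 0" by simp
  hence "\<lceil>2 powr (real (n * T) * R)\<rceil> > 0" by (subst zero_less_ceiling)
  hence "real (?M - 1) < 2 powr (real (n * T) * R)" by linarith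
  moreover have "real (Q ^ (2 * ?e)) \<le> 2 powr (2 * \<delta> * real n * log 2 (real Q))"
  proof -
    have "real (2 * ?e) \<le> 2 * \<delta> * real n"
      using of_nat_floor[of "\<delta> * real n"] \<delta> by simp
    hence "real Q powr real (2 * ?e) \<le> real Q powr (2 * \<delta> * real n)"
      using Q by (intro powr_mono) auto
    also have "\<dots> = 2 powr (2 * \<delta> * real n * log 2 (real Q))"
      using Q by (simp add: powr_def log_def)
    also have "real Q powr real (2 * ?e) = real (Q ^ (2 * ?e))"
      using Q by (subst powr_realpow) auto
    finally show ?thesis .
  qed
  ultimately have "real (?M - 1) * (2 ^ n * real (Q ^ (2 * ?e)))
      < 2 powr (real (n * T) * R) * (2 ^ n * 2 powr (2 * \<delta> * real n * log 2 (real Q)))"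
    using Q by (intro mult_less_le_imp_less mult_left_mono) auto
  also have "\<dots> = 2 powr (real (n * T) * R + (real n + 2 * \<delta> * real n * log 2 (real Q)))"
    by (simp only: powr_add powr_realpow[symmetric] zero_less_numeral)
  also have "\<dots> = 2 powr (real n * (real T * R + 1 + 2 * \<delta> * log 2 (real Q)))"
    by (simp add: algebra_simps)
  also have "\<dots> \<le> 2 powr (real n * log 2 (real Q))"
    using R by (intro powr_mono mult_left_mono) auto
  also have "\<dots> = real Q ^ n"
    using Q by (simp add: powr_def log_def exp_of_nat_mult)
  finally have "real ((?M - 1) * (2 ^ n * Q ^ (2 * ?e))) < real (Q ^ n)"
    by simp
  thus ?thesis by (simp only: of_nat_less_iff)
qed

lemma frame_code_achieves:
  assumes \<delta>: "\<delta> > 0" and noise: "16 * real T \<le> \<delta> * t\<^sup>2"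
    and R: "real T * R + 1 + 2 * \<delta> * log 2 (real Q) \<le> log 2 (real Q)"
  shows "hd_achievable C S I \<theta> R"
  unfolding hd_achievable_def Let_def
proof (intro allI impI)
  fix \<epsilon> :: real and N0 :: nat
  assume \<epsilon>: "\<epsilon> > 0"
  let ?a = "2 * (\<delta> / (4 * real T))\<^sup>2 * real T"
  have a: "?a > 0" using \<delta> frame_length by (intro mult_pos_pos zero_less_power) auto
  obtain n0 :: nat where n0: "ln (2 / \<epsilon>) / ?a \<le> real n0" using real_arch_simple by blast
  define n where "n = Suc (max N0 n0)"
  have "ln (2 / \<epsilon>) / ?a \<le> real n" using n0 by (simp add: n_def)
  hence "ln (2 / \<epsilon>) \<le> ?a * real n" using a by (simp add: divide_le_eq mult.commute)
  hence "exp (- (?a * real n)) \<le> exp (- ln (2 / \<epsilon>))" by simp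
  also have "\<dots> = \<epsilon> / 2" using \<epsilon> by (simp add: exp_minus)
  finally have small: "2 * exp (- 2 * (\<delta> / (4 * real T))\<^sup>2 * real (n * T)) \<le> \<epsilon>"
    by (simp add: ac_simps)
  let ?M = "nat \<lceil>2 powr (real (n * T) * R)\<rceil>" and ?e = "nat \<lfloor>\<delta> * real n\<rfloor>"
  from gilbert_varshamov[OF Q_pos code_size_bound[OF R \<delta>, of n]]
  obtain c where c: "\<forall>m<?M. c m \<in> {..<n} \<rightarrow>\<^sub>E {..<Q}"
    and dist: "\<forall>m<?M. \<forall>m'<m. card {i. i < n \<and> c m i \<noteq> c m' i} > 2 * ?e" by blast
  have "2 powr (real (n * T) * R) > 0" by simp
  hence M: "?M > 0" by (simp only: zero_less_nat_eq zero_less_ceiling)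
  have "hd_err_prob C S I \<theta> (n * T) ?M (\<lambda>m. source_word (c m)) frame_relay (frame_decoder n ?e ?M c) \<le> \<epsilon>"
  proof (rule order_trans[OF frame_error_le small])
    show "c m k < Q" if "m < ?M" "k < n" for m k
      using c that by (auto dest: PiE_mem)
  qed (use dist M \<delta> noise in \<open>auto simp: n_def\<close>)
  moreover have "n * T \<ge> n" using frame_length by simp
  hence "n * T \<ge> N0" "n * T > 0" unfolding n_def by linarith+
  ultimately show "\<exists>N\<ge>N0. 0 < N \<and> (\<exists>x rl dec. hd_code_ok C N (nat \<lceil>2 powr (real N * R)\<rceil>) x rl dec
      \<and> hd_err_prob C S I \<theta> N (nat \<lceil>2 powr (real N * R)\<rceil>) x rl dec \<le> \<epsilon>)"
    using frame_code_ok by blast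
qed

end

section \<open>Square grids and their separation\<close>

definition qam :: "nat \<Rightarrow> nat \<Rightarrow> complex" where
  "qam K s = Complex (real (s mod K) / (2 * real K)) (real (s div K mod K) / (2 * real K))"

text \<open>Both coordinates are reduced modulo \<open>K\<close> and lie in [0, 1/2], also for
  indices beyond the \<open>K\<^sup>2\<close> grid points; \<open>frame_code\<close> asks for such
  an unconditional bound.\<close>

lemma cmod_qam_le:
  assumes "K > 0"
  shows "cmod (qam K s) \<le> 1"
proof -
  have "real (s mod K) \<le> real K" "real (s div K mod K) \<le> real K"
    using assms by (simp_all add: less_imp_le)
  hence "real (s mod K) / (2 * real K) \<le> 1 / 2" "real (s div K mod K) / (2 * real K) \<le> 1 / 2"
    using assms by (simp_all add: field_simps)
  thus ?thesis
    using cmod_le[of "qam K s"] by (simp add: qam_def)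
qed

lemma le_abs_diff_of_mod_eq:
  fixes a b d :: nat
  assumes "a \<noteq> b" "a mod d = b mod d"
  shows "real d \<le> \<bar>real a - real b\<bar>"
proof -
  have *: "d \<le> y - x" if "x < y" "x mod d = y mod d" for x y :: nat
  proof -
    have "d dvd y - x" using that by (metis mod_eq_dvd_iff_nat less_imp_le)
    thus ?thesis using that by (simp add: dvd_imp_le)
  qed
  from assms consider "a < b" | "b < a" by linarith
  thus ?thesis using *[of a b] *[of b a] assms by cases linarith+
qed

text \<open>Some coordinate differs, and equal residues modulo \<open>D\<close> make it differ by at
  least \<open>D\<close> steps of width \<open>1 / (2 * K)\<close>. With \<open>D = 1\<close> the
  residue conditions hold trivially and this is the minimum distance of the grid.\<close>

lemma qam_separation:
  assumes K: "K > 0" and s: "s < K\<^sup>2" "s' < K\<^sup>2" "s \<noteq> s'"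
    and residue: "s mod K mod D = s' mod K mod D" "s div K mod D = s' div K mod D"
  shows "real D / (2 * real K) \<le> cmod (qam K s - qam K s')"
proof -
  have div: "s div K < K" "s' div K < K"
    using s by (simp_all add: less_mult_imp_div_less power2_eq_square)
  show ?thesis
  proof (cases "s mod K = s' mod K")
    case False
    have "real D / (2 * real K) \<le> \<bar>real (s mod K) - real (s' mod K)\<bar> / (2 * real K)"
      using le_abs_diff_of_mod_eq[OF False residue(1)] by (intro divide_right_mono) auto
    also have "\<dots> = \<bar>Re (qam K s - qam K s')\<bar>"
      by (simp add: qam_def flip: diff_divide_distrib)
    also have "\<dots> \<le> cmod (qam K s - qam K s')" by (rule abs_Re_le_cmod)
    finally show ?thesis .
  next
    case True
    hence ne: "s div K \<noteq> s' div K" using s(3) by (metis div_mult_mod_eq)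
    have "real D / (2 * real K) \<le> \<bar>real (s div K) - real (s' div K)\<bar> / (2 * real K)"
      using le_abs_diff_of_mod_eq[OF ne residue(2)] by (intro divide_right_mono) auto
    also have "\<dots> = \<bar>Im (qam K s - qam K s')\<bar>"
      using div by (simp add: qam_def flip: diff_divide_distrib)
    also have "\<dots> \<le> cmod (qam K s - qam K s')" by (rule abs_Im_le_cmod)
    finally show ?thesis .
  qed
qed

lemma qam_eqI:
  assumes K: "K > 0" and s: "s < K\<^sup>2" "s' < K\<^sup>2"
    and near: "cmod (complex_of_real (sqrt c) * qam K s - complex_of_real (sqrt c) * qam K s') \<le> r"
    and far: "r < sqrt c * real D / (2 * real K)"
    and residue: "s mod K mod D = s' mod K mod D" "s div K mod D = s' div K mod D"
    and c: "c \<ge> 0"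
  shows "s = s'"
proof (rule ccontr)
  assume "s \<noteq> s'"
  from qam_separation[OF K s this residue]
  have "sqrt c * (real D / (2 * real K)) \<le> sqrt c * cmod (qam K s - qam K s')"
    using c by (intro mult_left_mono) auto
  also have "\<dots> = cmod (complex_of_real (sqrt c) * qam K s - complex_of_real (sqrt c) * qam K s')"
    using c by (simp add: norm_mult flip: right_diff_distrib)
  finally show False using near far by simp
qed

text \<open>In the first \<open>T1\<close> slots the source sends points of a grid that only the relay can resolve. The
  destination sees them coarsely, and the relay supplies their coordinates modulo \<open>D\<close> in the remaining
  slots, in symbols strong enough to be decoded on top of the source signal.\<close>

lemma frame_code_exists:
  assumes gains: "C \<ge> 0" "S \<ge> 0" "I \<ge> 0" and t: "t > 0"
    and pos: "K > 0" "L > 0" "E > 0" "T1 + T2 > 0"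
    and relay: "T1 > 0 \<Longrightarrow> 2 * t < sqrt C / (2 * real K)"
    and coarse: "T1 > 0 \<Longrightarrow> 2 * t < sqrt S * real D / (2 * real K)"
    and strong: "E = 1 \<or> 2 * t + 2 * sqrt S < sqrt I / (2 * real E)"
    and source: "L = 1 \<or> 2 * t < sqrt S / (2 * real L)"
    and count: "D ^ (2 * T1) \<le> E ^ (2 * T2)"
  shows "\<exists>xs g. frame_code C S I \<theta> t (T1 + T2) T1 (K ^ (2 * T1) * L ^ (2 * T2)) xs g"
proof -
  define V1 V2 where "V1 = PiE {..<T1} (\<lambda>_. {..<K\<^sup>2})" and "V2 = PiE {..<T2} (\<lambda>_. {..<L\<^sup>2})"
  define B where "B = PiE {..<T1} (\<lambda>_. {..<D} \<times> {..<D})"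
  define X where "X = PiE {..<T2} (\<lambda>_. {..<E\<^sup>2})"
  define bin where "bin p = (\<lambda>j\<in>{..<T1}. (p j mod K mod D, p j div K mod D))" for p :: "nat \<Rightarrow> nat"
  define Q where "Q = K ^ (2 * T1) * L ^ (2 * T2)"
  have fin: "finite V1" "finite V2" "finite B" "finite X"
    unfolding V1_def V2_def B_def X_def by (intro finite_PiE; simp)+
  have "card (V1 \<times> V2) = Q"
    unfolding V1_def V2_def Q_def card_cartesian_product by (simp add: card_PiE power_mult)
  \<comment> \<open>A frame word is a pair of grid sequences, one for each phase; \<open>b\<close>
    numbers these pairs.\<close>
  then obtain b where b: "bij_betw b {0..<Q} (V1 \<times> V2)"
    using ex_bij_betw_nat_finite[of "V1 \<times> V2"] fin by auto
  have bw: "fst (b w) \<in> V1" "snd (b w) \<in> V2" if "w < Q" for w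
    using bij_betwE[OF b] that by (auto simp: mem_Times_iff)
  have sym1: "fst (b w) i < K\<^sup>2" if "w < Q" "i < T1" for w i
    using bw(1)[OF that(1)] that(2) by (auto simp: V1_def dest: PiE_mem)
  have sym2: "snd (b w) i < L\<^sup>2" if "w < Q" "i < T2" for w i
    using bw(2)[OF that(1)] that(2) by (auto simp: V2_def dest: PiE_mem)
  have "card B \<le> card X"
    using count unfolding B_def X_def by (simp add: card_PiE power_mult card_cartesian_product power2_eq_square)
  \<comment> \<open>By \<open>count\<close> there are at least as many relay words as residue
    patterns, so the patterns can be labelled injectively.\<close>
  then obtain \<phi> where \<phi>: "inj_on \<phi> B" "\<phi> ` B \<subseteq> X"
    using card_le_inj[OF fin(3,4)] by blast
  have D: "D > 0" if "T1 > 0" using coarse[OF that] t by (cases "D = 0") auto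
  have bin_B: "bin p \<in> B" for p
    using D unfolding B_def bin_def restrict_PiE_iff by fastforce
  have \<phi>_X: "\<phi> (bin p) \<in> X" for p using \<phi>(2) bin_B by blast
  have sym3: "\<phi> (bin p) i < E\<^sup>2" if "i < T2" for p i
    using \<phi>_X[of p] that by (auto simp: X_def dest: PiE_mem)
  define xs where "xs w j = (if j < T1 then qam K (fst (b w) j) else qam L (snd (b w) (j - T1)))" for w j
  define g where "g w j = qam E (\<phi> (bin (fst (b w))) (j - T1))" for w j
  have "frame_code C S I \<theta> t (T1 + T2) T1 Q xs g"
  proof
    show "0 < Q" using pos by (simp add: Q_def)
    show xs_le: "cmod (xs w j) \<le> 1" and "cmod (g w j) \<le> 1" for w j
      using pos by (simp_all add: xs_def g_def cmod_qam_le)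
    show "g w j = g w' j"
      if w: "w < Q" "w' < Q"
        and near: "\<And>i. i < T1 \<Longrightarrow>
          cmod (complex_of_real (sqrt C) * xs w i - complex_of_real (sqrt C) * xs w' i) \<le> 2 * t"
      for w w' j
    proof -
      have "fst (b w) i = fst (b w') i" if i: "i < T1" for i
        using near[OF i] i relay gains
        by (intro qam_eqI[OF pos(1) sym1[OF w(1) i] sym1[OF w(2) i], where D = 1 and c = C and r = "2 * t"])
           (auto simp: xs_def)
      hence "fst (b w) = fst (b w')"
        using bw(1)[OF w(1)] bw(1)[OF w(2)] unfolding V1_def by (intro PiE_ext) auto
      thus ?thesis by (simp add: g_def)
    qed
    show "w = w'"
      if w: "w < Q" "w' < Q"
        and near: "\<And>j. j < T1 + T2 \<Longrightarrow> cmod ((complex_of_real (sqrt S) * xs w j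
          + (if T1 \<le> j then cis \<theta> * complex_of_real (sqrt I) * g w j else 0))
        - (complex_of_real (sqrt S) * xs w' j
          + (if T1 \<le> j then cis \<theta> * complex_of_real (sqrt I) * g w' j else 0))) \<le> 2 * t"
      for w w'
    proof -
      \<comment> \<open>The relay symbols are separated first, with the source as interference: two
        source symbols of modulus at most 1 differ by at most \<open>2 * sqrt S\<close> after
        scaling, the extra term in \<open>strong\<close>.\<close>
      have bins: "bin (fst (b w)) = bin (fst (b w'))"
      proof -
        have "\<phi> (bin (fst (b w))) j = \<phi> (bin (fst (b w'))) j" if j: "j < T2" for j
        proof (cases "E = 1")
          case True
          thus ?thesis using sym3[OF j] by (metis less_one one_power2)
        next
          case False
          let ?x = "complex_of_real (sqrt S) * xs w (T1 + j) - complex_of_real (sqrt S) * xs w' (T1 + j)"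
          let ?y = "complex_of_real (sqrt I) * g w (T1 + j) - complex_of_real (sqrt I) * g w' (T1 + j)"
          have "cmod ?x = sqrt S * cmod (xs w (T1 + j) - xs w' (T1 + j))"
            using gains by (simp add: norm_mult flip: right_diff_distrib)
          also have "\<dots> \<le> sqrt S * (1 + 1)"
            using gains by (intro mult_left_mono order_trans[OF norm_triangle_ineq4] add_mono xs_le) auto
          finally have x: "cmod ?x \<le> 2 * sqrt S" by simp
          have "cmod (cis \<theta> * ?y) = cmod ((?x + cis \<theta> * ?y) - ?x)" by simp
          also have "\<dots> \<le> cmod (?x + cis \<theta> * ?y) + cmod ?x" by (rule norm_triangle_ineq4)
          also have "?x + cis \<theta> * ?y = (complex_of_real (sqrt S) * xs w (T1 + j)
              + cis \<theta> * complex_of_real (sqrt I) * g w (T1 + j))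
            - (complex_of_real (sqrt S) * xs w' (T1 + j)
              + cis \<theta> * complex_of_real (sqrt I) * g w' (T1 + j))"
            by (simp add: algebra_simps)
          also have "cmod \<dots> \<le> 2 * t" using near[of "T1 + j"] j by simp
          finally have y: "cmod ?y \<le> 2 * t + 2 * sqrt S" using x by (simp add: norm_mult)
          show ?thesis
            using y strong False gains
            by (intro qam_eqI[OF pos(3) sym3[OF j] sym3[OF j], where D = 1 and c = I and r = "2 * t + 2 * sqrt S"])
               (auto simp: g_def)
        qed
        hence "\<phi> (bin (fst (b w))) = \<phi> (bin (fst (b w')))"
          by (intro PiE_ext[OF \<phi>_X[unfolded X_def] \<phi>_X[unfolded X_def]]) simp
        thus ?thesis using \<phi>(1) bin_B by (auto dest: inj_onD)
      qed
      hence g: "g w = g w'" by (simp add: g_def[abs_def])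
      \<comment> \<open>Equal relay symbols cancel exactly, and the frame looks like a transmission
        from the source alone.\<close>
      have near': "cmod (complex_of_real (sqrt S) * xs w j - complex_of_real (sqrt S) * xs w' j) \<le> 2 * t"
        if "j < T1 + T2" for j
        using near[OF that] unfolding g add_diff_cancel_right .
      have "snd (b w) j = snd (b w') j" if j: "j < T2" for j
      proof (cases "L = 1")
        case True
        thus ?thesis using sym2[OF _ j] w by (metis less_one one_power2)
      next
        case False
        show ?thesis
          using near'[of "T1 + j"] j source False gains
          by (intro qam_eqI[OF pos(2) sym2[OF w(1) j] sym2[OF w(2) j], where D = 1 and c = S and r = "2 * t"])
             (auto simp: xs_def)
      qed
      hence "snd (b w) = snd (b w')"
        using bw(2)[OF w(1)] bw(2)[OF w(2)] unfolding V2_def by (intro PiE_ext) auto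
      \<comment> \<open>Candidates with the residues learned from the relay are \<open>D\<close>
        grid steps apart, which by \<open>coarse\<close> even the destination resolves.\<close>
      moreover have "fst (b w) i = fst (b w') i" if i: "i < T1" for i
      proof -
        have "bin (fst (b w)) i = bin (fst (b w')) i" using bins by simp
        thus ?thesis
          using near'[of i] i coarse gains
          by (intro qam_eqI[OF pos(1) sym1[OF w(1) i] sym1[OF w(2) i], where D = D and c = S and r = "2 * t"])
             (auto simp: xs_def bin_def)
      qed
      hence "fst (b w) = fst (b w')"
        using bw(1)[OF w(1)] bw(1)[OF w(2)] unfolding V1_def by (intro PiE_ext) auto
      ultimately have "b w = b w'" by (simp add: prod_eq_iff)
      thus ?thesis using b w by (auto simp: bij_betw_def dest: inj_onD)
    qed
  qed (use gains t pos in auto)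
  thus ?thesis unfolding Q_def by blast
qed

section \<open>Generalized degrees of freedom\<close>

text \<open>Rounding down, but never below 1, loses at most a factor 2. The value 1 may exceed
  \<open>y\<close>; it stands for a one-point grid, where there is nothing to separate.\<close>

lemma max_1_floor_bounds:
  fixes y :: real
  assumes "y > 0"
  defines "n \<equiv> max 1 (nat \<lfloor>y\<rfloor>)"
  shows "n > 0" "n = 1 \<or> real n \<le> y" "y \<ge> 1 \<Longrightarrow> real n \<le> y" "y / 2 \<le> real n"
proof -
  show "n > 0" by (simp add: n_def)
  have fl: "real (nat \<lfloor>y\<rfloor>) \<le> y" using assms by (intro of_nat_floor) simp
  thus "n = 1 \<or> real n \<le> y" by (auto simp: n_def max_def)
  show "real n \<le> y" if "y \<ge> 1" using that fl by (simp add: n_def max_def)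
  show "y / 2 \<le> real n"
  proof (cases "y \<ge> 1")
    case True
    hence "nat \<lfloor>y\<rfloor> \<ge> 1" by (simp add: le_nat_floor)
    hence "real (nat \<lfloor>y\<rfloor>) > y - 1" "real (nat \<lfloor>y\<rfloor>) \<ge> 1" by linarith+
    hence "real (nat \<lfloor>y\<rfloor>) \<ge> y / 2" by linarith
    thus ?thesis unfolding n_def by linarith
  next
    case False
    thus ?thesis by (simp add: n_def)
  qed
qed

text \<open>Up to constants a listening slot carries a grid matched to the relay and a forwarding
  slot one matched to the destination. Spacing and rounding cost at most
  \<open>log 2 (16 * t)\<close> bits per real dimension; the factor \<open>1 - 2 * \<delta>\<close>
  and the 1 are the price of the outer code.\<close>

lemma achievable_power_gains:
  fixes \<beta>sd \<beta>rd \<beta>sr \<theta> snr t \<delta> :: real and T1 T2 :: nat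
  defines "T \<equiv> real (T1 + T2)"
  assumes snr: "snr \<ge> 1" and \<beta>sd: "\<beta>sd \<ge> 0" and T_pos: "T1 + T2 > 0"
    and t: "t > 0" and \<delta>: "\<delta> > 0" "\<delta> < 1 / 2" and noise: "16 * T \<le> \<delta> * t\<^sup>2"
    and listen: "T1 > 0 \<Longrightarrow> 8 * t \<le> snr powr (\<beta>sr / 2)"
    and better: "T1 > 0 \<Longrightarrow> \<beta>sd \<le> \<beta>sr"
    and count: "T1 > 0 \<Longrightarrow> (2 * snr powr ((\<beta>sr - \<beta>sd) / 2)) ^ T1
      \<le> (snr powr ((\<beta>rd - \<beta>sd) / 2) / (16 * (t + 1))) ^ T2"
  shows "hd_achievable (snr powr \<beta>sr) (snr powr \<beta>sd) (snr powr \<beta>rd) \<theta>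
    (((1 - 2 * \<delta>) * ((T1 * \<beta>sr + T2 * \<beta>sd) * log 2 snr - 2 * T * log 2 (16 * t)) - 1) / T)"
proof -
  define c s i where "c = snr powr (\<beta>sr / 2)" and "s = snr powr (\<beta>sd / 2)" and "i = snr powr (\<beta>rd / 2)"
  have sqrt: "sqrt (snr powr \<beta>sr) = c" "sqrt (snr powr \<beta>sd) = s" "sqrt (snr powr \<beta>rd) = i"
    using snr by (simp_all add: c_def s_def i_def powr_half_sqrt_powr)
  have csi: "c > 0" "s \<ge> 1" "i > 0"
    using snr \<beta>sd by (simp_all add: c_def s_def i_def ge_one_powr_ge_zero)
  \<comment> \<open>Unless rounded up to 1, \<open>K\<close> and \<open>L\<close> give a received
    spacing of at least \<open>4 * t\<close>, twice the required radius; \<open>E\<close> also has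
    to overcome the source amplitude \<open>s\<close>. \<open>D\<close> is the least integer above
    \<open>4 * t * K / s\<close>, where residue classes become separated at the destination. Without
    listening slots there is nothing to forward and \<open>E\<close> is 1.\<close>
  define K where "K = max 1 (nat \<lfloor>c / (8 * t)\<rfloor>)"
  define L where "L = max 1 (nat \<lfloor>s / (8 * t)\<rfloor>)"
  define D where "D = nat \<lfloor>4 * t * real K / s\<rfloor> + 1"
  define E where "E = (if T1 = 0 then 1 else max 1 (nat \<lfloor>i / (8 * (t + s))\<rfloor>))"
  have K: "K > 0" "c / (16 * t) \<le> real K"
    using max_1_floor_bounds[of "c / (8 * t)"] csi t by (simp_all add: K_def)
  have L: "L > 0" "s / (16 * t) \<le> real L" "L = 1 \<or> real L \<le> s / (8 * t)"
    using max_1_floor_bounds[of "s / (8 * t)"] csi t by (simp_all add: L_def)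
  have E: "E > 0" "E = 1 \<or> real E \<le> i / (8 * (t + s))"
    using max_1_floor_bounds[of "i / (8 * (t + s))"] csi t by (auto simp: E_def)
  have D: "4 * t * real K / s < real D" "real D \<le> 4 * t * real K / s + 1"
  proof -
    have "4 * t * real K / s \<ge> 0" using csi t by simp
    thus "4 * t * real K / s < real D" "real D \<le> 4 * t * real K / s + 1"
      unfolding D_def by linarith+
  qed
  have K_le: "real K \<le> c / (8 * t)" if "T1 > 0"
    using max_1_floor_bounds(3)[of "c / (8 * t)"] listen[OF that] csi t by (simp add: K_def c_def)
  have "\<exists>xs g. frame_code (snr powr \<beta>sr) (snr powr \<beta>sd) (snr powr \<beta>rd) \<theta> t (T1 + T2) T1
      (K ^ (2 * T1) * L ^ (2 * T2)) xs g"
  proof (rule frame_code_exists[where D = D and E = E]; (unfold sqrt)?)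
    show "2 * t < c / (2 * real K)" if "T1 > 0"
    proof -
      have "8 * t * real K \<le> c" using K_le[OF that] t by (simp add: field_simps)
      moreover have "t * real K > 0" using t K by simp
      ultimately have "4 * t * real K < c" by linarith
      thus ?thesis using K by (simp add: field_simps)
    qed
    show "2 * t < s * real D / (2 * real K)"
      using D(1) csi t K by (simp add: field_simps)
    show "E = 1 \<or> 2 * t + 2 * s < i / (2 * real E)"
    proof (cases "E = 1")
      case False
      hence "real E \<le> i / (8 * (t + s))" using E by blast
      hence "8 * (t + s) * real E \<le> i" using csi t by (simp add: field_simps)
      moreover have "(t + s) * real E > 0" using csi t E by simp
      ultimately have "4 * ((t + s) * real E) < i" by linarith
      thus ?thesis using E by (simp add: field_simps)
    qed simp
    show "L = 1 \<or> 2 * t < s / (2 * real L)"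
    proof (cases "L = 1")
      case False
      hence "8 * t * real L \<le> s" using L t by (simp add: field_simps)
      moreover have "t * real L > 0" using t L by simp
      ultimately have "4 * t * real L < s" by linarith
      thus ?thesis using L by (simp add: field_simps)
    qed simp
    show "D ^ (2 * T1) \<le> E ^ (2 * T2)"
    proof (cases "T1 = 0")
      case False
      hence T1: "T1 > 0" by simp
      have ratio: "snr powr ((\<beta>sr - \<beta>sd) / 2) = c / s" "snr powr ((\<beta>rd - \<beta>sd) / 2) = i / s"
        using snr by (simp_all add: c_def s_def i_def powr_diff[symmetric] diff_divide_distrib)
      \<comment> \<open>\<open>D\<close> is at most half of \<open>c / s\<close> plus 1, and the
        relay link being at least as good as the direct one gives
        \<open>c / s \<ge> 1\<close>.\<close>
      have "real D \<le> 2 * (c / s)"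
      proof -
        have "4 * t * real K / s \<le> 4 * t * (c / (8 * t)) / s"
          using K_le[OF T1] csi t by (intro divide_right_mono mult_left_mono) auto
        also have "\<dots> = (c / s) / 2" using t by simp
        finally have "real D \<le> (c / s) / 2 + 1" using D(2) by linarith
        moreover have "c / s \<ge> 1"
          using better[OF T1] snr csi by (simp add: c_def s_def powr_mono)
        moreover have "y \<le> 2 * x" if "y \<le> x / 2 + 1" "x \<ge> 1" for x y :: real
          using that by linarith
        ultimately show ?thesis by blast
      qed
      hence "real D ^ T1 \<le> (2 * (c / s)) ^ T1" by (intro power_mono) auto
      also have "\<dots> \<le> (i / s / (16 * (t + 1))) ^ T2" using count[OF T1] unfolding ratio .
      also have "\<dots> \<le> real E ^ T2"
      proof (intro power_mono)
        \<comment> \<open>Uses \<open>s \<ge> 1\<close>; it brings out the ratio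
          \<open>i / s\<close>, and with it the exponent difference in \<open>count\<close>.\<close>
        have "16 * (t + s) \<le> 16 * (t + 1) * s"
          using csi t mult_left_mono[of 1 s t] by (simp add: algebra_simps)
        hence "i / (16 * (t + 1) * s) \<le> i / (16 * (t + s))"
          using csi t by (intro divide_left_mono) auto
        also have "\<dots> \<le> real E"
          using max_1_floor_bounds(4)[of "i / (8 * (t + s))"] csi t T1 by (simp add: E_def)
        finally show "i / s / (16 * (t + 1)) \<le> real E" by (simp add: ac_simps)
        show "0 \<le> i / s / (16 * (t + 1))" using csi t by simp
      qed
      finally have "D ^ T1 \<le> E ^ T2" by (simp flip: of_nat_power)
      hence "(D ^ T1) ^ 2 \<le> (E ^ T2) ^ 2" by (intro power_mono) auto
      thus ?thesis by (simp add: power_mult[symmetric] mult.commute)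
    qed (simp add: E_def)
  qed (use t K L E T_pos in auto)
  then obtain xs g where "frame_code (snr powr \<beta>sr) (snr powr \<beta>sd) (snr powr \<beta>rd) \<theta> t (T1 + T2) T1
      (K ^ (2 * T1) * L ^ (2 * T2)) xs g" by blast
  then interpret frame_code "snr powr \<beta>sr" "snr powr \<beta>sd" "snr powr \<beta>rd" \<theta> t "T1 + T2" T1
    "K ^ (2 * T1) * L ^ (2 * T2)" xs g .
  let ?Q = "K ^ (2 * T1) * L ^ (2 * T2)"
  have log_div: "log 2 (snr powr (\<beta> / 2) / (16 * t)) = \<beta> / 2 * log 2 snr - log 2 (16 * t)" for \<beta>
    using snr t by (simp add: log_divide log_powr)
  have "log 2 (c / (16 * t)) \<le> log 2 (real K)" "log 2 (s / (16 * t)) \<le> log 2 (real L)"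
    using K L csi t by (subst log_le_cancel_iff; simp)+
  hence "2 * real T1 * (\<beta>sr / 2 * log 2 snr - log 2 (16 * t)) + 2 * real T2 * (\<beta>sd / 2 * log 2 snr - log 2 (16 * t))
      \<le> 2 * real T1 * log 2 (real K) + 2 * real T2 * log 2 (real L)"
    unfolding c_def s_def log_div by (intro add_mono mult_left_mono) auto
  also have "\<dots> = log 2 (real ?Q)"
    using K L by (simp add: log_mult log_nat_power)
  finally have rate: "(T1 * \<beta>sr + T2 * \<beta>sd) * log 2 snr - 2 * T * log 2 (16 * t) \<le> log 2 (real ?Q)"
    by (simp add: T_def algebra_simps)
  show ?thesis
  proof (rule frame_code_achieves[OF \<delta>(1) noise[unfolded T_def]])
    let ?l = "(T1 * \<beta>sr + T2 * \<beta>sd) * log 2 snr - 2 * T * log 2 (16 * t)"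
    have "real (T1 + T2) * (((1 - 2 * \<delta>) * ?l - 1) / T) = (1 - 2 * \<delta>) * ?l - 1"
      using T_pos by (simp add: T_def del: of_nat_add)
    moreover have "(1 - 2 * \<delta>) * ?l \<le> (1 - 2 * \<delta>) * log 2 (real ?Q)"
      using rate \<delta> by (intro mult_left_mono) auto
    moreover have "(1 - 2 * \<delta>) * log 2 (real ?Q) = log 2 (real ?Q) - 2 * \<delta> * log 2 (real ?Q)"
      by (simp add: algebra_simps)
    ultimately show "real (T1 + T2) * (((1 - 2 * \<delta>) * ?l - 1) / T) + 1 + 2 * \<delta> * log 2 (real ?Q)
        \<le> log 2 (real ?Q)" by linarith
  qed
qed

section \<open>Growth of the capacity\<close>

lemma achievable_le_capacity:
  assumes "C \<ge> 0" "S \<ge> 0" "I \<ge> 0" "hd_achievable C S I \<theta> R"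
  shows "R \<le> hd_capacity C S I \<theta>"
  unfolding hd_capacity_def
proof (rule cSup_upper)
  show "bdd_above {R. hd_achievable C S I \<theta> R}"
  proof (rule bdd_aboveI)
    fix R assume "R \<in> {R. hd_achievable C S I \<theta> R}"
    \<comment> \<open>The converse with weight 1; any bound free of \<open>R\<close> makes the
      supremum of achievable rates an upper bound.\<close>
    hence "R * ln 2 \<le> 37 + max (1 * ln (1 + C + S) + (1 - 1) * ln (1 + S)) (1 * ln (1 + S) + (1 - 1) * ln (1 + S + I))"
      using assms by (intro achievable_rate_le) auto
    thus "R \<le> (37 + max (1 * ln (1 + C + S) + (1 - 1) * ln (1 + S)) (1 * ln (1 + S) + (1 - 1) * ln (1 + S + I))) / ln 2"
      by (simp add: le_divide_eq)
  qed
qed (use assms in simp)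

text \<open>\<open>relay\<close> asks strictly that the residues fit into the relay symbols to first
  order. The surplus is a positive power of \<open>snr\<close>, which eventually beats the constant
  factors, because \<open>\<delta>\<close> and \<open>t\<close> are chosen from the frame length and
  the gap alone.\<close>

lemma capacity_ratio_gt:
  fixes \<beta>sd \<beta>rd \<beta>sr \<theta> \<rho> :: real and T1 T2 :: nat
  assumes \<beta>: "\<beta>sd \<ge> 0" "\<beta>sr \<ge> 0" and T: "T1 + T2 > 0"
    and relay: "T1 > 0 \<Longrightarrow> \<beta>sr > \<beta>sd \<and> T1 * (\<beta>sr - \<beta>sd) < T2 * (\<beta>rd - \<beta>sd)"
    and \<rho>: "\<rho> < (T1 * \<beta>sr + T2 * \<beta>sd) / (T1 + T2)"
  shows "\<forall>\<^sub>F snr in at_top.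
    \<rho> < hd_capacity (snr powr \<beta>sr) (snr powr \<beta>sd) (snr powr \<beta>rd) \<theta> / log 2 (1 + snr)"
proof -
  define r where "r = (T1 * \<beta>sr + T2 * \<beta>sd) / real (T1 + T2)"
  have r: "r \<ge> 0" using \<beta> by (simp add: r_def)
  have \<rho>r: "\<rho> < r" using \<rho> by (simp add: r_def)
  \<comment> \<open>Makes the loss \<open>2 * \<delta> * r\<close> at most half of
    \<open>r - \<rho>\<close>; the \<open>+ 1\<close> guards against \<open>r = 0\<close>.\<close>
  define \<delta> where "\<delta> = min (1 / 4) ((r - \<rho>) / (4 * (r + 1)))"
  have \<delta>: "\<delta> > 0" "\<delta> < 1 / 2" using \<rho>r r by (auto simp: \<delta>_def min_def)
  have gap: "\<rho> < (1 - 2 * \<delta>) * r"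
  proof -
    have "\<delta> * r \<le> (r - \<rho>) / (4 * (r + 1)) * r"
      using r by (intro mult_right_mono) (auto simp: \<delta>_def)
    also have "\<dots> \<le> (r - \<rho>) / (4 * (r + 1)) * (r + 1)"
      using r \<rho>r by (intro mult_left_mono) auto
    also have "\<dots> = (r - \<rho>) / 4"
    proof -
      have "r + 1 \<noteq> 0" using r by simp
      from mult_divide_mult_cancel_right[OF this] show ?thesis by (simp only: times_divide_eq_left)
    qed
    finally show ?thesis using \<rho>r by (simp add: algebra_simps)
  qed
  \<comment> \<open>Chosen for equality in the noise condition.\<close>
  define t where "t = 4 * sqrt (real (T1 + T2) / \<delta>)"
  have "real (T1 + T2) > 0" using T by (simp only: of_nat_0_less_iff)
  hence t: "t > 0" using \<delta> by (simp add: t_def del: of_nat_add)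
  have noise: "16 * real (T1 + T2) \<le> \<delta> * t\<^sup>2"
    using T \<delta> by (simp add: t_def power_mult_distrib)
  define k where "k = 2 * (1 - 2 * \<delta>) * log 2 (16 * t) + 1 / real (T1 + T2)"
  have "((\<lambda>snr. ((1 - 2 * \<delta>) * r * log 2 snr - k) / log 2 (1 + snr)) \<longlongrightarrow> (1 - 2 * \<delta>) * r) at_top"
  proof -
    have "((\<lambda>snr::real. log 2 snr / log 2 (1 + snr)) \<longlongrightarrow> 1) at_top"
      and "((\<lambda>snr::real. 1 / log 2 (1 + snr)) \<longlongrightarrow> 0) at_top"
      by real_asymp+
    hence "((\<lambda>snr. (1 - 2 * \<delta>) * r * (log 2 snr / log 2 (1 + snr)) - k * (1 / log 2 (1 + snr)))
        \<longlongrightarrow> (1 - 2 * \<delta>) * r * 1 - k * 0) at_top"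
      by (intro tendsto_intros)
    thus ?thesis by (simp add: diff_divide_distrib)
  qed
  hence large: "\<forall>\<^sub>F snr in at_top. \<rho> < ((1 - 2 * \<delta>) * r * log 2 snr - k) / log 2 (1 + snr)"
    using gap by (rule order_tendstoD)
  have listen: "\<forall>\<^sub>F snr in at_top. T1 > 0 \<longrightarrow> 8 * t \<le> snr powr (\<beta>sr / 2)"
  proof (cases "T1 > 0")
    case True
    hence "\<beta>sr / 2 > 0" using relay \<beta> by fastforce
    hence "filterlim (\<lambda>snr::real. snr powr (\<beta>sr / 2)) at_top at_top" by real_asymp
    thus ?thesis by (auto simp: filterlim_at_top elim: eventually_mono)
  qed simp
  have count: "\<forall>\<^sub>F snr in at_top. T1 > 0 \<longrightarrow> (2 * snr powr ((\<beta>sr - \<beta>sd) / 2)) ^ T1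
      \<le> (snr powr ((\<beta>rd - \<beta>sd) / 2) / (16 * (t + 1))) ^ T2"
  proof (cases "T1 > 0")
    case True
    \<comment> \<open>The exponent of the surplus: up to constants, the ratio of the two sides of
      the claim is \<open>snr powr p\<close>.\<close>
    define p where "p = (T2 * (\<beta>rd - \<beta>sd) - T1 * (\<beta>sr - \<beta>sd)) / 2"
    have "p > 0" using relay[OF True] by (simp add: p_def)
    hence "filterlim (\<lambda>snr::real. snr powr p) at_top at_top" by real_asymp
    hence "\<forall>\<^sub>F snr in at_top. 2 ^ T1 * (16 * (t + 1)) ^ T2 \<le> snr powr p"
      by (simp add: filterlim_at_top)
    thus ?thesis
      using eventually_gt_at_top[of 0]
    proof eventually_elim
      case (elim snr)
      have pw: "(snr powr a) ^ n = snr powr (n * a)" for a :: real and n :: nat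
        using elim by (simp add: powr_power mult.commute)
      have "(2 * snr powr ((\<beta>sr - \<beta>sd) / 2)) ^ T1 * (16 * (t + 1)) ^ T2
          = (2 ^ T1 * (16 * (t + 1)) ^ T2) * snr powr (T1 * ((\<beta>sr - \<beta>sd) / 2))"
        unfolding power_mult_distrib pw by (simp only: ac_simps)
      also have "\<dots> \<le> snr powr p * snr powr (T1 * ((\<beta>sr - \<beta>sd) / 2))"
        using elim by (intro mult_right_mono) auto
      also have "\<dots> = snr powr (T2 * ((\<beta>rd - \<beta>sd) / 2))"
        unfolding powr_add[symmetric] by (rule arg_cong[where f = "(powr) snr"]) (simp add: p_def field_simps)
      finally show ?case
        using t unfolding power_divide pw by (simp add: le_divide_eq)
    qed
  qed simp
  show ?thesis
    using large listen count eventually_ge_at_top[of 1]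
  proof eventually_elim
    case (elim snr)
    let ?C = "snr powr \<beta>sr" and ?S = "snr powr \<beta>sd" and ?I = "snr powr \<beta>rd"
    have "hd_achievable ?C ?S ?I \<theta>
      (((1 - 2 * \<delta>) * ((T1 * \<beta>sr + T2 * \<beta>sd) * log 2 snr - 2 * real (T1 + T2) * log 2 (16 * t)) - 1) / real (T1 + T2))"
      by (rule achievable_power_gains) (use elim \<beta> T t \<delta> noise relay in \<open>auto intro: less_imp_le\<close>)
    also have "((1 - 2 * \<delta>) * ((T1 * \<beta>sr + T2 * \<beta>sd) * log 2 snr - 2 * real (T1 + T2) * log 2 (16 * t)) - 1) / real (T1 + T2)
        = (1 - 2 * \<delta>) * r * log 2 snr - k"
      using T unfolding r_def k_def by (simp add: field_simps del: of_nat_add)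
    finally have "(1 - 2 * \<delta>) * r * log 2 snr - k \<le> hd_capacity ?C ?S ?I \<theta>"
      by (intro achievable_le_capacity) auto
    hence "((1 - 2 * \<delta>) * r * log 2 snr - k) / log 2 (1 + snr) \<le> hd_capacity ?C ?S ?I \<theta> / log 2 (1 + snr)"
      using elim by (intro divide_right_mono) auto
    thus ?case using elim by linarith
  qed
qed

text \<open>Makes the set of achievable rates nonempty, so that its supremum can be bounded from
  above. At rate 0 there is one message and a constant decoder never errs.\<close>

lemma hd_achievable_0: "hd_achievable C S I \<theta> 0"
proof -
  have ok: "hd_code_ok C N 1 (\<lambda>_ _. 0) (\<lambda>_ _ _. (0, False)) (\<lambda>_. 0)" for N
    by (auto simp: hd_code_ok_def relay_input_def space_pair_measure split_beta')
  have err: "hd_err_prob C S I \<theta> N 1 x rl (\<lambda>_. 0) = 0" for N x rl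
    by (simp add: hd_err_prob_def)
  show ?thesis
    unfolding hd_achievable_def Let_def
  proof (intro allI impI)
    fix \<epsilon> :: real and N0 :: nat
    assume "\<epsilon> > 0"
    have "nat \<lceil>2 powr (real (Suc N0) * 0)\<rceil> = 1" by simp
    thus "\<exists>N\<ge>N0. N > 0 \<and> (\<exists>x rl dec. hd_code_ok C N (nat \<lceil>2 powr (real N * 0)\<rceil>) x rl dec
        \<and> hd_err_prob C S I \<theta> N (nat \<lceil>2 powr (real N * 0)\<rceil>) x rl dec \<le> \<epsilon>)"
      using ok err \<open>\<epsilon> > 0\<close> by (intro exI[of _ "Suc N0"]) (metis le_SucI less_imp_le order_refl zero_less_Suc)
  qed
qed

text \<open>Each logarithm is at most ln 3 plus the largest exponent times \<open>ln snr\<close>.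
  The hypotheses \<open>d1\<close> and \<open>d2\<close> are the weighted cut bounds in exponents,
  at listening fractions 1 and 0.\<close>

lemma capacity_power_gains_le:
  assumes \<beta>: "\<beta>sd \<ge> 0" "\<beta>rd \<ge> 0" "\<beta>sr \<ge> 0" and snr: "snr \<ge> 1" and w: "0 \<le> w" "w \<le> 1"
    and d1: "w * max \<beta>sr \<beta>sd + (1 - w) * \<beta>sd \<le> d" and d2: "w * \<beta>sd + (1 - w) * max \<beta>sd \<beta>rd \<le> d"
  shows "hd_capacity (snr powr \<beta>sr) (snr powr \<beta>sd) (snr powr \<beta>rd) \<theta> \<le> (37 + ln 3 + d * ln snr) / ln 2"
  unfolding hd_capacity_def
proof (rule cSup_least)
  show "{R. hd_achievable (snr powr \<beta>sr) (snr powr \<beta>sd) (snr powr \<beta>rd) \<theta> R} \<noteq> {}"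
    using hd_achievable_0 by blast
  fix R assume "R \<in> {R. hd_achievable (snr powr \<beta>sr) (snr powr \<beta>sd) (snr powr \<beta>rd) \<theta> R}"
  hence R: "R * ln 2 \<le> 37 + max (w * ln (1 + snr powr \<beta>sr + snr powr \<beta>sd) + (1 - w) * ln (1 + snr powr \<beta>sd))
      (w * ln (1 + snr powr \<beta>sd) + (1 - w) * ln (1 + snr powr \<beta>sd + snr powr \<beta>rd))"
    using w by (intro achievable_rate_le) auto
  have ln_snr: "ln snr \<ge> 0" using snr by simp
  have ln_le: "ln x \<le> ln 3 + b * ln snr" if "0 < x" "x \<le> 3 * snr powr b" for x b
  proof -
    have "ln x \<le> ln (3 * snr powr b)" using that by (subst ln_le_cancel_iff) auto
    thus ?thesis using snr by (simp add: ln_mult ln_powr)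
  qed
  have one: "1 \<le> snr powr b" if "b \<ge> 0" for b using that snr by (simp add: ge_one_powr_ge_zero)
  have mono: "snr powr b \<le> snr powr b'" if "b \<le> b'" for b b' using that snr by (rule powr_mono)
  have pos: "snr powr b > 0" for b using snr by simp
  have A0: "ln (1 + snr powr \<beta>sd) \<le> ln 3 + \<beta>sd * ln snr"
    using one[OF \<beta>(1)] pos[of \<beta>sd] by (intro ln_le) linarith+
  have A1: "ln (1 + snr powr \<beta>sr + snr powr \<beta>sd) \<le> ln 3 + max \<beta>sr \<beta>sd * ln snr"
    using one[of "max \<beta>sr \<beta>sd"] \<beta> mono[of \<beta>sr "max \<beta>sr \<beta>sd"] mono[of \<beta>sd "max \<beta>sr \<beta>sd"] pos[of \<beta>sd] pos[of \<beta>sr]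
    by (intro ln_le) linarith+
  have A2: "ln (1 + snr powr \<beta>sd + snr powr \<beta>rd) \<le> ln 3 + max \<beta>sd \<beta>rd * ln snr"
    using one[of "max \<beta>sd \<beta>rd"] \<beta> mono[of \<beta>rd "max \<beta>sd \<beta>rd"] mono[of \<beta>sd "max \<beta>sd \<beta>rd"] pos[of \<beta>sd] pos[of \<beta>rd]
    by (intro ln_le) linarith+
  have "w * ln (1 + snr powr \<beta>sr + snr powr \<beta>sd) + (1 - w) * ln (1 + snr powr \<beta>sd)
      \<le> w * (ln 3 + max \<beta>sr \<beta>sd * ln snr) + (1 - w) * (ln 3 + \<beta>sd * ln snr)"
    using w A0 A1 by (intro add_mono mult_left_mono) auto
  also have "\<dots> = ln 3 + (w * max \<beta>sr \<beta>sd + (1 - w) * \<beta>sd) * ln snr" by (simp add: algebra_simps)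
  also have "\<dots> \<le> ln 3 + d * ln snr" using d1 ln_snr by (intro add_left_mono mult_right_mono) auto
  finally have 1: "w * ln (1 + snr powr \<beta>sr + snr powr \<beta>sd) + (1 - w) * ln (1 + snr powr \<beta>sd) \<le> ln 3 + d * ln snr" .
  have "w * ln (1 + snr powr \<beta>sd) + (1 - w) * ln (1 + snr powr \<beta>sd + snr powr \<beta>rd)
      \<le> w * (ln 3 + \<beta>sd * ln snr) + (1 - w) * (ln 3 + max \<beta>sd \<beta>rd * ln snr)"
    using w A0 A2 by (intro add_mono mult_left_mono) auto
  also have "\<dots> = ln 3 + (w * \<beta>sd + (1 - w) * max \<beta>sd \<beta>rd) * ln snr" by (simp add: algebra_simps)
  also have "\<dots> \<le> ln 3 + d * ln snr" using d2 ln_snr by (intro add_left_mono mult_right_mono) auto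
  finally have "R * ln 2 \<le> 37 + ln 3 + d * ln snr" using R 1 by linarith
  thus "R \<le> (37 + ln 3 + d * ln snr) / ln 2" by (simp add: le_divide_eq)
qed

theorem theorem1:
  fixes \<beta>sd \<beta>rd \<beta>sr \<theta> :: real
  assumes "\<beta>sd \<ge> 0" and "\<beta>rd \<ge> 0" and "\<beta>sr \<ge> 0"
  shows "((\<lambda>snr. hd_capacity (snr powr \<beta>sr) (snr powr \<beta>sd) (snr powr \<beta>rd) \<theta> / log 2 (1 + snr))
          \<longlongrightarrow> (if \<beta>sr > \<beta>sd \<and> \<beta>rd > \<beta>sd
               then \<beta>sd + ((\<beta>rd - \<beta>sd) * (\<beta>sr - \<beta>sd)) / ((\<beta>rd - \<beta>sd) + (\<beta>sr - \<beta>sd))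
               else \<beta>sd)) at_top"
    (is "(?f \<longlongrightarrow> ?d) at_top")
proof (rule order_tendstoI)
  define a b where "a = \<beta>sr - \<beta>sd" and "b = \<beta>rd - \<beta>sd"
  fix \<rho> assume \<rho>: "\<rho> < ?d"
  show "\<forall>\<^sub>F snr in at_top. \<rho> < ?f snr"
  proof (cases "\<beta>sr > \<beta>sd \<and> \<beta>rd > \<beta>sd")
    case True
    hence ab: "a > 0" "b > 0" by (auto simp: a_def b_def)
    \<comment> \<open>The listening fraction at which the residues, \<open>a\<close> per listening
      slot, exactly fill the surplus \<open>b\<close> of the relay per forwarding slot.\<close>
    define q where "q = b / (a + b)"
    have q: "0 < q" "q < 1" using ab by (auto simp: q_def)
    have d: "?d = \<beta>sd + q * a"
      using True by (simp add: q_def a_def b_def add.commute)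
    define \<eta> where "\<eta> = \<beta>sd + q * a - \<rho>"
    have "\<eta> > 0" using \<rho> d by (simp add: \<eta>_def)
    \<comment> \<open>Rounding the listening time costs at most one slot, that is
      \<open>a / T\<close>, which has to be below the gap \<open>\<eta>\<close>.\<close>
    obtain T0 :: nat where "a / \<eta> < real T0" using reals_Archimedean2 by blast
    define T where "T = Suc T0"
    have T: "real T > 0" "a / \<eta> < real T" using \<open>a / \<eta> < real T0\<close> by (simp_all add: T_def)
    \<comment> \<open>The largest integer strictly below \<open>q * T\<close>; strictness provides
      the surplus that \<open>capacity_ratio_gt\<close> requires.\<close>
    define T1 where "T1 = nat (\<lceil>q * real T\<rceil> - 1)"
    have "q * real T > 0" using q T by simp
    hence T1: "q * real T - 1 \<le> real T1" "real T1 < q * real T" unfolding T1_def by linarith+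
    have "q * real T < 1 * real T" using q T by (intro mult_strict_right_mono) auto
    hence le: "T1 \<le> T" using T1 by linarith
    define T2 where "T2 = T - T1"
    have sum: "T1 + T2 = T" "real T2 = real T - real T1" using le by (simp_all add: T2_def)
    show ?thesis
    proof (rule capacity_ratio_gt[where ?T1.0 = T1 and ?T2.0 = T2])
      show "T1 + T2 > 0" unfolding sum(1) by (simp add: T_def)
      have "real T1 * (a + b) < q * real T * (a + b)" using T1 ab by (intro mult_strict_right_mono) auto
      also have "\<dots> = real T * b" using ab by (simp add: q_def)
      finally have "real T1 * a < real T2 * b" unfolding sum by (simp add: algebra_simps)
      thus "\<beta>sr > \<beta>sd \<and> real T1 * (\<beta>sr - \<beta>sd) < real T2 * (\<beta>rd - \<beta>sd)"
        using True by (simp add: a_def b_def)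
      have "\<rho> = \<beta>sd + q * a - \<eta>" by (simp add: \<eta>_def)
      also have "\<dots> < \<beta>sd + q * a - a / real T"
        using T \<open>\<eta> > 0\<close> by (simp add: field_simps)
      also have "\<dots> = \<beta>sd + (q * real T - 1) * a / real T"
        using T by (simp add: field_simps)
      also have "\<dots> \<le> \<beta>sd + real T1 * a / real T"
        using T1 ab T by (intro add_left_mono divide_right_mono mult_right_mono) auto
      also have "\<dots> = (real T1 * \<beta>sr + real T2 * \<beta>sd) / real (T1 + T2)"
        using T unfolding sum by (simp add: a_def field_simps)
      finally show "\<rho> < (real T1 * \<beta>sr + real T2 * \<beta>sd) / real (T1 + T2)" .
    qed (use assms in auto)
  next
    case False
    \<comment> \<open>Direct transmission: frames of one slot without listening.\<close>
    thus ?thesis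
      using \<rho> assms by (intro capacity_ratio_gt[where ?T1.0 = 0 and ?T2.0 = 1]) auto
  qed
next
  define a b where "a = \<beta>sr - \<beta>sd" and "b = \<beta>rd - \<beta>sd"
  fix \<rho> assume \<rho>: "?d < \<rho>"
  obtain w where w: "0 \<le> w" "w \<le> 1" "w * max \<beta>sr \<beta>sd + (1 - w) * \<beta>sd \<le> ?d"
    "w * \<beta>sd + (1 - w) * max \<beta>sd \<beta>rd \<le> ?d"
  proof (cases "\<beta>sr > \<beta>sd \<and> \<beta>rd > \<beta>sd")
    case True
    hence ab: "a > 0" "b > 0" by (auto simp: a_def b_def)
    \<comment> \<open>With this weight the bounds at listening fractions 1 and 0 coincide, and both
      equal \<open>?d\<close>.\<close>
    define q where "q = b / (a + b)"
    have d: "?d = \<beta>sd + q * a" using True by (simp add: q_def a_def b_def add.commute)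
    have "(1 - q) * b = q * a" using ab by (simp add: q_def field_simps)
    hence "q * \<beta>sd + (1 - q) * max \<beta>sd \<beta>rd = \<beta>sd + q * a" using True by (simp add: b_def algebra_simps max_def)
    moreover have "q * max \<beta>sr \<beta>sd + (1 - q) * \<beta>sd = \<beta>sd + q * a"
      using True by (simp add: a_def algebra_simps max_def)
    ultimately show ?thesis using ab d by (intro that[of q]) (auto simp: q_def)
  next
    case False
    \<comment> \<open>If the source-relay link is no better than the direct one, the broadcast cut
      alone gives \<open>\<beta>sd\<close>; otherwise the relay-destination link is no better, and
      the multiple-access cut alone does.\<close>
    thus ?thesis
      using that[of 1] that[of 0] by (cases "\<beta>sr > \<beta>sd") (auto simp: max_def)
  qed
  have "((\<lambda>snr. (37 + ln 3 + ?d * ln snr) / ln (1 + snr)) \<longlongrightarrow> ?d) at_top"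
  proof -
    have "((\<lambda>snr::real. ln snr / ln (1 + snr)) \<longlongrightarrow> 1) at_top"
      and "((\<lambda>snr::real. 1 / ln (1 + snr)) \<longlongrightarrow> 0) at_top"
      by real_asymp+
    hence "((\<lambda>snr::real. (37 + ln 3) * (1 / ln (1 + snr)) + ?d * (ln snr / ln (1 + snr)))
        \<longlongrightarrow> (37 + ln 3) * 0 + ?d * 1) at_top"
      by (intro tendsto_intros)
    thus ?thesis by (simp only: times_divide_eq_right mult_1_right mult_zero_right add_0 add_divide_distrib)
  qed
  hence "\<forall>\<^sub>F snr in at_top. (37 + ln 3 + ?d * ln snr) / ln (1 + snr) < \<rho>"
    using \<rho> by (rule order_tendstoD)
  thus "\<forall>\<^sub>F snr in at_top. ?f snr < \<rho>"
    using eventually_ge_at_top[of 1]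
  proof eventually_elim
    case (elim snr)
    have "?f snr \<le> (37 + ln 3 + ?d * ln snr) / ln 2 / log 2 (1 + snr)"
      using assms w elim by (intro divide_right_mono capacity_power_gains_le) auto
    also have "\<dots> = (37 + ln 3 + ?d * ln snr) / ln (1 + snr)"
      by (simp add: log_def)
    finally show ?case using elim by linarith
  qed
qed

end
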